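(* There exists a constant $\mathscr{C}>0$ such that for every real number $C\geq\mathscr{C}$ and every integer $t\geq 1$, there exists a simple $t$-design curve on $S^3$ of length $Ct^2$.
   Context: $S^d\subset\mathbb{R}^{d+1}$ denotes the unit sphere, $\sigma$ its standard uniform (surface) measure, and $|S^d|=\sigma(S^d)$. $P_t(S^d)$ is the space of restrictions to $S^d$ of polynomials on $\mathbb{R}^{d+1}$ of degree at most $t$. For $d\in\{1,2,\dots\}$ and $t\in\{0,1,2,\dots\}$, a $t$-design curve on $S^d$ is a continuous, piecewise smooth, closed curve $\gamma:[0,1]\to S^d$ with finitely many self-intersections such that \[\frac{1}{\ell(\gamma)}\int_0^1 f(\gamma(s))\,|\gamma'(s)|\,ds=\frac{1}{|S^d|}\int_{S^d}f\,d\sigma\quad\text{for all } f\in P_t(S^d),\] where $\ell(\gamma)=\int_0^1|\gamma'(s)|\,ds$ is the length of $\gamma$. Closed means $\gamma(0)=\gamma(1)$. A closed curve is simple if it has no self-intersections (other than the coincidence $\gamma(0)=\gamma(1)$ of its endpoints). *)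

theory Defs
  imports "HOL-Analysis.Analysis"
begin

text \<open>
  The sphere \<open>S\<^sup>d\<close> is \<open>sphere 0 1\<close> in \<open>real ^ 'n\<close> with \<open>CARD('n) = d + 1\<close>.
\<close>

text \<open>
  The surface measure, given by polar coordinates:
  \<open>\<sigma>(A) = (d + 1) \<cdot> vol {r x | x \<in> A, 0 < r \<le> 1}\<close>, i.e. the image of Lebesgue measure on the
  punctured unit ball under \<open>x \<mapsto> x / |x|\<close>, scaled by \<open>d + 1\<close>. Its underlying space is the
  sphere itself, so integrals against it ignore values of the integrand off the sphere.
\<close>

definition sphere_measure :: "(real ^ 'n::finite) measure" where
  "sphere_measure =
     scale_measure (of_nat CARD('n))
       (distr (restrict_space lborel (cball 0 1 - {0})) (restrict_space borel (sphere 0 1))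
         (\<lambda>x. x /\<^sub>R norm x))"

text \<open>
  The index set below consists of all exponent vectors of total degree at most \<open>t\<close>; it is finite,
  so the sum is a genuine one.
\<close>

definition polys_deg_le :: "nat \<Rightarrow> (real ^ 'n::finite \<Rightarrow> real) set" where
  "polys_deg_le t =
     {p. \<exists>c :: ('n \<Rightarrow> nat) \<Rightarrow> real.
           p = (\<lambda>x. \<Sum>\<alpha> | (\<Sum>i\<in>UNIV. \<alpha> i) \<le> t. c \<alpha> * (\<Prod>i\<in>UNIV. (x $ i) ^ \<alpha> i))}"

definition sphere_polys :: "nat \<Rightarrow> (real ^ 'n::finite \<Rightarrow> real) set" where
  "sphere_polys t = (\<lambda>p. restrict p (sphere 0 1)) ` polys_deg_le t"

text \<open>
  Smoothness (\<open>C\<^sup>\<infinity>\<close>) on a closed interval, with one-sided derivatives of all orders at its ends;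
  \<open>D k\<close> is the \<open>k\<close>-th derivative.
\<close>

definition smooth_on_interval :: "real \<Rightarrow> real \<Rightarrow> (real \<Rightarrow> 'a::real_normed_vector) \<Rightarrow> bool" where
  "smooth_on_interval a b g \<longleftrightarrow>
     (\<exists>D :: nat \<Rightarrow> real \<Rightarrow> 'a.
        (\<forall>s\<in>{a..b}. D 0 s = g s) \<and>
        (\<forall>k. \<forall>s\<in>{a..b}. (D k has_vector_derivative D (Suc k) s) (at s within {a..b})))"

definition piecewise_smooth :: "(real \<Rightarrow> 'a::real_normed_vector) \<Rightarrow> bool" where
  "piecewise_smooth g \<longleftrightarrow>
     (\<exists>(m::nat) a :: nat \<Rightarrow> real. a 0 = 0 \<and> a m = 1 \<and>
        (\<forall>i<m. a i < a (Suc i) \<and> smooth_on_interval (a i) (a (Suc i)) g))"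

text \<open>
  At the finitely many break points of a piecewise smooth curve the value of \<open>speed\<close> is
  irrelevant, since it is only ever integrated.
\<close>

definition speed :: "(real \<Rightarrow> 'a::real_normed_vector) \<Rightarrow> real \<Rightarrow> real" where
  "speed g s = norm (vector_derivative g (at s within {0..1}))"

definition curve_length :: "(real \<Rightarrow> 'a::real_normed_vector) \<Rightarrow> real" where
  "curve_length g = integral {0..1} (speed g)"

text \<open>
  Self-intersections as pairs of parameters with the same image, the coincidence of the end points
  of a closed curve not being counted.
\<close>

definition self_intersections :: "(real \<Rightarrow> 'a) \<Rightarrow> (real \<times> real) set" where
  "self_intersections g =
     {(s, u). 0 \<le> s \<and> s < u \<and> u \<le> 1 \<and> g s = g u \<and> \<not> (s = 0 \<and> u = 1)}"

definition design_curve :: "nat \<Rightarrow> (real \<Rightarrow> real ^ 'n::finite) \<Rightarrow> bool" where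
  "design_curve t g \<longleftrightarrow>
     path g \<and> path_image g \<subseteq> sphere 0 1 \<and> piecewise_smooth g \<and> pathstart g = pathfinish g \<and>
     finite (self_intersections g) \<and>
     (\<forall>f \<in> sphere_polys t.
        (1 / curve_length g) * integral {0..1} (\<lambda>s. f (g s) * speed g s) =
        (1 / measure (sphere_measure :: (real ^ 'n) measure) (sphere 0 1)) *
          integral\<^sup>L sphere_measure f)"

end

theory Submission
  imports Defs
begin

text \<open>
  A curve that is exact for a torus action is easy to write down: on the torus of all
  \<open>(cos \<eta> e\<^sup>i\<^sup>\<alpha>, sin \<eta> e\<^sup>i\<^sup>\<beta>)\<close> the knot of slope \<open>(1, 2t + 1)\<close> or \<open>(2t + 1, 1)\<close> averages every nonconstant character of degree at
  most \<open>2t\<close> to zero, so a positive quadrature rule in \<open>u = sin\<^sup>2 \<eta>\<close>, which is uniformly distributed on \<open>[0, 1]\<close>,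
  gives weights on \<open>O(t)\<close> knots of length \<open>O(t)\<close> that are exact for polynomials of degree \<open>2t\<close>. With the nodes
  \<open>2\<eta> = k\<pi>/(2J)\<close> the weights dominate the lengths of the knots up to a factor \<open>O(t\<^sup>2)\<close>, even after a
  bounded multiple of the unit circle \<open>\<eta> = 0\<close> has been added to the rule. Two copies of this configuration, one of
  them reflected, are connected: the circle \<open>\<eta> = 0\<close> of each copy meets all knots of the other.

  Hence \<open>C t\<^sup>2\<close> times the mean over the sphere is the arc length of a closed polygon through the nodes plus point
  masses at the nodes, bounded below independently of the mesh. Moving the vertices to general position makes the
  polygon simple. The point masses are produced by replacing an edge near each node with a wave of small amplitude and
  large frequency; if the amplitudes are small enough the curve stays simple for all of them. The moments depend
  continuously on the amplitudes and are, up to a small error, linear in the gained lengths, so the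
  Poincare--Miranda theorem finds amplitudes for which all moments are exact.
\<close>

section \<open>The Poincare--Miranda theorem and general position\<close>

text \<open>The obstacle is that making a curve simple moves it, and this destroys any exact
  identity it satisfied. Therefore every loop is given strictly more weight than its length, and the
  surplus is a reserve: its lower bound is fixed before the mesh, so the errors of sampling, of the
  perturbation and of the waves can all be pushed below it. The amplitudes then only have to solve a
  system with the right signs on the faces of a box; no derivative in the amplitudes is controlled.
  That system is close to diagonal because the moments are those of a Lagrange basis on a subset of
  the nodes. Exactness in degree 2t, not only t, makes this basis complete: a polynomial of degree t
  vanishing at the nodes has a square of mean 0, so it vanishes on the sphere. Within one copy the
  loops lie on disjoint tori, and a connecting path would add length that no weight accounts for.
  With a second copy the connections are points on loops that belong to the rule, and cost nothing.
  The length is not adjusted separately: it is the moment of the constant 1, and any total mass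
  above the threshold is admissible.\<close>

lemma compact_box_fun:
  fixes b :: "nat \<Rightarrow> real"
  shows "compact {x. \<forall>i. 0 \<le> x i \<and> x i \<le> b i}"
proof -
  have "compactin (product_topology (\<lambda>i::nat. euclidean :: real topology) UNIV) (PiE UNIV (\<lambda>i. {0..b i}))"
    by (subst compactin_PiE) auto
  moreover have "PiE UNIV (\<lambda>i. {0..b i}) = {x. \<forall>i. 0 \<le> x i \<and> x i \<le> b i}"
    by (auto simp: PiE_def Pi_def)
  ultimately show ?thesis
    by (simp add: euclidean_product_topology)
qed

lemma tendsto_fun_componentwise:
  fixes X :: "nat \<Rightarrow> nat \<Rightarrow> real"
  assumes "\<And>j. (\<lambda>k. X k j) \<longlonglongrightarrow> l j"
  shows "X \<longlonglongrightarrow> l"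
proof -
  have "limitin (product_topology (\<lambda>i::nat. euclidean :: real topology) UNIV) X l sequentially"
    using assms by (simp add: limitin_componentwise)
  then show ?thesis by (simp add: euclidean_product_topology)
qed

text \<open>The signs of the \<open>G i\<close> label a grid of mesh 1/(k + 1), and the signs on the
  faces are the boundary conditions of \<open>kuhn_lemma\<close>. It yields a cell where every
  \<open>G i\<close> takes a value \<le> 0 and a value \<ge> 0; the cells shrink to a point where
  all \<open>G i\<close> vanish. Points are functions on \<open>nat\<close>, so that the number of
  unknowns is a term and not a type.\<close>

theorem poincare_miranda:
  fixes n :: nat and b :: "nat \<Rightarrow> real" and G :: "nat \<Rightarrow> (nat \<Rightarrow> real) \<Rightarrow> real"
  assumes b: "\<And>i. i < n \<Longrightarrow> 0 < b i"
    and cont: "\<And>i. i < n \<Longrightarrow> continuous_on UNIV (G i)"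
    and lo: "\<And>i x. i < n \<Longrightarrow> \<forall>j<n. 0 \<le> x j \<and> x j \<le> b j \<Longrightarrow> x i = 0 \<Longrightarrow> G i x < 0"
    and hi: "\<And>i x. i < n \<Longrightarrow> \<forall>j<n. 0 \<le> x j \<and> x j \<le> b j \<Longrightarrow> x i = b i \<Longrightarrow> G i x > 0"
  shows "\<exists>x. (\<forall>i<n. 0 \<le> x i \<and> x i \<le> b i) \<and> (\<forall>i<n. G i x = 0)"
proof -
  \<comment> \<open>Coordinates from \<open>n\<close> on are 0, so all grid points lie in one
    compact box of the function space.\<close>
  define P where "P p q = (\<lambda>i. if i < n then b i * (real (q i) / real p) else 0)" for p :: nat and q :: "nat \<Rightarrow> nat"
  have Pbox: "\<forall>j<n. 0 \<le> P p q j \<and> P p q j \<le> b j" if "0 < p" "\<forall>j<n. q j \<le> p" for p q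
    using that b by (auto simp: P_def divide_simps less_imp_le mult_left_mono)
  have cell: "\<exists>q. (\<forall>i<n. q i < Suc k) \<and>
      (\<forall>i<n. \<exists>r s. (\<forall>j<n. q j \<le> r j \<and> r j \<le> q j + 1) \<and> (\<forall>j<n. q j \<le> s j \<and> s j \<le> q j + 1) \<and>
         G i (P (Suc k) r) \<le> 0 \<and> 0 \<le> G i (P (Suc k) s))" for k
  proof -
    define label where "label r i = (if G i (P (Suc k) r) \<le> 0 then 0 else 1::nat)" for r i
    have "\<forall>x. (\<forall>i<n. x i \<le> Suc k) \<longrightarrow> (\<forall>i<n. label x i = 0 \<or> label x i = 1)"
      by (simp add: label_def)
    moreover have "\<forall>x. (\<forall>i<n. x i \<le> Suc k) \<longrightarrow> (\<forall>i<n. x i = 0 \<longrightarrow> label x i = 0)"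
    proof (intro allI impI)
      fix x i assume *: "\<forall>i<n. x i \<le> Suc k" "i < n" "x i = 0"
      have "G i (P (Suc k) x) < 0"
        by (rule lo[OF \<open>i < n\<close> Pbox]) (use * in \<open>auto simp: P_def\<close>)
      then show "label x i = 0" by (simp add: label_def)
    qed
    moreover have "\<forall>x. (\<forall>i<n. x i \<le> Suc k) \<longrightarrow> (\<forall>i<n. x i = Suc k \<longrightarrow> label x i = 1)"
    proof (intro allI impI)
      fix x i assume *: "\<forall>i<n. x i \<le> Suc k" "i < n" "x i = Suc k"
      have "G i (P (Suc k) x) > 0"
        by (rule hi[OF \<open>i < n\<close> Pbox]) (use * in \<open>auto simp: P_def\<close>)
      then show "label x i = 1" by (simp add: label_def)
    qed
    ultimately obtain q where q: "\<forall>i<n. q i < Suc k"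
       "\<forall>i<n. \<exists>r s. (\<forall>j<n. q j \<le> r j \<and> r j \<le> q j + 1) \<and> (\<forall>j<n. q j \<le> s j \<and> s j \<le> q j + 1) \<and> label r i \<noteq> label s i"
      by (rule kuhn_lemma[of "Suc k" n label, OF zero_less_Suc])
    show ?thesis
    proof (rule exI[of _ q], intro conjI allI impI)
      fix i assume "i < n"
      then obtain r s where rs: "\<forall>j<n. q j \<le> r j \<and> r j \<le> q j + 1" "\<forall>j<n. q j \<le> s j \<and> s j \<le> q j + 1" "label r i \<noteq> label s i"
        using q(2) by blast
      show "\<exists>r s. (\<forall>j<n. q j \<le> r j \<and> r j \<le> q j + 1) \<and> (\<forall>j<n. q j \<le> s j \<and> s j \<le> q j + 1) \<and>
         G i (P (Suc k) r) \<le> 0 \<and> 0 \<le> G i (P (Suc k) s)"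
      proof (cases "G i (P (Suc k) r) \<le> 0")
        case True
        then show ?thesis using rs by (intro exI[of _ r] exI[of _ s]) (auto simp: label_def split: if_splits)
      next
        case False
        then show ?thesis using rs by (intro exI[of _ s] exI[of _ r]) (auto simp: label_def split: if_splits)
      qed
    qed (use q in auto)
  qed
  define C where "C k q i r s \<longleftrightarrow> (\<forall>j<n. q j \<le> r j \<and> r j \<le> q j + 1) \<and> (\<forall>j<n. q j \<le> s j \<and> s j \<le> q j + 1) \<and>
         G i (P (Suc k) r) \<le> 0 \<and> 0 \<le> G i (P (Suc k) s)" for k i and q r s :: "nat \<Rightarrow> nat"
  from cell have "\<forall>k. \<exists>q. (\<forall>i<n. q i < Suc k) \<and> (\<forall>i<n. \<exists>r s. C k q i r s)" unfolding C_def ..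
  from choice[OF this] obtain q where Q: "\<forall>k. (\<forall>i<n. q k i < Suc k) \<and> (\<forall>i<n. \<exists>r s. C k (q k) i r s)" ..
  define r where "r k i = (SOME r. \<exists>s. C k (q k) i r s)" for k i
  define s where "s k i = (SOME s. C k (q k) i (r k i) s)" for k i
  have q: "q k i < Suc k" if "i < n" for k i using Q that by simp
  have C: "C k (q k) i (r k i) (s k i)" if "i < n" for k i
  proof -
    have "\<exists>r s. C k (q k) i r s" using Q that by simp
    then have "\<exists>s. C k (q k) i (r k i) s" unfolding r_def by (rule someI_ex)
    then show ?thesis unfolding s_def by (rule someI_ex)
  qed
  have rs:
     "\<And>k i j. i < n \<Longrightarrow> j < n \<Longrightarrow> q k j \<le> r k i j \<and> r k i j \<le> q k j + 1"
     "\<And>k i j. i < n \<Longrightarrow> j < n \<Longrightarrow> q k j \<le> s k i j \<and> s k i j \<le> q k j + 1"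
     "\<And>k i. i < n \<Longrightarrow> G i (P (Suc k) (r k i)) \<le> 0"
     "\<And>k i. i < n \<Longrightarrow> 0 \<le> G i (P (Suc k) (s k i))"
    using C unfolding C_def by auto
  define z where "z k = P (Suc k) (q k)" for k
  define B where "B = (\<lambda>i. if i < n then b i else 0)"
  have "z k \<in> {x. \<forall>i. 0 \<le> x i \<and> x i \<le> B i}" for k
  proof -
    have "\<forall>j<n. q k j \<le> Suc k" using q[of _ k] by (auto intro: less_imp_le)
    from Pbox[OF _ this] show ?thesis by (auto simp: z_def B_def) (auto simp: P_def)
  qed
  moreover have "seq_compact {x. \<forall>i. 0 \<le> x i \<and> x i \<le> B i}"
    by (rule compact_imp_seq_compact[OF compact_box_fun])
  ultimately obtain l \<phi> where l: "l \<in> {x. \<forall>i. 0 \<le> x i \<and> x i \<le> B i}" "strict_mono (\<phi> :: nat \<Rightarrow> nat)" "(z \<circ> \<phi>) \<longlonglongrightarrow> l"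
    by (elim seq_compactE[of _ z]) auto
  have zj: "(\<lambda>k. z (\<phi> k) j) \<longlonglongrightarrow> l j" for j
  proof -
    have "continuous_on UNIV (\<lambda>f::nat\<Rightarrow>real. f j)" by (simp add: continuous_on_product_then_coordinatewise)
    from continuous_on_tendsto_compose[OF this l(3)] show ?thesis by (simp add: o_def)
  qed
  \<comment> \<open>Any choice of corners of the cells has the same limit, as the side of a cell in
    direction \<open>j\<close> is \<open>b j\<close> divided by k + 1.\<close>
  have near: "(\<lambda>k. P (Suc (\<phi> k)) (u (\<phi> k))) \<longlonglongrightarrow> l"
    if u: "\<And>k j. j < n \<Longrightarrow> q k j \<le> u k j \<and> u k j \<le> q k j + 1" for u
  proof (rule tendsto_fun_componentwise)
    fix j
    show "(\<lambda>k. P (Suc (\<phi> k)) (u (\<phi> k)) j) \<longlonglongrightarrow> l j"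
    proof (cases "j < n")
      case False
      then have "l j = 0" using l(1) by (force simp: B_def intro: antisym)
      then show ?thesis using False by (simp add: P_def)
    next
      case True
      have bd: "norm (P (Suc (\<phi> k)) (u (\<phi> k)) j - z (\<phi> k) j) \<le> b j / real (Suc (\<phi> k))" for k
      proof -
        have "P (Suc (\<phi> k)) (u (\<phi> k)) j - z (\<phi> k) j = b j * ((real (u (\<phi> k) j) - real (q (\<phi> k) j)) / real (Suc (\<phi> k)))"
          using True by (simp add: P_def z_def diff_divide_distrib right_diff_distrib)
        also have "norm \<dots> = b j * (\<bar>real (u (\<phi> k) j) - real (q (\<phi> k) j)\<bar> / real (Suc (\<phi> k)))"
          using b[OF True] by (simp add: abs_mult)
        also have "\<dots> \<le> b j * (1 / real (Suc (\<phi> k)))"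
          using u[OF True, of "\<phi> k"] b[OF True] by (intro mult_left_mono divide_right_mono) (auto)
        finally show ?thesis by simp
      qed
      have "(\<lambda>k. b j / real (Suc k)) \<longlonglongrightarrow> 0"
        using tendsto_mult_left[OF LIMSEQ_inverse_real_of_nat, of "b j"] by (simp add: divide_inverse)
      then have "(\<lambda>k. b j / real (Suc (\<phi> k))) \<longlonglongrightarrow> 0"
        by (drule_tac LIMSEQ_subseq_LIMSEQ[OF _ l(2)]) (simp add: o_def)
      then have "(\<lambda>k. P (Suc (\<phi> k)) (u (\<phi> k)) j - z (\<phi> k) j) \<longlonglongrightarrow> 0"
        by (rule Lim_null_comparison[OF always_eventually[OF allI[OF bd]]])
      from tendsto_add[OF this zj[of j]] show ?thesis by simp
    qed
  qed
  have "G i l = 0" if "i < n" for i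
  proof -
    have c: "(\<lambda>k. G i (X k)) \<longlonglongrightarrow> G i l" if "X \<longlonglongrightarrow> l" for X
      using continuous_on_tendsto_compose[OF cont[OF \<open>i < n\<close>] that] by simp
    have "(\<lambda>k. P (Suc (\<phi> k)) (r (\<phi> k) i)) \<longlonglongrightarrow> l"
      by (rule near) (rule rs(1)[OF that])
    from c[OF this] have "G i l \<le> 0"
      by (rule LIMSEQ_le_const2) (blast intro: rs(3)[OF that])
    moreover have "(\<lambda>k. P (Suc (\<phi> k)) (s (\<phi> k) i)) \<longlonglongrightarrow> l"
      by (rule near) (rule rs(2)[OF that])
    from c[OF this] have "0 \<le> G i l"
      by (rule LIMSEQ_le_const) (blast intro: rs(4)[OF that])
    ultimately show ?thesis by simp
  qed
  moreover have "\<forall>i<n. 0 \<le> l i \<and> l i \<le> b i" using l(1) by (auto simp: B_def split: if_splits)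
  ultimately show ?thesis by blast
qed

text \<open>The points are chosen one after another outside the spans of at most three earlier ones,
  which are finitely many null sets because the dimension is at least 4. In a vanishing combination
  of at most four points, the last one with nonzero coefficient would lie in such a span.\<close>

lemma general_position:
  fixes x :: "nat \<Rightarrow> 'a::euclidean_space"
  assumes dim: "4 \<le> DIM('a)" and e: "0 < e"
  shows "\<exists>p. (\<forall>i. norm (p i - x i) < e) \<and>
    (\<forall>I c. finite I \<longrightarrow> card I \<le> 4 \<longrightarrow> (\<Sum>i\<in>I. c i *\<^sub>R p i) = 0 \<longrightarrow> (\<forall>i\<in>I. c i = 0))"
proof -
  define P where "P f i r \<longleftrightarrow> norm (r - x i) < e \<and> (\<forall>J. J \<subseteq> {..<i} \<longrightarrow> card J \<le> 3 \<longrightarrow> r \<notin> span (f ` J))"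
    for f :: "nat \<Rightarrow> 'a" and i :: nat and r :: 'a
  have "\<exists>p. \<forall>i. P p i (p i)"
  proof (rule dependent_wellorder_choice)
    fix r and f g :: "nat \<Rightarrow> 'a" and i :: nat
    assume "\<And>y. y < i \<Longrightarrow> f y = g y"
    then have "f ` J = g ` J" if "J \<subseteq> {..<i}" for J using that by (intro image_cong) auto
    then show "P f i r = P g i r" by (auto simp: P_def)
  next
    fix i :: nat and f :: "nat \<Rightarrow> 'a"
    define U where "U = (\<Union>J\<in>{J. J \<subseteq> {..<i} \<and> card J \<le> 3}. span (f ` J))"
    have "negligible (span (f ` J))" if "J \<subseteq> {..<i}" "card J \<le> 3" for J
    proof (rule negligible_lowdim)
      have "finite J" using that finite_subset by blast
      then have "dim (f ` J) \<le> card (f ` J)" by (intro dim_le_card') auto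
      also have "\<dots> \<le> card J" using \<open>finite J\<close> card_image_le by blast
      finally show "dim (span (f ` J)) < DIM('a)" using that dim by (simp add: dim_span)
    qed
    then have "negligible U" unfolding U_def
      by (intro negligible_Union) auto
    moreover have "\<not> negligible (ball (x i) e)" using e by (simp add: open_not_negligible)
    ultimately obtain r where "r \<in> ball (x i) e" "r \<notin> U"
      by (meson negligible_subset subsetI)
    then show "\<exists>r. P f i r" by (auto simp: P_def U_def dist_norm norm_minus_commute)
  qed
  then obtain p where p: "\<And>i. norm (p i - x i) < e" "\<And>i J. J \<subseteq> {..<i} \<Longrightarrow> card J \<le> 3 \<Longrightarrow> p i \<notin> span (p ` J)"
    by (auto simp: P_def)
  have "\<forall>i\<in>I. c i = 0" if I: "finite I" "card I \<le> 4" "(\<Sum>i\<in>I. c i *\<^sub>R p i) = 0" for I c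
  proof (rule ccontr)
    assume "\<not> (\<forall>i\<in>I. c i = 0)"
    define K where "K = {i\<in>I. c i \<noteq> 0}"
    have K: "finite K" "K \<noteq> {}" using I \<open>\<not> _\<close> by (auto simp: K_def)
    define m where "m = Max K"
    have m: "m \<in> K" using K m_def by auto
    define J where "J = K - {m}"
    have J: "J \<subseteq> {..<m}" using K Max_ge[OF K(1)] unfolding J_def m_def by (fastforce simp: order.strict_iff_order)
    have "card K \<le> 4" using I card_mono[of I K] by (auto simp: K_def)
    then have cJ: "card J \<le> 3" using m K by (simp add: J_def)
    have "0 = (\<Sum>i\<in>K. c i *\<^sub>R p i)"
      using I by (subst I(3)[symmetric], intro sum.mono_neutral_right) (auto simp: K_def)
    also have "\<dots> = c m *\<^sub>R p m + (\<Sum>i\<in>J. c i *\<^sub>R p i)"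
      using K m by (simp add: J_def sum.remove)
    finally have eq: "c m *\<^sub>R p m = - (\<Sum>i\<in>J. c i *\<^sub>R p i)" by (simp add: eq_neg_iff_add_eq_0)
    have "p m = (1 / c m) *\<^sub>R (c m *\<^sub>R p m)" using m by (simp add: K_def)
    also have "\<dots> \<in> span (p ` J)" unfolding eq
      by (intro span_scale span_neg span_sum) (auto intro: span_base)
    finally show False using p(2)[OF J cJ] by blast
  qed
  with p(1) show ?thesis by blast
qed

section \<open>Gluing arcs\<close>

text \<open>At \<open>s = 1\<close> the index is \<open>M\<close> and the local parameter 0, so the
  end value is \<open>c M 0\<close>. Hence \<open>joins\<close> reaches the arc of index
  \<open>M\<close>, and closedness reads \<open>c M 0 = c 0 0\<close>.\<close>

definition glue :: "nat \<Rightarrow> (nat \<Rightarrow> real \<Rightarrow> 'a) \<Rightarrow> real \<Rightarrow> 'a" where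
  "glue M c s = c (nat \<lfloor>real M * s\<rfloor>) (frac (real M * s))"

locale glued_arcs =
  fixes M :: nat and c c' :: "nat \<Rightarrow> real \<Rightarrow> 'a::euclidean_space"
  assumes M: "0 < M"
    and joins: "\<And>i. i < M \<Longrightarrow> c i 1 = c (Suc i) 0"
    and deriv: "\<And>i x. i < M \<Longrightarrow> x \<in> {0..1} \<Longrightarrow> (c i has_vector_derivative c' i x) (at x within {0..1})"
    and cont_deriv: "\<And>i. i < M \<Longrightarrow> continuous_on {0..1} (c' i)"
begin

lemma glue_piece:
  assumes i: "i < M" and s: "real i / real M \<le> s" "s \<le> real (Suc i) / real M"
  shows "glue M c s = c i (real M * s - real i)" "real M * s - real i \<in> {0..1}"
proof -
  have b: "real i \<le> real M * s" "real M * s \<le> real i + 1"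
    using s M by (auto simp: field_simps)
  then show "real M * s - real i \<in> {0..1}" by auto
  show "glue M c s = c i (real M * s - real i)"
  proof (cases "real M * s = real i + 1")
    case True
    then have "\<lfloor>real M * s\<rfloor> = int (Suc i)" by (simp add: floor_eq_iff)
    then have "nat \<lfloor>real M * s\<rfloor> = Suc i" by (simp only: nat_int)
    then show ?thesis using joins[OF i] True by (simp add: glue_def frac_def)
  next
    case False
    then have "\<lfloor>real M * s\<rfloor> = int i" using b by (simp add: floor_eq_iff)
    then show ?thesis by (simp add: glue_def frac_def)
  qed
qed

lemma glue_continuous_piece:
  assumes i: "i < M"
  shows "continuous_on {real i / real M..real (Suc i) / real M} (glue M c)"
proof -
  have "continuous_on {0..1} (c i)"
    using deriv[OF i] by (meson continuous_on_eq_continuous_within has_vector_derivative_continuous)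
  then have "continuous_on {real i / real M..real (Suc i) / real M} (\<lambda>s. c i (real M * s - real i))"
    by (rule continuous_on_compose2) (auto intro!: continuous_intros simp: glue_piece(2)[OF i, simplified] dest: glue_piece(2)[OF i])
  then show ?thesis
    by (rule continuous_on_eq) (simp add: glue_piece(1)[OF i])
qed

lemma glue_continuous: "continuous_on {0..1} (glue M c)"
proof -
  have "k \<le> M \<Longrightarrow> continuous_on {0..real k / real M} (glue M c)" for k
  proof (induction k)
    case (Suc k)
    have "{0..real (Suc k) / real M} = {0..real k / real M} \<union> {real k / real M..real (Suc k) / real M}"
      by (rule ivl_disj_un_two_touch(4)[symmetric]) (auto simp: divide_right_mono)
    moreover have "continuous_on ({0..real k / real M} \<union> {real k / real M..real (Suc k) / real M}) (glue M c)"
      using Suc by (intro continuous_on_closed_Un glue_continuous_piece) auto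
    ultimately show ?case by simp
  qed simp
  from this[of M] show ?thesis using M by simp
qed

lemma glue_piecewise_smooth:
  assumes "\<And>i. i < M \<Longrightarrow> smooth_on_interval 0 1 (c i)"
  shows "piecewise_smooth (glue M c)"
  unfolding piecewise_smooth_def
proof (intro exI[of _ M] exI[of _ "\<lambda>i. real i / real M"] conjI allI impI)
  fix i assume i: "i < M"
  obtain D where D: "\<And>s. s \<in> {0..1} \<Longrightarrow> D 0 s = c i s"
    "\<And>k s. s \<in> {0..1} \<Longrightarrow> (D k has_vector_derivative D (Suc k) s) (at s within {0..1})"
    using assms[OF i] unfolding smooth_on_interval_def by blast
  let ?I = "{real i / real M..real (Suc i) / real M}"
  show "smooth_on_interval (real i / real M) (real (Suc i) / real M) (glue M c)"
    unfolding smooth_on_interval_def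
  proof (intro exI[of _ "\<lambda>k s. real M ^ k *\<^sub>R D k (real M * s - real i)"] conjI ballI allI)
    fix s assume "s \<in> ?I"
    then have s: "real i / real M \<le> s" "s \<le> real (Suc i) / real M" by auto
    show "real M ^ 0 *\<^sub>R D 0 (real M * s - real i) = glue M c s"
      using glue_piece[OF i s] D(1) by simp
    fix k
    have "((\<lambda>s. real M * s - real i) has_vector_derivative real M) (at s within ?I)"
      by (auto intro!: derivative_eq_intros simp: has_real_derivative_iff_has_vector_derivative[symmetric])
    moreover have "(D k has_vector_derivative D (Suc k) (real M * s - real i)) (at (real M * s - real i) within (\<lambda>s. real M * s - real i) ` ?I)"
      by (rule has_vector_derivative_within_subset[OF D(2)]) (use glue_piece(2)[OF i] s in auto)
    ultimately have "((D k \<circ> (\<lambda>s. real M * s - real i)) has_vector_derivative real M *\<^sub>R D (Suc k) (real M * s - real i)) (at s within ?I)"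
      by (rule vector_diff_chain_within)
    then have "((\<lambda>s. real M ^ k *\<^sub>R (D k \<circ> (\<lambda>s. real M * s - real i)) s) has_vector_derivative real M ^ k *\<^sub>R (real M *\<^sub>R D (Suc k) (real M * s - real i))) (at s within ?I)"
      by (rule bounded_linear.has_vector_derivative[OF bounded_linear_scaleR_right])
    then show "((\<lambda>s. real M ^ k *\<^sub>R D k (real M * s - real i)) has_vector_derivative real M ^ Suc k *\<^sub>R D (Suc k) (real M * s - real i)) (at s within ?I)"
      by (simp add: o_def mult.commute)
  qed
qed (use M in \<open>auto simp: divide_strict_right_mono\<close>)

text \<open>The factor \<open>M\<close> in the speed cancels the factor 1/M of the substitution; the
  break points, where the speed is not controlled, are finitely many.\<close>

lemma glue_integral:
  assumes f: "\<And>i. i < M \<Longrightarrow> continuous_on {0..1} (\<lambda>x. f (c i x))"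
  shows "((\<lambda>s. f (glue M c s) * speed (glue M c) s) has_integral
      (\<Sum>i<M. integral {0..1} (\<lambda>x. f (c i x) * norm (c' i x)))) {0..1}"
proof -
  define F where "F = (\<lambda>s. f (glue M c s) * speed (glue M c) s)"
  have piece: "(F has_integral integral {0..1} (\<lambda>x. f (c i x) * norm (c' i x))) {real i / real M..real (Suc i) / real M}"
    if i: "i < M" for i
  proof -
    let ?a = "real i / real M" and ?b = "real (Suc i) / real M"
    have "((\<lambda>x. f (c i x) * norm (c' i x)) has_integral integral {0..1} (\<lambda>x. f (c i x) * norm (c' i x))) (cbox 0 1)"
      using integrable_continuous_interval[of 0 1 "\<lambda>x. f (c i x) * norm (c' i x)"]
      by (simp add: has_integral_integral[symmetric] continuous_on_mult continuous_on_norm f i cont_deriv)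
    from has_integral_affinity'[OF this, of "real M" "- real i"] M
    have "((\<lambda>s. f (c i (real M * s - real i)) * norm (c' i (real M * s - real i))) has_integral
        integral {0..1} (\<lambda>x. f (c i x) * norm (c' i x)) / real M) {?a..?b}"
      by (simp add: divide_inverse_commute add.commute)
    from has_integral_mult_right[OF this, of "real M"] M
    have "((\<lambda>s. real M * (f (c i (real M * s - real i)) * norm (c' i (real M * s - real i)))) has_integral
        integral {0..1} (\<lambda>x. f (c i x) * norm (c' i x))) {?a..?b}"
      by simp
    then show ?thesis
    proof (rule has_integral_spike_finite[rotated 2])
      show "finite {?a, ?b}" by simp
      fix s assume "s \<in> {?a..?b} - {?a, ?b}"
      then have s: "?a < s" "s < ?b" by auto
      then have s': "?a \<le> s" "s \<le> ?b" by auto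
      let ?x = "real M * s - real i"
      have x: "?x \<in> {0<..<1}" using s M by (auto simp: field_simps)
      have "(c i has_vector_derivative c' i ?x) (at ?x)"
        using deriv[OF i glue_piece(2)[OF i s']] x by (simp add: at_within_Icc_at)
      moreover have "((\<lambda>s. real M * s - real i) has_vector_derivative real M) (at s)"
        by (auto intro!: derivative_eq_intros simp: has_real_derivative_iff_has_vector_derivative[symmetric])
      ultimately have "((c i \<circ> (\<lambda>s. real M * s - real i)) has_vector_derivative real M *\<^sub>R c' i ?x) (at s)"
        by (intro vector_diff_chain_at)
      then have "(glue M c has_vector_derivative real M *\<^sub>R c' i ?x) (at s)"
        by (rule has_vector_derivative_transform_within_open[of _ _ _ "{?a<..<?b}"])
           (use s glue_piece(1)[OF i] in auto)
      moreover have "0 < s" "s < 1"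
      proof -
        have "0 \<le> ?a" by simp
        then show "0 < s" using s by linarith
        have "?b \<le> 1" using i M by (simp add: field_simps)
        then show "s < 1" using s by linarith
      qed
      ultimately have "speed (glue M c) s = real M * norm (c' i ?x)"
        by (simp add: speed_def at_within_Icc_at vector_derivative_at)
      then show "F s = real M * (f (c i ?x) * norm (c' i ?x))"
        using glue_piece(1)[OF i s'] by (simp add: F_def)
    qed
  qed
  have "k \<le> M \<Longrightarrow> (F has_integral (\<Sum>i<k. integral {0..1} (\<lambda>x. f (c i x) * norm (c' i x)))) {0..real k / real M}" for k
  proof (induction k)
    case (Suc k)
    have "(F has_integral (\<Sum>i<k. integral {0..1} (\<lambda>x. f (c i x) * norm (c' i x))) + integral {0..1} (\<lambda>x. f (c k x) * norm (c' k x))) {0..real (Suc k) / real M}"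
      by (rule has_integral_combine[OF _ _ Suc.IH piece]) (use Suc.prems in \<open>auto simp: field_simps\<close>)
    then show ?case by simp
  qed (simp add: has_integral_refl)
  from this[of M] show ?thesis using M by (simp add: F_def)
qed

lemma glue_simple:
  assumes inj: "\<And>i j x y. i < M \<Longrightarrow> j < M \<Longrightarrow> x \<in> {0..<1} \<Longrightarrow> y \<in> {0..<1} \<Longrightarrow> c i x = c j y \<Longrightarrow> i = j \<and> x = y"
    and closed: "c M 0 = c 0 0"
  shows "simple_path (glue M c)" "glue M c 0 = glue M c 1"
proof -
  have 01: "glue M c 1 = glue M c 0" using closed by (simp add: glue_def frac_def)
  then show "glue M c 0 = glue M c 1" ..
  have inj': "s = s'" if s: "0 \<le> s" "s < 1" "0 \<le> s'" "s' < 1" and eq: "glue M c s = glue M c s'" for s s'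
  proof -
    have lt: "nat \<lfloor>real M * s\<rfloor> < M" if "0 \<le> s" "s < 1" for s
      using that M by (simp add: nat_less_iff floor_less_iff)
    have fr: "frac z \<in> {0..<1}" for z :: real by (simp add: frac_lt_1)
    have "nat \<lfloor>real M * s\<rfloor> = nat \<lfloor>real M * s'\<rfloor> \<and> frac (real M * s) = frac (real M * s')"
      by (rule inj[OF lt lt fr fr]) (use s eq in \<open>auto simp: glue_def\<close>)
    moreover have "\<lfloor>real M * s\<rfloor> \<ge> 0" "\<lfloor>real M * s'\<rfloor> \<ge> 0" using s by auto
    ultimately have "\<lfloor>real M * s\<rfloor> = \<lfloor>real M * s'\<rfloor>" "frac (real M * s) = frac (real M * s')" by (auto simp: eq_nat_nat_iff)
    then have "real M * s = real M * s'" by (simp add: frac_def)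
    then show ?thesis using M by simp
  qed
  have "x = y \<or> x = 0 \<and> y = 1 \<or> x = 1 \<and> y = 0" if "x \<in> {0..1}" "y \<in> {0..1}" "glue M c x = glue M c y" for x y
  proof (cases "x = 1"; cases "y = 1")
    assume "x = 1" "y \<noteq> 1"
    then show ?thesis using inj'[of 0 y] that 01 by auto
  next
    assume "x \<noteq> 1" "y = 1"
    then show ?thesis using inj'[of x 0] that 01 by auto
  next
    assume "x \<noteq> 1" "y \<noteq> 1"
    then show ?thesis using inj'[of x y] that by auto
  qed simp
  then show "simple_path (glue M c)"
    using glue_continuous by (auto simp: simple_path_def loop_free_def path_def)
qed

end

lemma no_self_intersections:
  assumes "simple_path g" shows "self_intersections g = {}"
proof -
  have "s = 0 \<and> u = 1" if "0 \<le> s" "s < u" "u \<le> 1" "g s = g u" for s u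
  proof -
    have "s = u \<or> s = 0 \<and> u = 1 \<or> s = 1 \<and> u = 0"
      using assms that unfolding simple_path_def loop_free_def by (meson atLeastAtMost_iff less_imp_le order_trans)
    then show ?thesis using that by linarith
  qed
  then show ?thesis by (auto simp: self_intersections_def)
qed

section \<open>Waves on a geodesic edge\<close>

text \<open>
  The derivative of \<^const>\<open>sgn\<close> at \<open>P\<close> in the direction \<open>Q\<close>.
\<close>

definition radial_deriv :: "'a::euclidean_space \<Rightarrow> 'a \<Rightarrow> 'a" where
  "radial_deriv P Q = (1 / norm P) *\<^sub>R Q - ((P \<bullet> Q) / norm P ^ 3) *\<^sub>R P"

lemma norm_radial_deriv_le:
  assumes "P \<noteq> 0" shows "norm (radial_deriv P Q) \<le> norm Q / norm P"
proof -
  have P: "norm P \<noteq> 0" using assms by simp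
  have "(norm (radial_deriv P Q))\<^sup>2 = (Q \<bullet> Q) * (1 / norm P)\<^sup>2 - (P \<bullet> Q) * ((P \<bullet> Q) / norm P ^ 3 * (1 / norm P)) - (P \<bullet> Q) * ((P \<bullet> Q) / norm P ^ 3 * (1 / norm P)) + (P \<bullet> P) * ((P \<bullet> Q) / norm P ^ 3)\<^sup>2"
    unfolding radial_deriv_def power2_norm_eq_inner
    by (simp only: inner_diff_left inner_diff_right inner_scaleR_left inner_scaleR_right inner_commute[of Q P] power2_eq_square)
       (simp only: algebra_simps)
  also have "\<dots> = (norm Q)\<^sup>2 / (norm P)\<^sup>2 - (P \<bullet> Q)\<^sup>2 / (norm P)^4"
    unfolding dot_square_norm using P by (simp add: power_divide power2_eq_square power3_eq_cube power4_eq_xxxx)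
  also have "\<dots> \<le> (norm Q / norm P)\<^sup>2" by (simp add: power_divide)
  finally show ?thesis by (rule power2_le_imp_le) simp
qed

lemma norm_radial_deriv_orthogonal:
  assumes g: "orthogonal_transformation g"
  shows "norm (radial_deriv (g P) (g Q)) = norm (radial_deriv P Q)"
proof -
  have "radial_deriv (g P) (g Q) = g (radial_deriv P Q)"
    using g linear_diff[OF orthogonal_transformation_linear[OF g]] linear_scale[OF orthogonal_transformation_linear[OF g]]
    by (simp add: radial_deriv_def orthogonal_transformation_norm[OF g] orthogonal_transformation_def)
  then show ?thesis using g by (simp add: orthogonal_transformation_norm)
qed

lemma sgn_has_vector_derivative:
  fixes w :: "real \<Rightarrow> 'a::euclidean_space"
  assumes w: "(w has_vector_derivative w') (at x within S)" and nz: "w x \<noteq> 0"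
  shows "((\<lambda>y. sgn (w y)) has_vector_derivative radial_deriv (w x) w') (at x within S)"
    and "((\<lambda>y. 1 / norm (w y)) has_real_derivative - ((1 / norm (w x)) ^ 3 * (w x \<bullet> w'))) (at x within S)"
proof -
  have "((\<lambda>y. norm (w y)) has_derivative (\<lambda>t. (t *\<^sub>R w') \<bullet> sgn (w x))) (at x within S)"
    by (rule has_derivative_compose[OF w[unfolded has_vector_derivative_def] has_derivative_norm[OF nz]])
  then have n: "((\<lambda>y. norm (w y)) has_real_derivative (w x \<bullet> w') / norm (w x)) (at x within S)"
    by (rule has_derivative_imp_has_field_derivative) (simp add: sgn_div_norm inner_commute divide_inverse)
  have nz': "norm (w x) \<noteq> 0" using nz by simp
  show r: "((\<lambda>y. 1 / norm (w y)) has_real_derivative - ((1 / norm (w x)) ^ 3 * (w x \<bullet> w'))) (at x within S)"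
    using DERIV_inverse'[OF n nz'] by (simp add: divide_inverse power3_eq_cube mult.assoc mult.commute mult.left_commute)
  have "((\<lambda>y. (1 / norm (w y)) *\<^sub>R w y) has_vector_derivative
     (1 / norm (w x)) *\<^sub>R w' + (- ((1 / norm (w x)) ^ 3 * (w x \<bullet> w'))) *\<^sub>R w x) (at x within S)"
    by (rule has_vector_derivative_scaleR[OF r w])
  then show "((\<lambda>y. sgn (w y)) has_vector_derivative radial_deriv (w x) w') (at x within S)"
    by (simp add: sgn_div_norm divide_inverse radial_deriv_def power_inverse mult.commute)
qed

text \<open>A curve in the ambient space; the arc on the sphere is its \<open>sgn\<close>. The sine
  vanishes at both ends, so amplitude and frequency of one edge can change without moving a
  vertex.\<close>

definition wave :: "'a::euclidean_space \<Rightarrow> 'a \<Rightarrow> 'a \<Rightarrow> nat \<Rightarrow> real \<Rightarrow> real \<Rightarrow> 'a" where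
  "wave a b d K h x = (1 - x) *\<^sub>R a + x *\<^sub>R b + (h * sin (2 * pi * real K * x)) *\<^sub>R d"

definition wave' :: "'a::euclidean_space \<Rightarrow> 'a \<Rightarrow> 'a \<Rightarrow> nat \<Rightarrow> real \<Rightarrow> real \<Rightarrow> 'a" where
  "wave' a b d K h x = b - a + (h * (2 * pi * real K) * cos (2 * pi * real K * x)) *\<^sub>R d"

definition arc_integral :: "('a::euclidean_space \<Rightarrow> real) \<Rightarrow> 'a \<Rightarrow> 'a \<Rightarrow> 'a \<Rightarrow> nat \<Rightarrow> real \<Rightarrow> real" where
  "arc_integral f a b d K h = integral {0..1} (\<lambda>x. f (sgn (wave a b d K h x)) * norm (radial_deriv (wave a b d K h x) (wave' a b d K h x)))"

text \<open>The angle between \<open>a\<close> and \<open>b\<close> if the segment misses the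
  origin. The integral is that of \<open>arc_integral\<close> for the constant 1 at amplitude 0, so
  the two agree by unfolding, and continuity in the end points is that of an integral with
  parameters.\<close>

definition arc_len :: "'a::euclidean_space \<Rightarrow> 'a \<Rightarrow> real" where
  "arc_len a b = integral {0..1} (\<lambda>x. norm (radial_deriv ((1 - x) *\<^sub>R a + x *\<^sub>R b) (b - a)))"

lemma wave_has_vector_derivative:
  "((wave a b d K h) has_vector_derivative wave' a b d K h x) (at x within S)"
proof -
  have 1: "((\<lambda>x. 1 - x) has_real_derivative -1) (at x within S)" "((\<lambda>x. x) has_real_derivative 1) (at x within S)"
    "((\<lambda>x. h * sin (2 * pi * real K * x)) has_real_derivative h * (2 * pi * real K) * cos (2 * pi * real K * x)) (at x within S)"
    by (auto intro!: derivative_eq_intros)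
  have "((\<lambda>x. (1 - x) *\<^sub>R a + x *\<^sub>R b + (h * sin (2 * pi * real K * x)) *\<^sub>R d) has_vector_derivative
     ((1 - x) *\<^sub>R 0 + (-1) *\<^sub>R a) + (x *\<^sub>R 0 + 1 *\<^sub>R b) + ((h * sin (2 * pi * real K * x)) *\<^sub>R 0 + (h * (2 * pi * real K) * cos (2 * pi * real K * x)) *\<^sub>R d)) (at x within S)"
    by (intro has_vector_derivative_add has_vector_derivative_scaleR 1 has_vector_derivative_const)
  then show ?thesis by (simp add: wave_def[abs_def] wave'_def)
qed

text \<open>Independence keeps the wave away from the origin for every amplitude, since the
  coefficients 1 - x and x do not vanish together.\<close>

locale wavy_arc =
  fixes a b d :: "'a::euclidean_space"
  assumes indep: "\<And>u v w. u *\<^sub>R a + v *\<^sub>R b + w *\<^sub>R d = 0 \<Longrightarrow> u = 0 \<and> v = 0 \<and> w = 0"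
begin

lemma wave_nz: "wave a b d K h x \<noteq> 0"
  using indep[of "1 - x" x "h * sin (2 * pi * real K * x)"] by (auto simp: wave_def)

lemma sgn_wave_deriv:
  "((\<lambda>x. sgn (wave a b d K h x)) has_vector_derivative radial_deriv (wave a b d K h x) (wave' a b d K h x)) (at x within S)"
  by (rule sgn_has_vector_derivative(1)[OF wave_has_vector_derivative wave_nz])

lemma cont_wave: "continuous_on S (\<lambda>(h, x). wave a b d K h x)" "continuous_on S (\<lambda>(h, x). wave' a b d K h x)"
  unfolding wave_def wave'_def split_beta by (intro continuous_intros)+

lemma cont_radial: "continuous_on S (\<lambda>(h, x). radial_deriv (wave a b d K h x) (wave' a b d K h x))"
  using cont_wave[unfolded split_beta] unfolding radial_deriv_def split_beta
  by (intro continuous_intros) (auto simp: wave_nz)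

lemma cont_sgn_wave: "continuous_on S (\<lambda>(h, x). sgn (wave a b d K h x))"
  using cont_wave[unfolded split_beta] unfolding split_beta sgn_div_norm
  by (intro continuous_intros) (auto simp: wave_nz)

lemma cont_arc_integrand:
  assumes "continuous_on UNIV f"
  shows "continuous_on S (\<lambda>(h, x). f (sgn (wave a b d K h x)) * norm (radial_deriv (wave a b d K h x) (wave' a b d K h x)))"
  using cont_radial[of S K, unfolded split_beta] continuous_on_compose2[OF assms cont_sgn_wave[of S K, unfolded split_beta] subset_UNIV]
  unfolding split_beta by (intro continuous_intros)

lemma cont_fixed:
  fixes F :: "real \<Rightarrow> real \<Rightarrow> 'b::topological_space"
  assumes "continuous_on UNIV (\<lambda>(h, x). F h x)"
  shows "continuous_on T (F h)"
proof -
  have "continuous_on T (\<lambda>x. (\<lambda>(h, x). F h x) (h, x))"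
    by (rule continuous_on_compose2[OF assms]) (auto intro!: continuous_intros)
  then show ?thesis by simp
qed

lemma cont_arc_integral:
  assumes "continuous_on UNIV f"
  shows "continuous_on UNIV (arc_integral f a b d K)"
proof -
  have "continuous_on UNIV (\<lambda>h. integral (cbox 0 1) (\<lambda>x. f (sgn (wave a b d K h x)) * norm (radial_deriv (wave a b d K h x) (wave' a b d K h x))))"
    by (rule integral_continuous_on_param) (rule cont_arc_integrand[OF assms])
  then show ?thesis by (simp add: arc_integral_def[abs_def])
qed

lemma arc_integrand_integrable:
  assumes "continuous_on UNIV f"
  shows "(\<lambda>x. f (sgn (wave a b d K h x)) * norm (radial_deriv (wave a b d K h x) (wave' a b d K h x))) integrable_on {u..v}"
  by (rule integrable_continuous_interval, rule cont_fixed[OF cont_arc_integrand[OF assms]])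

lemma arc_integral_near:
  assumes f: "continuous_on UNIV f" and c: "\<And>x. x \<in> {0..1} \<Longrightarrow> \<bar>f (sgn (wave a b d K h x)) - v\<bar> \<le> \<omega>"
  shows "\<bar>arc_integral f a b d K h - v * arc_integral (\<lambda>_. 1) a b d K h\<bar> \<le> \<omega> * arc_integral (\<lambda>_. 1) a b d K h"
proof -
  let ?n = "\<lambda>x. norm (radial_deriv (wave a b d K h x) (wave' a b d K h x))"
  have 1: "?n integrable_on {0..1}" using arc_integrand_integrable[of "\<lambda>_. 1"] by simp
  have "arc_integral f a b d K h - v * arc_integral (\<lambda>_. 1) a b d K h = integral {0..1} (\<lambda>x. (f (sgn (wave a b d K h x)) - v) * ?n x)"
    unfolding arc_integral_def integral_mult_right[symmetric]
    by (subst integral_diff[symmetric]) (auto simp: algebra_simps intro!: arc_integrand_integrable f integrable_on_mult_right 1)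
  also have "norm \<dots> \<le> integral {0..1} (\<lambda>x. \<omega> * ?n x)"
  proof (rule integral_norm_bound_integral)
    show "(\<lambda>x. (f (sgn (wave a b d K h x)) - v) * ?n x) integrable_on {0..1}"
      unfolding left_diff_distrib by (intro integrable_diff arc_integrand_integrable f integrable_on_mult_right 1)
    show "(\<lambda>x. \<omega> * ?n x) integrable_on {0..1}" by (intro integrable_on_mult_right 1)
  qed (use c in \<open>auto simp: abs_mult intro!: mult_right_mono\<close>)
  finally show ?thesis by (simp add: arc_integral_def)
qed

lemma arc_integral_flat: "arc_integral (\<lambda>_. 1) a b d K 0 = arc_len a b"
  by (simp add: arc_integral_def arc_len_def wave_def wave'_def)

lemma arc_integral_1_nonneg: "0 \<le> arc_integral (\<lambda>_. 1) a b d K h"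
  unfolding arc_integral_def by (rule integral_nonneg) (use arc_integrand_integrable[of "\<lambda>_. 1"] in auto)

text \<open>The crests lie on the arc \<open>top\<close> and the undisturbed points on the arc
  \<open>bot\<close>. By independence these are disjoint compact sets, and neither depends on
  \<open>K\<close>. Every period passes from \<open>bot\<close> to \<open>top\<close>, which costs
  at least their distance \<open>c\<close>.\<close>

lemma wave_length_unbounded:
  assumes h: "h \<noteq> 0"
  shows "\<exists>c>0. \<forall>K>0. real K * c \<le> arc_integral (\<lambda>_. 1) a b d K h"
proof -
  define top where "top y = sgn ((1 - y) *\<^sub>R a + y *\<^sub>R b + h *\<^sub>R d)" for y
  define bot where "bot y = sgn ((1 - y) *\<^sub>R a + y *\<^sub>R b)" for y
  have nz: "(1 - y) *\<^sub>R a + y *\<^sub>R b + w *\<^sub>R d \<noteq> 0" for y w using indep[of "1 - y" y w] by auto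
  have nz0: "(1 - y) *\<^sub>R a + y *\<^sub>R b \<noteq> 0" for y using nz[of y 0] by simp
  have "compact (top ` {0..1})" unfolding top_def sgn_div_norm
    by (intro compact_continuous_image continuous_intros) (use nz in auto)
  moreover have "compact (bot ` {0..1})" unfolding bot_def sgn_div_norm
    by (intro compact_continuous_image continuous_intros) (use nz0 in auto)
  moreover have "top ` {0..1} \<inter> bot ` {0..1} = {}"
  proof -
    have "top y \<noteq> bot z" for y z
    proof
      assume eq: "top y = bot z"
      define P where "P = (1 - y) *\<^sub>R a + y *\<^sub>R b + h *\<^sub>R d"
      define Q where "Q = (1 - z) *\<^sub>R a + z *\<^sub>R b"
      have "P \<noteq> 0" "Q \<noteq> 0" using nz nz0 by (auto simp: P_def Q_def)
      moreover have "sgn P = sgn Q" using eq by (simp add: top_def bot_def P_def Q_def)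
      ultimately have PQ: "P = (norm P / norm Q) *\<^sub>R Q" by (simp add: sgn_div_norm field_simps vector_fraction_eq_iff)
      define \<mu> where "\<mu> = norm P / norm Q"
      have "((1 - y) - \<mu> * (1 - z)) *\<^sub>R a + (y - \<mu> * z) *\<^sub>R b + h *\<^sub>R d = P - \<mu> *\<^sub>R Q"
        by (simp add: P_def Q_def algebra_simps)
      also have "\<dots> = 0" using PQ by (simp add: \<mu>_def)
      finally show False using indep h by blast
    qed
    then show ?thesis by auto
  qed
  ultimately obtain c where c: "c > 0" "\<And>p q. p \<in> top ` {0..1} \<Longrightarrow> q \<in> bot ` {0..1} \<Longrightarrow> c \<le> dist p q"
    using separate_compact_closed[of "top ` {0..1}" "bot ` {0..1}"] compact_imp_closed by metis
  have "real K * c \<le> arc_integral (\<lambda>_. 1) a b d K h" if K: "K > 0" for K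
  proof -
    define n where "n x = norm (radial_deriv (wave a b d K h x) (wave' a b d K h x))" for x
    have int: "n integrable_on {u..v}" for u v
      using arc_integrand_integrable[of "\<lambda>_. 1"] by (simp add: n_def[abs_def])
    have n0: "0 \<le> n x" for x by (simp add: n_def)
    have chord: "norm (sgn (wave a b d K h v) - sgn (wave a b d K h u)) \<le> integral {u..v} n" if "u \<le> v" for u v
    proof -
      have "((\<lambda>x. radial_deriv (wave a b d K h x) (wave' a b d K h x)) has_integral (sgn (wave a b d K h v) - sgn (wave a b d K h u))) {u..v}"
        by (rule fundamental_theorem_of_calculus[OF that]) (rule sgn_wave_deriv)
      then have "sgn (wave a b d K h v) - sgn (wave a b d K h u) = integral {u..v} (\<lambda>x. radial_deriv (wave a b d K h x) (wave' a b d K h x))"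
        and "(\<lambda>x. radial_deriv (wave a b d K h x) (wave' a b d K h x)) integrable_on {u..v}"
        by (auto simp: integral_unique has_integral_integrable)
      then show ?thesis
        using integral_norm_bound_integral[of "\<lambda>x. radial_deriv (wave a b d K h x) (wave' a b d K h x)" "{u..v}" n] int by (simp add: n_def)
    qed
    have "k \<le> K \<Longrightarrow> real k * c \<le> integral {0..real k / real K} n" for k
    proof (induction k)
      case (Suc k)
      \<comment> \<open>The start of period \<open>k\<close>, its crest a quarter of a period later,
        and its end.\<close>
      let ?u = "real k / real K" and ?m = "(real k + 1 / 4) / real K" and ?v = "real (Suc k) / real K"
      have le: "0 \<le> ?u" "?u \<le> ?m" "?m \<le> ?v" by (auto simp: divide_right_mono)
      have "?v \<le> 1" using Suc.prems K by (simp add: field_simps)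
      have "sin (2 * pi * real K * ?u) = 0"
      proof -
        have "2 * pi * real K * ?u = real (2 * k) * pi" using K by (simp add: field_simps)
        then show ?thesis by (simp only: sin_npi)
      qed
      then have "sgn (wave a b d K h ?u) = bot ?u" by (simp add: wave_def bot_def)
      moreover have "sin (2 * pi * real K * ?m) = 1"
      proof -
        have "2 * pi * real K * ?m = pi / 2 + 2 * pi * real k" using K by (simp add: field_simps)
        then show ?thesis using sin_int_2pin[of "int k"] cos_int_2pin[of "int k"] by (simp add: sin_add)
      qed
      then have "sgn (wave a b d K h ?m) = top ?m" by (simp add: wave_def top_def)
      ultimately have "c \<le> norm (sgn (wave a b d K h ?m) - sgn (wave a b d K h ?u))"
        using c(2)[of "top ?m" "bot ?u"] le \<open>?v \<le> 1\<close> by (auto simp: dist_norm)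
      also have "\<dots> \<le> integral {?u..?m} n" by (rule chord[OF le(2)])
      also have "\<dots> \<le> integral {?u..?v} n" using le by (intro integral_subset_le int) (auto simp: n0)
      finally have "c \<le> integral {?u..?v} n" .
      moreover have "integral {0..?v} n = integral {0..?u} n + integral {?u..?v} n"
        using le by (intro Henstock_Kurzweil_Integration.integral_combine[symmetric] int) auto
      ultimately show ?case using Suc by (simp add: distrib_right)
    qed simp
    from this[of K] show ?thesis using K by (simp add: arc_integral_def n_def[abs_def])
  qed
  then show ?thesis using c by blast
qed

end

section \<open>Smoothness of the projected wave\<close>

context wavy_arc
begin

text \<open>An algebra of coefficient functions closed under differentiation: for the wave w and r =
  1/|w| one has r' = - r^3 (w . w'), and w . w' lies in the algebra again. So derivatives of all
  orders exist without a formula for them.\<close>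

inductive smooth_alg :: "nat \<Rightarrow> real \<Rightarrow> (real \<Rightarrow> real) \<Rightarrow> bool" for K h where
  const: "smooth_alg K h (\<lambda>_. c)"
| ident: "smooth_alg K h (\<lambda>x. x)"
| sin: "smooth_alg K h (\<lambda>x. sin (2 * pi * real K * x))"
| cos: "smooth_alg K h (\<lambda>x. cos (2 * pi * real K * x))"
| radius: "smooth_alg K h (\<lambda>x. 1 / norm (wave a b d K h x))"
| add: "smooth_alg K h f \<Longrightarrow> smooth_alg K h g \<Longrightarrow> smooth_alg K h (\<lambda>x. f x + g x)"
| mult: "smooth_alg K h f \<Longrightarrow> smooth_alg K h g \<Longrightarrow> smooth_alg K h (\<lambda>x. f x * g x)"

lemma smooth_alg_lin:
  "smooth_alg K h (\<lambda>x. (1 + (-1) * x) * u + x * v + h * sin (2 * pi * real K * x) * w)"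
  using smooth_alg.add[OF smooth_alg.add[OF smooth_alg.mult[OF smooth_alg.add[OF smooth_alg.const[of K h 1]
      smooth_alg.mult[OF smooth_alg.const[of K h "-1"] smooth_alg.ident]] smooth_alg.const[of K h u]]
      smooth_alg.mult[OF smooth_alg.ident smooth_alg.const[of K h v]]]
      smooth_alg.mult[OF smooth_alg.mult[OF smooth_alg.const[of K h h] smooth_alg.sin] smooth_alg.const[of K h w]]] .

lemma smooth_alg_wave_inner: "smooth_alg K h (\<lambda>x. wave a b d K h x \<bullet> wave' a b d K h x)"
proof -
  define k where "k = h * (2 * pi * real K)"
  define f where "f u v w x = (1 + (-1) * x) * u + x * v + h * sin (2 * pi * real K * x) * w" for u v w x :: real
  have lin: "smooth_alg K h (f u v w)" for u v w
    unfolding f_def[abs_def] by (rule smooth_alg_lin)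
  have "smooth_alg K h (\<lambda>x. f (a \<bullet> (b - a)) (b \<bullet> (b - a)) (d \<bullet> (b - a)) x
      + f (a \<bullet> d) (b \<bullet> d) (d \<bullet> d) x * (k * cos (2 * pi * real K * x)))"
    by (rule smooth_alg.add[OF lin smooth_alg.mult[OF lin smooth_alg.mult[OF smooth_alg.const smooth_alg.cos]]])
  moreover have "f (a \<bullet> (b - a)) (b \<bullet> (b - a)) (d \<bullet> (b - a)) x
      + f (a \<bullet> d) (b \<bullet> d) (d \<bullet> d) x * (k * cos (2 * pi * real K * x)) = wave a b d K h x \<bullet> wave' a b d K h x" for x
  proof -
    have "wave a b d K h x = (1 + (-1) * x) *\<^sub>R a + x *\<^sub>R b + (h * sin (2 * pi * real K * x)) *\<^sub>R d"
      "wave' a b d K h x = (b - a) + (k * cos (2 * pi * real K * x)) *\<^sub>R d"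
      by (simp_all add: wave_def wave'_def k_def)
    then show ?thesis unfolding f_def
      by (simp only: inner_add_left inner_add_right inner_scaleR_left inner_scaleR_right) (simp only: algebra_simps)
  qed
  ultimately show ?thesis by (simp only:)
qed

lemma smooth_alg_deriv:
  assumes "smooth_alg K h g"
  shows "\<exists>g'. smooth_alg K h g' \<and> (\<forall>x. (g has_real_derivative g' x) (at x))"
  using assms
proof induction
  case (const c)
  show ?case by (rule exI[of _ "\<lambda>_. 0"]) (simp add: smooth_alg.const)
next
  case ident
  show ?case by (rule exI[of _ "\<lambda>_. 1"]) (simp add: smooth_alg.const)
next
  case sin
  show ?case
    by (rule exI[of _ "\<lambda>x. (2 * pi * real K) * cos (2 * pi * real K * x)"])
       (intro conjI allI smooth_alg.mult[OF smooth_alg.const smooth_alg.cos], auto intro!: derivative_eq_intros)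
next
  case cos
  show ?case
    by (rule exI[of _ "\<lambda>x. (- (2 * pi * real K)) * sin (2 * pi * real K * x)"])
       (intro conjI allI smooth_alg.mult[OF smooth_alg.const smooth_alg.sin], auto intro!: derivative_eq_intros)
next
  case radius
  let ?r = "\<lambda>x. 1 / norm (wave a b d K h x)"
  have "smooth_alg K h (\<lambda>x. (-1) * (?r x * (?r x * ?r x) * (wave a b d K h x \<bullet> wave' a b d K h x)))"
    by (intro smooth_alg.mult smooth_alg.const smooth_alg.radius smooth_alg_wave_inner)
  moreover have "(?r has_real_derivative (-1) * (?r x * (?r x * ?r x) * (wave a b d K h x \<bullet> wave' a b d K h x))) (at x)" for x
    using sgn_has_vector_derivative(2)[OF wave_has_vector_derivative[of a b d K h x UNIV] wave_nz]
    by (simp add: power3_eq_cube mult.assoc)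
  ultimately show ?case by blast
next
  case (add f g)
  then obtain f' g' where "smooth_alg K h f'" "smooth_alg K h g'"
    "\<And>x. (f has_real_derivative f' x) (at x)" "\<And>x. (g has_real_derivative g' x) (at x)" by blast
  then show ?case by (intro exI[of _ "\<lambda>x. f' x + g' x"]) (auto intro: smooth_alg.add DERIV_add)
next
  case (mult f g)
  then obtain f' g' where *: "smooth_alg K h f'" "smooth_alg K h g'"
    "\<And>x. (f has_real_derivative f' x) (at x)" "\<And>x. (g has_real_derivative g' x) (at x)" by blast
  have "smooth_alg K h (\<lambda>x. f' x * g x + g' x * f x)"
    by (intro smooth_alg.add smooth_alg.mult * mult.hyps)
  moreover have "((\<lambda>x. f x * g x) has_real_derivative f' x * g x + g' x * f x) (at x)" for x
    by (rule DERIV_mult) (rule *)+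
  ultimately show ?case by blast
qed

lemma smooth_alg_derivs:
  assumes "smooth_alg K h g"
  shows "\<exists>D. D 0 = g \<and> (\<forall>k x. (D k has_real_derivative D (Suc k) x) (at x))"
proof -
  define nxt where "nxt g = (SOME g'. smooth_alg K h g' \<and> (\<forall>x. (g has_real_derivative g' x) (at x)))" for g
  have nxt: "smooth_alg K h (nxt g) \<and> (\<forall>x. (g has_real_derivative nxt g x) (at x))" if "smooth_alg K h g" for g
    using someI_ex[OF smooth_alg_deriv[OF that]] unfolding nxt_def[symmetric] .
  have alg: "smooth_alg K h ((nxt ^^ k) g)" for k
    by (induction k) (use assms nxt in auto)
  show ?thesis
    by (rule exI[of _ "\<lambda>k. (nxt ^^ k) g"]) (use alg nxt in auto)
qed

lemma smooth_sgn_wave: "smooth_on_interval 0 1 (\<lambda>x. sgn (wave a b d K h x))"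
proof -
  define r where "r x = 1 / norm (wave a b d K h x)" for x
  define f where "f u v w x = (1 + (-1) * x) * u + x * v + h * sin (2 * pi * real K * x) * w" for u v w x :: real
  have alg: "smooth_alg K h (\<lambda>x. r x * f u v w x)" for u v w
    unfolding r_def f_def by (rule smooth_alg.mult[OF smooth_alg.radius smooth_alg_lin])
  obtain A where A: "A 0 = (\<lambda>x. r x * f 1 0 0 x) \<and> (\<forall>k x. (A k has_real_derivative A (Suc k) x) (at x))"
    using smooth_alg_derivs[OF alg] ..
  obtain B where B: "B 0 = (\<lambda>x. r x * f 0 1 0 x) \<and> (\<forall>k x. (B k has_real_derivative B (Suc k) x) (at x))"
    using smooth_alg_derivs[OF alg] ..
  obtain C where C: "C 0 = (\<lambda>x. r x * f 0 0 1 x) \<and> (\<forall>k x. (C k has_real_derivative C (Suc k) x) (at x))"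
    using smooth_alg_derivs[OF alg] ..
  have D: "(A k has_real_derivative A (Suc k) x) (at x within {0..1})" "(B k has_real_derivative B (Suc k) x) (at x within {0..1})"
    "(C k has_real_derivative C (Suc k) x) (at x within {0..1})" for k x
    using A B C by (blast intro: has_field_derivative_at_within)+
  show ?thesis
    unfolding smooth_on_interval_def
  proof (intro exI[of _ "\<lambda>k x. A k x *\<^sub>R a + B k x *\<^sub>R b + C k x *\<^sub>R d"] conjI ballI allI)
    fix x :: real
    show "A 0 x *\<^sub>R a + B 0 x *\<^sub>R b + C 0 x *\<^sub>R d = sgn (wave a b d K h x)"
      using A B C by (simp add: f_def r_def sgn_div_norm scaleR_add_right divide_inverse) (simp add: wave_def scaleR_add_right)
    fix k
    have "((\<lambda>x. A k x *\<^sub>R a + B k x *\<^sub>R b + C k x *\<^sub>R d) has_vector_derivative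
       (A k x *\<^sub>R 0 + A (Suc k) x *\<^sub>R a) + (B k x *\<^sub>R 0 + B (Suc k) x *\<^sub>R b) + (C k x *\<^sub>R 0 + C (Suc k) x *\<^sub>R d)) (at x within {0..1})"
      by (intro has_vector_derivative_add has_vector_derivative_scaleR has_vector_derivative_const D)
    then show "((\<lambda>x. A k x *\<^sub>R a + B k x *\<^sub>R b + C k x *\<^sub>R d) has_vector_derivative
       A (Suc k) x *\<^sub>R a + B (Suc k) x *\<^sub>R b + C (Suc k) x *\<^sub>R d) (at x within {0..1})" by simp
  qed
qed

end

section \<open>Lengths of geodesic arcs\<close>

text \<open>Every point of the chord is within 1/2 of one of its end points, hence at distance at
  least 1/2 from the origin, so radial projection stretches the chord by a factor of at most
  2.\<close>

lemma arc_len_le: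
  assumes "norm a = 1" "norm b = 1" "norm (a - b) \<le> 1"
  shows "0 \<le> arc_len a b" "arc_len a b \<le> 2 * norm (a - b)"
proof -
  let ?P = "\<lambda>x. (1 - x) *\<^sub>R a + x *\<^sub>R b"
  have half: "1 / 2 \<le> norm (?P x)" if x: "x \<in> {0..1}" for x
  proof (cases "x \<le> 1 / 2")
    case True
    have "?P x = a - x *\<^sub>R (a - b)" by (simp add: algebra_simps)
    then have "norm a - norm (x *\<^sub>R (a - b)) \<le> norm (?P x)" by (simp only: norm_triangle_ineq2)
    moreover have "norm (x *\<^sub>R (a - b)) \<le> 1 / 2 * 1" using x True assms unfolding norm_scaleR by (intro mult_mono) auto
    ultimately show ?thesis using assms by linarith
  next
    case False
    have "?P x = b - (1 - x) *\<^sub>R (b - a)" by (simp add: algebra_simps)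
    then have "norm b - norm ((1 - x) *\<^sub>R (b - a)) \<le> norm (?P x)" by (simp only: norm_triangle_ineq2)
    moreover have "norm ((1 - x) *\<^sub>R (b - a)) \<le> 1 / 2 * 1"
      using x False assms unfolding norm_scaleR by (intro mult_mono) (auto simp: norm_minus_commute)
    ultimately show ?thesis using assms by linarith
  qed
  have cont: "continuous_on {0..1} (\<lambda>x. norm (radial_deriv (?P x) (b - a)))"
    unfolding radial_deriv_def by (intro continuous_intros) (use half in force)+
  have int: "(\<lambda>x. norm (radial_deriv (?P x) (b - a))) integrable_on {0..1}"
    by (rule integrable_continuous_interval[OF cont])
  show "0 \<le> arc_len a b" unfolding arc_len_def by (rule integral_nonneg[OF int]) simp
  have "arc_len a b \<le> integral {0..1} (\<lambda>x::real. 2 * norm (a - b))"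
    unfolding arc_len_def
  proof (rule Henstock_Kurzweil_Integration.integral_le[OF int])
    fix x :: real assume x: "x \<in> {0..1}"
    then have nz: "?P x \<noteq> 0" using half[of x] by auto
    have "norm (radial_deriv (?P x) (b - a)) \<le> norm (b - a) / norm (?P x)" by (rule norm_radial_deriv_le[OF nz])
    also have "\<dots> \<le> norm (b - a) / (1 / 2)" using half[OF x] by (intro divide_left_mono) auto
    finally show "norm (radial_deriv (?P x) (b - a)) \<le> 2 * norm (a - b)" by (simp add: norm_minus_commute)
  qed (rule integrable_const_ivl)
  then show "arc_len a b \<le> 2 * norm (a - b)" by simp
qed

lemma arc_len_orthogonal:
  assumes g: "orthogonal_transformation g" shows "arc_len (g a) (g b) = arc_len a b"
proof -
  have "(1 - x) *\<^sub>R g a + x *\<^sub>R g b = g ((1 - x) *\<^sub>R a + x *\<^sub>R b)" "g b - g a = g (b - a)" for x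
    using orthogonal_transformation_linear[OF g] by (simp_all add: linear_add linear_scale linear_diff)
  then show ?thesis by (simp add: arc_len_def norm_radial_deriv_orthogonal[OF g])
qed

lemma arc_len_continuous:
  "continuous_on {(a, b). \<forall>x\<in>{0..1}. (1 - x) *\<^sub>R a + x *\<^sub>R b \<noteq> 0} (\<lambda>(a, b). arc_len a b)"
proof -
  let ?U = "{(a::'a, b). \<forall>x\<in>{0..1}. (1 - x) *\<^sub>R a + x *\<^sub>R b \<noteq> 0}"
  have "continuous_on ?U (\<lambda>p. integral (cbox 0 1) (\<lambda>x. norm (radial_deriv ((1 - x) *\<^sub>R fst p + x *\<^sub>R snd p) (snd p - fst p))))"
    by (rule integral_continuous_on_param)
       (auto simp: radial_deriv_def split_beta intro!: continuous_intros)
  then show ?thesis by (simp add: arc_len_def split_beta)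
qed

section \<open>Wavy polygons\<close>

lemma norm_sgn_diff_le:
  fixes a b :: "'a::real_normed_vector"
  assumes "a \<noteq> 0" shows "norm (sgn a - sgn b) \<le> 2 * norm (a - b) / norm a"
proof (cases "b = 0")
  case True
  then show ?thesis using assms by (simp add: norm_sgn)
next
  case False
  have n: "norm a > 0" "norm b > 0" using assms False by auto
  have "norm a *\<^sub>R (sgn a - sgn b) = (a - b) + (norm b - norm a) *\<^sub>R sgn b"
    using n by (simp add: sgn_div_norm algebra_simps)
  then have "norm a * norm (sgn a - sgn b) = norm ((a - b) + (norm b - norm a) *\<^sub>R sgn b)"
    using n by (metis abs_norm_cancel norm_scaleR)
  also have "\<dots> \<le> norm (a - b) + \<bar>norm b - norm a\<bar> * 1"
    by (rule norm_triangle_le) (use False in \<open>simp add: norm_sgn\<close>)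
  also have "\<dots> \<le> 2 * norm (a - b)" using norm_triangle_ineq3[of b a] by (simp add: norm_minus_commute)
  finally show ?thesis using n by (simp add: field_simps)
qed

lemma sgn_eqD:
  fixes a b :: "'a::real_normed_vector"
  assumes "sgn a = sgn b" "a \<noteq> 0" "b \<noteq> 0"
  obtains \<mu> where "0 < \<mu>" "a = \<mu> *\<^sub>R b"
proof
  have n: "norm a > 0" "norm b > 0" using assms by auto
  then show "0 < norm a / norm b" by simp
  have "a = norm a *\<^sub>R sgn a" using n by (simp add: sgn_div_norm)
  also have "\<dots> = (norm a / norm b) *\<^sub>R b" unfolding assms(1) using n by (simp add: sgn_div_norm divide_inverse)
  finally show "a = (norm a / norm b) *\<^sub>R b" .
qed

text \<open>\<open>b\<close> is the least positive solution of \<open>f x = c\<close>; by the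
  intermediate value theorem \<open>f\<close> cannot exceed \<open>c\<close> before it. It will be
  the upper end of the amplitude range of a wave: the gain reaches its largest allowed value there
  and stays below it before.\<close>

lemma first_hit:
  fixes f :: "real \<Rightarrow> real"
  assumes f: "continuous_on UNIV f" and h: "0 < h" "f 0 < c" "c \<le> f h"
  shows "\<exists>b. 0 < b \<and> b \<le> h \<and> f b = c \<and> (\<forall>x. 0 \<le> x \<and> x \<le> b \<longrightarrow> f x \<le> c)"
proof -
  define Z where "Z = {x \<in> {0..h}. f x = c}"
  have fc: "continuous_on A f" for A using f continuous_on_subset by blast
  have "compact ({0..h} \<inter> f -` {c})"
    by (intro compact_Int_closed compact_Icc continuous_closed_vimage closed_singleton)
       (use f in \<open>auto simp: continuous_on_eq_continuous_at\<close>)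
  moreover have "Z = {0..h} \<inter> f -` {c}" by (auto simp: Z_def)
  ultimately have "compact Z" by simp
  moreover have ivt: "\<exists>z\<ge>0. z \<le> x \<and> f z = c" if "0 \<le> x" "c \<le> f x" for x
    using IVT'[of f 0 c x] that h(2) fc[of "{0..x}"] by auto
  obtain z where "0 \<le> z" "z \<le> h" "f z = c" using ivt[of h] h by auto
  then have "z \<in> Z" by (simp add: Z_def)
  then have "Z \<noteq> {}" by blast
  ultimately obtain b where b: "b \<in> Z" "\<And>z. z \<in> Z \<Longrightarrow> b \<le> z" using compact_attains_inf[of Z] by auto
  have "b \<noteq> 0" using b h by (auto simp: Z_def)
  moreover have "f x \<le> c" if x: "0 \<le> x" "x \<le> b" for x
  proof (rule ccontr)
    assume "\<not> f x \<le> c"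
    then have fx: "c < f x" by simp
    then obtain z where z: "0 \<le> z" "z \<le> x" "f z = c" using ivt[of x] x by auto
    then have "b \<le> z" using b x by (auto simp: Z_def)
    then have "x = z" using z x by simp
    then show False using fx z by simp
  qed
  ultimately show ?thesis using b(1) by (intro exI[of _ b]) (auto simp: Z_def)
qed

text \<open>The sine is bounded by 1 at every frequency, so \<open>h0\<close> does not depend on
  \<open>K\<close>. This order of quantifiers allows the frequency to be chosen last, large enough
  for a wave of admissible amplitude to have any required length.\<close>

lemma (in wavy_arc) wave_displacement:
  assumes "0 < \<delta>"
  shows "\<exists>h0>0. \<forall>K h x. \<bar>h\<bar> \<le> h0 \<longrightarrow> x \<in> {0..1} \<longrightarrow> norm (sgn (wave a b d K h x) - sgn (wave a b d K 0 x)) < \<delta>"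
proof -
  have nz0: "(1 - y) *\<^sub>R a + y *\<^sub>R b \<noteq> 0" for y using indep[of "1 - y" y 0] by auto
  have "compact ((\<lambda>y. norm ((1 - y) *\<^sub>R a + y *\<^sub>R b)) ` {0..1})"
    by (intro compact_continuous_image continuous_intros compact_Icc)
  then obtain m where m: "m \<in> (\<lambda>y. norm ((1 - y) *\<^sub>R a + y *\<^sub>R b)) ` {0..1}"
     "\<And>y. y \<in> {0..1} \<Longrightarrow> m \<le> norm ((1 - y) *\<^sub>R a + y *\<^sub>R b)"
    using compact_attains_inf[of "(\<lambda>y. norm ((1 - y) *\<^sub>R a + y *\<^sub>R b)) ` {0..1::real}"] by fastforce
  have mp: "0 < m" using m(1) nz0 by auto
  define D where "D = norm d + 1"
  define h0 where "h0 = \<delta> * m / (4 * D)"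
  have dp: "D > 0" using norm_ge_zero[of d] by (simp add: D_def add_nonneg_pos)
  have h0: "0 < h0" using assms mp dp by (simp add: h0_def)
  have "norm (sgn (wave a b d K h x) - sgn (wave a b d K 0 x)) < \<delta>" if h: "\<bar>h\<bar> \<le> h0" and x: "x \<in> {0..1}" for K h x
  proof -
    have w0: "wave a b d K 0 x = (1 - x) *\<^sub>R a + x *\<^sub>R b" by (simp add: wave_def)
    have "norm (sgn (wave a b d K 0 x) - sgn (wave a b d K h x)) \<le> 2 * norm (wave a b d K 0 x - wave a b d K h x) / norm (wave a b d K 0 x)"
      by (rule norm_sgn_diff_le[OF wave_nz])
    also have "\<dots> \<le> 2 * (h0 * D) / m"
    proof (rule frac_le)
      have "wave a b d K 0 x - wave a b d K h x = - ((h * sin (2 * pi * real K * x)) *\<^sub>R d)" by (simp add: wave_def)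
      then have "norm (wave a b d K 0 x - wave a b d K h x) = \<bar>h\<bar> * \<bar>sin (2 * pi * real K * x)\<bar> * norm d"
        by (simp add: abs_mult)
      also have "\<dots> \<le> h0 * 1 * D" using h by (intro mult_mono) (auto simp: D_def)
      finally show "2 * norm (wave a b d K 0 x - wave a b d K h x) \<le> 2 * (h0 * D)" by simp
      show "m \<le> norm (wave a b d K 0 x)" using m(2)[OF x] w0 by simp
    qed (use h0 mp dp in auto)
    also have "\<dots> = \<delta> / 2" using mp dp by (simp add: h0_def field_simps)
    also have "\<dots> < \<delta>" using assms by simp
    finally show ?thesis by (simp add: norm_minus_commute)
  qed
  then show ?thesis using h0 by blast
qed

text \<open>
  Two edges have at most four vertices, so the independence of any four vertices makes the polygon simple.
  The wave on an edge oscillates towards the next vertex but one; it then stays independent of the adjacent edges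
  for every amplitude.
\<close>

locale wavy_polygon =
  fixes M :: nat and p :: "nat \<Rightarrow> 'a::euclidean_space"
  assumes M4: "4 \<le> M" and period: "\<And>i. p (i + M) = p i"
    and generic: "\<And>I c. I \<subseteq> {..<M} \<Longrightarrow> card I \<le> 4 \<Longrightarrow> (\<Sum>i\<in>I. c i *\<^sub>R p i) = 0 \<Longrightarrow> \<forall>i\<in>I. c i = 0"
begin

lemma p_mod: "p (i mod M) = p i"
proof -
  have "p (j + k * M) = p j" for j k
    by (induction k) (use period in \<open>auto simp: add.assoc[symmetric] add.commute[of M]\<close>)
  from this[of "i mod M" "i div M"] show ?thesis by (simp add: add.commute)
qed

lemma mod_shift_ne:
  assumes "a < M" "b < M" "a \<noteq> b" shows "(i + a) mod M \<noteq> (i + b) mod M"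
proof -
  have lt: "(i + a) mod M \<noteq> (i + b) mod M" if "a < b" "b < M" for a b
  proof
    assume "(i + a) mod M = (i + b) mod M"
    then have "M dvd (i + b) - (i + a)" using that by (subst mod_eq_dvd_iff_nat[symmetric]) auto
    then show False using that by (auto dest: dvd_imp_le)
  qed
  show ?thesis using assms lt[of a b] lt[of b a] by (cases "a < b") auto
qed

lemma indep_indices:
  assumes d: "distinct [i, j, k, l]" "i < M" "j < M" "k < M" "l < M"
    and 0: "u *\<^sub>R p i + v *\<^sub>R p j + w *\<^sub>R p k + z *\<^sub>R p l = 0"
  shows "u = 0 \<and> v = 0 \<and> w = 0 \<and> z = 0"
proof -
  define c where "c n = (if n = i then u else if n = j then v else if n = k then w else z)" for n
  have "\<forall>n\<in>{i, j, k, l}. c n = 0"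
    by (rule generic) (use d 0 in \<open>auto simp: c_def add.assoc\<close>)
  then show ?thesis using d by (auto simp: c_def split: if_splits)
qed

lemma indep4:
  assumes "u *\<^sub>R p i + v *\<^sub>R p (i + 1) + w *\<^sub>R p (i + 2) + z *\<^sub>R p (i + 3) = 0"
  shows "u = 0 \<and> v = 0 \<and> w = 0 \<and> z = 0"
proof (rule indep_indices)
  show "distinct [i mod M, (i + 1) mod M, (i + 2) mod M, (i + 3) mod M]"
    using mod_shift_ne[of 0 1 i] mod_shift_ne[of 0 2 i] mod_shift_ne[of 0 3 i] mod_shift_ne[of 1 2 i]
      mod_shift_ne[of 1 3 i] mod_shift_ne[of 2 3 i] M4 by simp
  show "u *\<^sub>R p (i mod M) + v *\<^sub>R p ((i + 1) mod M) + w *\<^sub>R p ((i + 2) mod M) + z *\<^sub>R p ((i + 3) mod M) = 0"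
    using assms by (simp only: p_mod)
qed (use M4 in auto)

sublocale arc: wavy_arc "p i" "p (i + 1)" "p (i + 2)" for i
  by standard (use indep4[of _ i _ _ 0] in auto)

definition edge :: "nat \<Rightarrow> (nat \<Rightarrow> real) \<Rightarrow> nat \<Rightarrow> real \<Rightarrow> 'a" where
  "edge K \<eta> i x = sgn (wave (p i) (p (i + 1)) (p (i + 2)) K (\<eta> i) x)"

definition edge' :: "nat \<Rightarrow> (nat \<Rightarrow> real) \<Rightarrow> nat \<Rightarrow> real \<Rightarrow> 'a" where
  "edge' K \<eta> i x = radial_deriv (wave (p i) (p (i + 1)) (p (i + 2)) K (\<eta> i) x) (wave' (p i) (p (i + 1)) (p (i + 2)) K (\<eta> i) x)"

sublocale glued_arcs M "edge K \<eta>" "edge' K \<eta>" for K \<eta>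
proof
  show "0 < M" using M4 by simp
  fix i x assume "i < M"
  have s: "sin (2 * pi * real K) = 0" using sin_npi[of "2 * K"] by (simp add: mult_ac)
  show "edge K \<eta> i 1 = edge K \<eta> (Suc i) 0" using s by (simp add: edge_def wave_def)
  show "(edge K \<eta> i has_vector_derivative edge' K \<eta> i x) (at x within {0..1})"
    unfolding edge_def[abs_def] edge'_def by (rule arc.sgn_wave_deriv)
  show "continuous_on {0..1} (edge' K \<eta> i)"
    unfolding edge'_def[abs_def] by (rule arc.cont_fixed[OF arc.cont_radial])
qed

text \<open>Both edges with their waves are combinations of the four independent vertices from
  \<open>p i\<close> to \<open>p (i + 3)\<close>, and \<open>p i\<close> occurs in the first one
  only, with the nonzero coefficient 1 - x.\<close>

lemma adjacent_edges_disjoint: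
  assumes j: "j mod M = (i + 1) mod M" and x: "x \<in> {0..<1}"
  shows "edge K \<eta> i x \<noteq> edge K \<theta> j y"
proof
  assume eq: "edge K \<eta> i x = edge K \<theta> j y"
  have pj: "p j = p (i + 1)" "p (j + 1) = p (i + 2)" "p (j + 2) = p (i + 3)"
  proof -
    show "p j = p (i + 1)" using j p_mod by metis
    have "(j + 1) mod M = (i + 1 + 1) mod M" using j by (metis mod_add_left_eq)
    then show "p (j + 1) = p (i + 2)" using p_mod by (metis add.assoc one_add_one)
    have "(j + 2) mod M = (i + 1 + 2) mod M" using j by (metis mod_add_left_eq)
    moreover have "i + 1 + 2 = i + 3" by simp
    ultimately show "p (j + 2) = p (i + 3)" using p_mod[of "j + 2"] p_mod[of "i + 3"] by (simp only:)
  qed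
  obtain \<mu> where \<mu>: "wave (p i) (p (i + 1)) (p (i + 2)) K (\<eta> i) x = \<mu> *\<^sub>R wave (p j) (p (j + 1)) (p (j + 2)) K (\<theta> j) y"
    by (rule sgn_eqD[OF eq[unfolded edge_def] arc.wave_nz arc.wave_nz])
  define s where "s = \<eta> i * sin (2 * pi * real K * x)"
  define s' where "s' = \<theta> j * sin (2 * pi * real K * y)"
  have "(1 - x) *\<^sub>R p i + (x - \<mu> * (1 - y)) *\<^sub>R p (i + 1) + (s - \<mu> * y) *\<^sub>R p (i + 2) + (- \<mu> * s') *\<^sub>R p (i + 3) = 0"
    using \<mu> unfolding pj wave_def s_def[symmetric] s'_def[symmetric] by (simp add: algebra_simps)
  then have "1 - x = 0" using indep4 by blast
  then show False using x by simp
qed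

text \<open>The coefficients of \<open>p i\<close> and \<open>p (i + 1)\<close> are 1 - x and x.
  Their sum is 1 at every parameter, so two points with the same projection have ratio 1.\<close>

lemma same_edge_injective:
  assumes "edge K \<eta> i x = edge K \<eta> i y" shows "x = y"
proof -
  obtain \<mu> where \<mu>: "wave (p i) (p (i + 1)) (p (i + 2)) K (\<eta> i) x = \<mu> *\<^sub>R wave (p i) (p (i + 1)) (p (i + 2)) K (\<eta> i) y"
    by (rule sgn_eqD[OF assms[unfolded edge_def] arc.wave_nz arc.wave_nz])
  define s where "s = \<eta> i * sin (2 * pi * real K * x)"
  define s' where "s' = \<eta> i * sin (2 * pi * real K * y)"
  have "((1 - x) - \<mu> * (1 - y)) *\<^sub>R p i + (x - \<mu> * y) *\<^sub>R p (i + 1) + (s - \<mu> * s') *\<^sub>R p (i + 2) = 0"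
    using \<mu> unfolding wave_def s_def[symmetric] s'_def[symmetric] by (simp add: algebra_simps)
  then have "(1 - x) - \<mu> * (1 - y) = 0" "x - \<mu> * y = 0" using arc.indep by blast+
  then have "\<mu> = 1" "x = \<mu> * y" by (simp_all add: algebra_simps)
  then show ?thesis by simp
qed

lemma distant_edges_separated:
  assumes ij: "i < M" "j < M" "i \<noteq> j" "j \<noteq> (i + 1) mod M" "i \<noteq> (j + 1) mod M"
  shows "\<exists>e>0. \<forall>x\<in>{0..1}. \<forall>y\<in>{0..1}. e \<le> norm (edge 0 (\<lambda>_. 0) i x - edge 0 (\<lambda>_. 0) j y)"
proof -
  let ?E = "\<lambda>i. edge 0 (\<lambda>_. 0) i ` {0..1}"
  have c: "compact (?E i)" for i
    unfolding edge_def by (intro compact_continuous_image arc.cont_fixed[OF arc.cont_sgn_wave] compact_Icc)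
  have dis: "?E i \<inter> ?E j = {}"
  proof -
    have "edge 0 (\<lambda>_. 0) i x \<noteq> edge 0 (\<lambda>_. 0) j y" for x y
    proof
      assume eq: "edge 0 (\<lambda>_. 0) i x = edge 0 (\<lambda>_. 0) j y"
      obtain \<mu> where \<mu>: "wave (p i) (p (i + 1)) (p (i + 2)) 0 0 x = \<mu> *\<^sub>R wave (p j) (p (j + 1)) (p (j + 2)) 0 0 y"
        by (rule sgn_eqD[OF eq[unfolded edge_def] arc.wave_nz arc.wave_nz])
      have "(1 - x) *\<^sub>R p i + x *\<^sub>R p ((i + 1) mod M) + (- \<mu> * (1 - y)) *\<^sub>R p j + (- \<mu> * y) *\<^sub>R p ((j + 1) mod M) = 0"
        using \<mu> by (simp add: wave_def p_mod algebra_simps del: Suc_eq_plus1)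
      moreover have "distinct [i, (i + 1) mod M, j, (j + 1) mod M]"
      proof -
        have "i \<noteq> (i + 1) mod M" "j \<noteq> (j + 1) mod M"
          using mod_shift_ne[of 0 1 i] mod_shift_ne[of 0 1 j] ij M4 by auto
        moreover have "(i + 1) mod M \<noteq> (j + 1) mod M"
          using ij mod_shift_ne[of i j 1] by (simp add: add.commute)
        ultimately show ?thesis using ij by auto
      qed
      ultimately have "1 - x = 0 \<and> x = 0" using indep_indices ij M4 by (metis mod_less_divisor M)
      then show False by auto
    qed
    then show ?thesis by auto
  qed
  obtain e where e: "0 < e" "\<And>x y. x \<in> ?E i \<Longrightarrow> y \<in> ?E j \<Longrightarrow> e \<le> dist x y"
    using separate_compact_closed[OF c compact_imp_closed[OF c] dis] by blast
  then show ?thesis by (intro exI[of _ e]) (auto simp: dist_norm)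
qed

text \<open>Only pairs of nonadjacent edges limit the amplitude: a wave may move each of them by at
  most half of their distance in the flat polygon. Equal and adjacent edges are settled by
  independence.\<close>

lemma small_waves:
  assumes \<delta>: "0 < \<delta>"
  shows "\<exists>h0>0. \<forall>K \<eta>. (\<forall>i<M. \<bar>\<eta> i\<bar> \<le> h0) \<longrightarrow>
     (\<forall>i<M. \<forall>x\<in>{0..1}. norm (edge K \<eta> i x - edge 0 (\<lambda>_. 0) i x) < \<delta>) \<and>
     simple_path (glue M (edge K \<eta>)) \<and> glue M (edge K \<eta>) 0 = glue M (edge K \<eta>) 1"
proof -
  define far where "far = {(i, j). i < M \<and> j < M \<and> i \<noteq> j \<and> j \<noteq> (i + 1) mod M \<and> i \<noteq> (j + 1) mod M}"
  have ffar: "finite far" by (rule finite_subset[of _ "{..<M} \<times> {..<M}"]) (auto simp: far_def)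
  have "\<forall>q\<in>far. \<exists>e>0. \<forall>x\<in>{0..1}. \<forall>y\<in>{0..1}. e \<le> norm (edge 0 (\<lambda>_. 0) (fst q) x - edge 0 (\<lambda>_. 0) (snd q) y)"
    using distant_edges_separated by (auto simp: far_def)
  then obtain e where e: "\<And>q. q \<in> far \<Longrightarrow> 0 < e q"
    "\<And>q x y. q \<in> far \<Longrightarrow> x \<in> {0..1} \<Longrightarrow> y \<in> {0..1} \<Longrightarrow> e q \<le> norm (edge 0 (\<lambda>_. 0) (fst q) x - edge 0 (\<lambda>_. 0) (snd q) y)"
    by (metis (no_types, lifting) bchoice)
  define \<delta>' where "\<delta>' = Min (insert \<delta> ((\<lambda>q. e q / 2) ` far))"
  have \<delta>': "0 < \<delta>'" "\<delta>' \<le> \<delta>" "\<And>q. q \<in> far \<Longrightarrow> \<delta>' \<le> e q / 2"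
  proof -
    have fin: "finite (insert \<delta> ((\<lambda>q. e q / 2) ` far))" using ffar by simp
    show "0 < \<delta>'" unfolding \<delta>'_def using fin e(1) \<delta> by (subst Min_gr_iff) auto
    show "\<delta>' \<le> \<delta>" unfolding \<delta>'_def by (rule Min_le[OF fin]) simp
    show "\<delta>' \<le> e q / 2" if "q \<in> far" for q unfolding \<delta>'_def by (rule Min_le[OF fin]) (use that in simp)
  qed
  have "\<forall>i. \<exists>h0>0. \<forall>K h x. \<bar>h\<bar> \<le> h0 \<longrightarrow> x \<in> {0..1} \<longrightarrow>
     norm (sgn (wave (p i) (p (i + 1)) (p (i + 2)) K h x) - sgn (wave (p i) (p (i + 1)) (p (i + 2)) K 0 x)) < \<delta>'"
    using arc.wave_displacement[OF \<delta>'(1)] by blast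
  from choice[OF this] obtain h0 where h0: "\<And>i. 0 < h0 i"
    "\<And>i K h x. \<bar>h\<bar> \<le> h0 i \<Longrightarrow> x \<in> {0..1} \<Longrightarrow>
     norm (sgn (wave (p i) (p (i + 1)) (p (i + 2)) K h x) - sgn (wave (p i) (p (i + 1)) (p (i + 2)) K 0 x)) < \<delta>'"
    by blast
  define h1 where "h1 = Min (h0 ` {..<M})"
  have h1: "0 < h1" "\<And>i. i < M \<Longrightarrow> h1 \<le> h0 i" unfolding h1_def using h0(1) M by (auto simp: Min_gr_iff lessThan_empty_iff)
  have "(\<forall>i<M. \<forall>x\<in>{0..1}. norm (edge K \<eta> i x - edge 0 (\<lambda>_. 0) i x) < \<delta>) \<and>
     simple_path (glue M (edge K \<eta>)) \<and> glue M (edge K \<eta>) 0 = glue M (edge K \<eta>) 1"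
    if \<eta>: "\<forall>i<M. \<bar>\<eta> i\<bar> \<le> h1" for K \<eta>
  proof -
    have near: "norm (edge K \<eta> i x - edge 0 (\<lambda>_. 0) i x) < \<delta>'" if "i < M" "x \<in> {0..1}" for i x
    proof -
      have "wave (p i) (p (i + 1)) (p (i + 2)) K 0 x = wave (p i) (p (i + 1)) (p (i + 2)) 0 0 x" by (simp add: wave_def)
      then show ?thesis using h0(2)[of "\<eta> i" i x K] \<eta> that h1(2)[OF that(1)] unfolding edge_def by force
    qed
    have inj: "i = j \<and> x = y" if ij: "i < M" "j < M" and xy: "x \<in> {0..<1}" "y \<in> {0..<1}" and eq: "edge K \<eta> i x = edge K \<eta> j y" for i j x y
    proof -
      have xy': "x \<in> {0..1}" "y \<in> {0..1}" using xy by auto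
      have "j \<noteq> (i + 1) mod M" using adjacent_edges_disjoint[of j i x K \<eta> \<eta> y] xy eq ij by auto
      moreover have "i \<noteq> (j + 1) mod M" using adjacent_edges_disjoint[of i j y K \<eta> \<eta> x] xy eq ij by auto
      moreover have "(i, j) \<notin> far"
      proof
        assume f: "(i, j) \<in> far"
        let ?a = "edge 0 (\<lambda>_. 0) i x" and ?b = "edge 0 (\<lambda>_. 0) j y" and ?m = "edge K \<eta> i x"
        have "norm (?a - ?b) = norm ((?m - ?b) - (?m - ?a))" by simp
        also have "\<dots> \<le> norm (?m - ?b) + norm (?m - ?a)" by (rule norm_triangle_ineq4)
        also have "\<dots> < \<delta>' + \<delta>'" using near[OF ij(1) xy'(1)] near[OF ij(2) xy'(2)] eq by simp
        also have "\<dots> \<le> e (i, j)" using \<delta>'(3)[OF f] by simp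
        finally show False using e(2)[OF f xy'] by simp
      qed
      ultimately have "i = j" using ij by (auto simp: far_def)
      then show ?thesis using same_edge_injective eq by blast
    qed
    have cl: "edge K \<eta> M 0 = edge K \<eta> 0 0" using period[of 0] by (simp add: edge_def wave_def)
    have "simple_path (glue M (edge K \<eta>))" "glue M (edge K \<eta>) 0 = glue M (edge K \<eta>) 1"
      by (rule glue_simple[OF inj cl]; assumption)+
    moreover have "\<forall>i<M. \<forall>x\<in>{0..1}. norm (edge K \<eta> i x - edge 0 (\<lambda>_. 0) i x) < \<delta>"
      using near \<delta>'(2) by (meson less_le_trans)
    ultimately show ?thesis by blast
  qed
  then show ?thesis using h1(1) by blast
qed

lemma edge_in_sphere: "edge K \<eta> i x \<in> sphere 0 1"
  using arc.wave_nz by (simp add: edge_def norm_sgn)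

lemma glue_in_sphere: "path_image (glue M (edge K \<eta>)) \<subseteq> sphere 0 1"
  unfolding path_image_def glue_def using edge_in_sphere by auto

lemma glue_edge_smooth: "piecewise_smooth (glue M (edge K \<eta>))"
  unfolding edge_def[abs_def] by (rule glue_piecewise_smooth[unfolded edge_def[abs_def]]) (rule arc.smooth_sgn_wave)

lemma glue_edge_integral:
  assumes F: "continuous_on UNIV F"
  shows "((\<lambda>s. F (glue M (edge K \<eta>) s) * speed (glue M (edge K \<eta>)) s) has_integral
      (\<Sum>i<M. arc_integral F (p i) (p (i + 1)) (p (i + 2)) K (\<eta> i))) {0..1}"
proof -
  have "continuous_on {0..1} (\<lambda>x. F (edge K \<eta> i x))" for i
    unfolding edge_def by (rule continuous_on_compose2[OF F arc.cont_fixed[OF arc.cont_sgn_wave]]) auto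
  from glue_integral[OF this] show ?thesis by (simp add: arc_integral_def edge_def edge'_def)
qed

end

section \<open>Perturbation of a closed polygon\<close>

lemma segment_nonzero:
  assumes "norm a = 1" "norm b = 1" "norm (a - b) \<le> 1" "x \<in> {0..1::real}"
  shows "(1 - x) *\<^sub>R a + x *\<^sub>R b \<noteq> 0"
proof
  assume 0: "(1 - x) *\<^sub>R a + x *\<^sub>R b = 0"
  have "a = x *\<^sub>R (a - b)" "b = - ((1 - x) *\<^sub>R (a - b))" using 0 by (simp_all add: algebra_simps)
  then have "norm a = x * norm (a - b)" "norm b = (1 - x) * norm (a - b)"
    using assms(4) by (metis abs_of_nonneg atLeastAtMost_iff norm_scaleR, metis abs_of_nonneg atLeastAtMost_iff diff_ge_0_iff_ge norm_minus_cancel norm_scaleR)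
  moreover have "x * norm (a - b) \<le> x * 1" "(1 - x) * norm (a - b) \<le> (1 - x) * 1"
    using assms by (intro mult_left_mono; simp)+
  ultimately show False using assms by auto
qed

text \<open>General position is produced for a whole sequence and then folded modulo
  \<open>M\<close>, which restores the period. Arc length is continuous in the end points, and only
  \<open>M\<close> edges have to be controlled.\<close>

lemma generic_perturbation:
  fixes x :: "nat \<Rightarrow> 'a::euclidean_space"
  assumes dim: "4 \<le> DIM('a)" and M: "4 \<le> M" and period: "\<And>i. x (i + M) = x i"
    and x: "\<And>i. norm (x i) = 1" "\<And>i. norm (x i - x (i + 1)) \<le> 1" and e: "0 < \<delta>" "0 < \<kappa>"
  shows "\<exists>p. wavy_polygon M p \<and> (\<forall>i. norm (p i - x i) < \<delta>) \<and>
     (\<forall>i<M. \<bar>arc_len (p i) (p (i + 1)) - arc_len (x i) (x (i + 1))\<bar> < \<kappa>)"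
proof -
  let ?U = "{(a::'a, b). \<forall>x\<in>{0..1}. (1 - x) *\<^sub>R a + x *\<^sub>R b \<noteq> 0}"
  have xU: "(x i, x (i + 1)) \<in> ?U" for i using segment_nonzero[OF x(1) x(1) x(2)] by auto
  have "\<exists>d>0. \<forall>q\<in>?U. dist q (x i, x (i + 1)) < d \<longrightarrow> dist ((\<lambda>(a, b). arc_len a b) q) (arc_len (x i) (x (i + 1))) < \<kappa>" for i
    using arc_len_continuous[where 'a='a, unfolded continuous_on_iff, rule_format, OF xU e(2), of i] by fastforce
  then have "\<forall>i. \<exists>d>0. \<forall>q\<in>?U. dist q (x i, x (i + 1)) < d \<longrightarrow> dist ((\<lambda>(a, b). arc_len a b) q) (arc_len (x i) (x (i + 1))) < \<kappa>" ..
  from choice[OF this] obtain d where d: "\<And>i. 0 < d i"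
    "\<And>i q. q \<in> ?U \<Longrightarrow> dist q (x i, x (i + 1)) < d i \<Longrightarrow> dist ((\<lambda>(a, b). arc_len a b) q) (arc_len (x i) (x (i + 1))) < \<kappa>"
    by blast
  define d0 where "d0 = Min (insert \<delta> ((\<lambda>i. d i / 2) ` {..<M}))"
  have d0: "0 < d0" "d0 \<le> \<delta>" "\<And>i. i < M \<Longrightarrow> d0 \<le> d i / 2"
  proof -
    have fin: "finite (insert \<delta> ((\<lambda>i. d i / 2) ` {..<M}))" by simp
    show "0 < d0" unfolding d0_def using fin d(1) e by (subst Min_gr_iff) auto
    show "d0 \<le> \<delta>" unfolding d0_def by (rule Min_le[OF fin]) simp
    show "d0 \<le> d i / 2" if "i < M" for i unfolding d0_def by (rule Min_le[OF fin]) (use that in simp)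
  qed
  obtain q where q: "\<And>i. norm (q i - x i) < d0"
    "\<And>I c. finite I \<Longrightarrow> card I \<le> 4 \<Longrightarrow> (\<Sum>i\<in>I. c i *\<^sub>R q i) = 0 \<Longrightarrow> \<forall>i\<in>I. c i = 0"
    using general_position[OF dim d0(1), of x] by blast
  define p where "p i = q (i mod M)" for i
  have xm: "x (i mod M) = x i" for i
  proof -
    have "x (j + k * M) = x j" for j k
      by (induction k) (use period in \<open>auto simp: add.assoc[symmetric] add.commute[of M]\<close>)
    from this[of "i mod M" "i div M"] show ?thesis by (simp add: add.commute)
  qed
  interpret wavy_polygon M p
  proof
    show "4 \<le> M" by (rule M)
    show "p (i + M) = p i" for i by (simp add: p_def)
    fix I c assume I: "I \<subseteq> {..<M}" "card I \<le> 4" "(\<Sum>i\<in>I. c i *\<^sub>R p i) = 0"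
    have "(\<Sum>i\<in>I. c i *\<^sub>R q i) = (\<Sum>i\<in>I. c i *\<^sub>R p i)"
      by (intro sum.cong refl) (use I(1) in \<open>auto simp: p_def\<close>)
    then show "\<forall>i\<in>I. c i = 0" using q(2)[of I c] I finite_subset by auto
  qed
  have near: "norm (p i - x i) < d0" for i using q(1)[of "i mod M"] xm[of i] by (simp add: p_def)
  have "\<bar>arc_len (p i) (p (i + 1)) - arc_len (x i) (x (i + 1))\<bar> < \<kappa>" if i: "i < M" for i
  proof -
    have "(1 - y) *\<^sub>R p i + y *\<^sub>R p (i + 1) \<noteq> 0" for y using arc.indep[of "1 - y" i y 0] by auto
    then have "(p i, p (i + 1)) \<in> ?U" by auto
    moreover have "dist (p i, p (i + 1)) (x i, x (i + 1)) < d i"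
    proof -
      have "dist (p i, p (i + 1)) (x i, x (i + 1)) \<le> dist (p i) (x i) + dist (p (i + 1)) (x (i + 1))"
        by (simp add: dist_Pair_Pair sqrt_sum_squares_le_sum)
      also have "\<dots> < d0 + d0" using near[of i] near[of "i + 1"] by (simp add: dist_norm)
      also have "\<dots> \<le> d i" using d0(3)[OF i] by simp
      finally show ?thesis .
    qed
    ultimately show ?thesis using d(2)[of "(p i, p (i + 1))" i] by (simp add: dist_real_def)
  qed
  moreover have "norm (p i - x i) < \<delta>" for i using near[of i] d0(2) by simp
  ultimately show ?thesis using wavy_polygon_axioms by blast
qed

section \<open>Solving the moment equations by amplitudes\<close>

text \<open>The unknowns are the amplitudes on edges that start near the nodes in \<open>S\<close>.
  As the \<open>g y\<close> are Lagrange functions on \<open>Y\<close>, length gained near a node of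
  \<open>Y\<close> changes its own moment by about that length and the moments of the other nodes of
  \<open>Y\<close> hardly at all. Masses at nodes outside \<open>Y\<close> are not determined by the
  moments, so their gains are prescribed instead. The bounds \<open>rmin\<close>,
  \<open>rmax\<close> and \<open>\<Lambda>\<close> do not depend on \<epsilon> in
  \<open>approx\<close>, so the mesh can be chosen after the error budget.\<close>

theorem exact_simple_curve:
  fixes S Y :: "'a::euclidean_space set" and g :: "'a \<Rightarrow> 'a \<Rightarrow> real" and T :: "'a \<Rightarrow> real"
  assumes dim: "4 \<le> DIM('a)"
    and S: "finite S" "S \<subseteq> sphere 0 1" "Y \<subseteq> S"
    and g: "\<And>y. y \<in> Y \<Longrightarrow> continuous_on UNIV (g y)"
    and lagrange: "\<And>y y'. y \<in> Y \<Longrightarrow> y' \<in> Y \<Longrightarrow> g y y' = (if y = y' then 1 else 0)"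
    and rmin: "0 < rmin"
    and approx: "\<And>\<epsilon>. 0 < \<epsilon> \<Longrightarrow> \<exists>(M::nat) x \<rho>. 4 \<le> M \<and> (\<forall>i. x (i + M) = x i) \<and> (\<forall>i. x i \<in> sphere 0 1) \<and>
        S \<subseteq> x ` {..<M} \<and> (\<forall>i. norm (x i - x (i + 1)) \<le> \<epsilon>) \<and>
        (\<Sum>i<M. arc_len (x i) (x (i + 1))) \<le> \<Lambda> \<and> (\<forall>s\<in>S. rmin \<le> \<rho> s \<and> \<rho> s \<le> rmax) \<and>
        (\<forall>y\<in>Y. (\<Sum>i<M. arc_len (x i) (x (i + 1)) * g y (x i)) + (\<Sum>s\<in>S. \<rho> s * g y s) = T y)"
  shows "\<exists>\<gamma>. simple_path \<gamma> \<and> \<gamma> 0 = \<gamma> 1 \<and> path_image \<gamma> \<subseteq> sphere 0 1 \<and> piecewise_smooth \<gamma> \<and>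
      (\<forall>F. continuous_on UNIV F \<longrightarrow> (\<lambda>s. F (\<gamma> s) * speed \<gamma> s) integrable_on {0..1}) \<and>
      (\<forall>y\<in>Y. integral {0..1} (\<lambda>s. g y (\<gamma> s) * speed \<gamma> s) = T y)"
proof -
  have finY: "finite Y" using S finite_subset by blast
  define n where "n = card S"
  obtain s where s: "bij_betw s {..<n} S" using ex_bij_betw_nat_finite[OF S(1)] by (auto simp: n_def atLeast0LessThan)
  have sS: "k < n \<Longrightarrow> s k \<in> S" for k using s by (auto simp: bij_betw_def)
  have "\<exists>B>0. \<forall>y\<in>Y. \<forall>x\<in>sphere 0 1. \<bar>g y x\<bar> \<le> B"
  proof -
    have "\<forall>y\<in>Y. \<exists>B. \<forall>x\<in>sphere 0 1. \<bar>g y x\<bar> \<le> B"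
    proof
      fix y assume "y \<in> Y"
      have "compact (g y ` sphere 0 1)" by (intro compact_continuous_image continuous_on_subset[OF g[OF \<open>y \<in> Y\<close>]]) auto
      then show "\<exists>B. \<forall>x\<in>sphere 0 1. \<bar>g y x\<bar> \<le> B" using compact_imp_bounded bounded_iff by (metis imageI real_norm_def)
    qed
    from bchoice[OF this] obtain B where B: "\<And>y x. y \<in> Y \<Longrightarrow> x \<in> sphere 0 1 \<Longrightarrow> \<bar>g y x\<bar> \<le> B y" by blast
    have "\<bar>g y x\<bar> \<le> 1 + (\<Sum>z\<in>Y. \<bar>B z\<bar>)" if "y \<in> Y" "x \<in> sphere 0 1" for y x
      using B[OF that] member_le_sum[OF that(1), of "\<lambda>z. \<bar>B z\<bar>"] finY by force
    moreover have "0 < 1 + (\<Sum>z\<in>Y. \<bar>B z\<bar>)" by (intro add_pos_nonneg sum_nonneg) auto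
    ultimately show ?thesis by blast
  qed
  then obtain B where B: "0 < B" "\<And>y x. y \<in> Y \<Longrightarrow> x \<in> sphere 0 1 \<Longrightarrow> \<bar>g y x\<bar> \<le> B" by blast
  define L where "L = \<bar>\<Lambda>\<bar> + 1"
  \<comment> \<open>The arc length along which \<open>g y\<close> gets replaced by its value at a
    vertex: \<open>L\<close> for the flat polygon, and for each of the \<open>n\<close> nodes one
    edge with and one without its wave.\<close>
  define W where "W = L + real n * (2 * \<bar>rmax\<bar> + 2 * L)"
  have LW: "1 \<le> L" "L \<le> W" by (auto simp: L_def W_def)
  \<comment> \<open>At most half of \<open>rmin\<close> is spent: a quarter on the oscillation of
    the \<open>g y\<close> along an edge, a quarter on the change \<open>\<kappa>0\<close> of length
    under perturbation, which is later shared among the \<open>M\<close> edges.\<close>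
  define \<omega> where "\<omega> = rmin / (4 * W)"
  define \<kappa>0 where "\<kappa>0 = min 1 (rmin / (4 * B))"
  have \<omega>: "0 < \<omega>" using rmin LW by (simp add: \<omega>_def)
  have \<kappa>0: "0 < \<kappa>0" "\<kappa>0 \<le> 1" "B * \<kappa>0 \<le> rmin / 4" using rmin B by (auto simp: \<kappa>0_def min_def field_simps)
  have small: "\<omega> * W + B * \<kappa>0 < rmin"
  proof -
    have "\<omega> * W = rmin / 4" using LW by (simp add: \<omega>_def)
    then show ?thesis using \<kappa>0 rmin by linarith
  qed
  have "\<exists>\<delta>>0. \<forall>y\<in>Y. \<forall>u\<in>sphere 0 1. \<forall>v\<in>sphere 0 1. norm (u - v) < \<delta> \<longrightarrow> \<bar>g y u - g y v\<bar> \<le> \<omega>"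
  proof -
    have "\<forall>y\<in>Y. \<exists>\<delta>>0. \<forall>u\<in>sphere 0 1. \<forall>v\<in>sphere 0 1. norm (u - v) < \<delta> \<longrightarrow> \<bar>g y u - g y v\<bar> \<le> \<omega>"
    proof
      fix y assume "y \<in> Y"
      have "uniformly_continuous_on (sphere 0 1) (g y)"
        by (intro compact_uniformly_continuous continuous_on_subset[OF g[OF \<open>y \<in> Y\<close>]]) auto
      then obtain \<delta> where "\<delta> > 0" "\<And>u v. u \<in> sphere 0 1 \<Longrightarrow> v \<in> sphere 0 1 \<Longrightarrow> dist v u < \<delta> \<Longrightarrow> dist (g y v) (g y u) < \<omega>"
        unfolding uniformly_continuous_on_def using \<omega> by blast
      then show "\<exists>\<delta>>0. \<forall>u\<in>sphere 0 1. \<forall>v\<in>sphere 0 1. norm (u - v) < \<delta> \<longrightarrow> \<bar>g y u - g y v\<bar> \<le> \<omega>"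
        by (intro exI[of _ \<delta>]) (simp add: dist_norm less_imp_le)
    qed
    from bchoice[OF this] obtain \<delta> where \<delta>: "\<forall>y\<in>Y. 0 < \<delta> y \<and> (\<forall>u\<in>sphere 0 1. \<forall>v\<in>sphere 0 1. norm (u - v) < \<delta> y \<longrightarrow> \<bar>g y u - g y v\<bar> \<le> \<omega>)" ..
    show ?thesis
    proof (intro exI[of _ "Min (insert 1 (\<delta> ` Y))"] conjI ballI impI)
      show "0 < Min (insert 1 (\<delta> ` Y))" using finY \<delta> by auto
      fix y u v :: 'a assume yuv: "y \<in> Y" "u \<in> sphere 0 1" "v \<in> sphere 0 1" "norm (u - v) < Min (insert 1 (\<delta> ` Y))"
      have "Min (insert 1 (\<delta> ` Y)) \<le> \<delta> y" using finY yuv by (intro Min_le) auto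
      then show "\<bar>g y u - g y v\<bar> \<le> \<omega>" using \<delta> yuv by (meson less_le_trans)
    qed
  qed
  then obtain \<delta> where \<delta>: "0 < \<delta>" "\<And>y u v. y \<in> Y \<Longrightarrow> u \<in> sphere 0 1 \<Longrightarrow> v \<in> sphere 0 1 \<Longrightarrow> norm (u - v) < \<delta> \<Longrightarrow> \<bar>g y u - g y v\<bar> \<le> \<omega>"
    by blast
  \<comment> \<open>Mesh and displacement of the vertices, at most \<delta>/8 each, add up to
    \<delta>/4, which \<open>norm_sgn_diff_le\<close> doubles. The other half of \<delta> is left to
    the wave.\<close>
  define \<epsilon> where "\<epsilon> = min 1 (\<delta> / 8)"
  have \<epsilon>: "0 < \<epsilon>" "\<epsilon> \<le> 1" "\<epsilon> \<le> \<delta> / 8" using \<delta>(1) by (simp_all add: \<epsilon>_def)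
  obtain M :: nat and x \<rho> where H: "4 \<le> M \<and> (\<forall>i. x (i + M) = x i) \<and> (\<forall>i. x i \<in> sphere 0 1) \<and>
        S \<subseteq> x ` {..<M} \<and> (\<forall>i. norm (x i - x (i + 1)) \<le> \<epsilon>) \<and>
        (\<Sum>i<M. arc_len (x i) (x (i + 1))) \<le> \<Lambda> \<and> (\<forall>s\<in>S. rmin \<le> \<rho> s \<and> \<rho> s \<le> rmax) \<and>
        (\<forall>y\<in>Y. (\<Sum>i<M. arc_len (x i) (x (i + 1)) * g y (x i)) + (\<Sum>s\<in>S. \<rho> s * g y s) = T y)"
    using approx[OF \<epsilon>(1)] by (elim exE)
  have M4: "4 \<le> M" and Sx: "S \<subseteq> x ` {..<M}" and len: "(\<Sum>i<M. arc_len (x i) (x (i + 1))) \<le> \<Lambda>"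
    using H by blast+
  have xper: "x (i + M) = x i" and xsph: "x i \<in> sphere 0 1" and mesh: "norm (x i - x (i + 1)) \<le> \<epsilon>" for i
    using H by blast+
  have \<rho>: "rmin \<le> \<rho> s" "\<rho> s \<le> rmax" if "s \<in> S" for s
    using H that by blast+
  have T: "(\<Sum>i<M. arc_len (x i) (x (i + 1)) * g y (x i)) + (\<Sum>s\<in>S. \<rho> s * g y s) = T y" if "y \<in> Y" for y
    using H that by blast
  have xn: "norm (x i) = 1" for i using xsph[of i] by simp
  have M0: "0 < M" using M4 by simp
  define \<kappa> where "\<kappa> = \<kappa>0 / real M"
  have \<kappa>: "0 < \<kappa>" using \<kappa>0 M0 by (simp add: \<kappa>_def)
  have mesh1: "norm (x i - x (i + 1)) \<le> 1" for i using mesh[of i] \<epsilon> by linarith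
  obtain p where p: "wavy_polygon M p" "\<And>i. norm (p i - x i) < \<delta> / 8"
      "\<And>i. i < M \<Longrightarrow> \<bar>arc_len (p i) (p (i + 1)) - arc_len (x i) (x (i + 1))\<bar> < \<kappa>"
    using generic_perturbation[OF dim M4 xper xn mesh1, of "\<delta> / 8" \<kappa>] \<delta>(1) \<kappa> by (metis half_gt_zero_iff divide_pos_pos zero_less_numeral)
  interpret wavy_polygon M p by (rule p(1))
  obtain h0 where h0: "0 < h0" "\<And>K \<eta>. \<forall>i<M. \<bar>\<eta> i\<bar> \<le> h0 \<Longrightarrow>
     (\<forall>i<M. \<forall>x\<in>{0..1}. norm (edge K \<eta> i x - edge 0 (\<lambda>_. 0) i x) < \<delta> / 2) \<and>
     simple_path (glue M (edge K \<eta>)) \<and> glue M (edge K \<eta>) 0 = glue M (edge K \<eta>) 1"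
    using small_waves[OF half_gt_zero[OF \<delta>(1)]] by blast
  define AI where "AI F K i h = arc_integral F (p i) (p (i + 1)) (p (i + 2)) K h" for F K i h
  have AIc: "continuous_on UNIV F \<Longrightarrow> continuous_on UNIV (AI F K i)" for F K i
    unfolding AI_def[abs_def] by (rule arc.cont_arc_integral)
  have AI0: "AI (\<lambda>_. 1) K i 0 = arc_len (p i) (p (i + 1))" for K i
    unfolding AI_def by (rule arc.arc_integral_flat)
  have AIpos: "0 \<le> AI (\<lambda>_. 1) K i h" for K i h unfolding AI_def by (rule arc.arc_integral_1_nonneg)
  have close: "norm (sgn (wave (p i) (p (i + 1)) (p (i + 2)) K h z) - x i) < \<delta>"
    if i: "i < M" and h: "\<bar>h\<bar> \<le> h0" and z: "z \<in> {0..1}" for i h K z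
  proof -
    have a: "norm (sgn (wave (p i) (p (i + 1)) (p (i + 2)) K h z) - edge 0 (\<lambda>_. 0) i z) < \<delta> / 2"
      using h0(2)[of "\<lambda>_. h" K] h i z by (auto simp: edge_def)
    let ?w = "(1 - z) *\<^sub>R p i + z *\<^sub>R p (i + 1)"
    have sx: "sgn (x i) = x i" using xn[of i] by (simp add: sgn_div_norm)
    have "norm (x i - edge 0 (\<lambda>_. 0) i z) = norm (sgn (x i) - sgn ?w)" by (simp add: sx edge_def wave_def)
    also have "\<dots> \<le> 2 * norm (x i - ?w) / norm (x i)" by (rule norm_sgn_diff_le) (use xn[of i] in auto)
    also have "\<dots> = 2 * norm (x i - ?w)" using xn by simp
    also have "x i - ?w = (1 - z) *\<^sub>R (x i - p i) + z *\<^sub>R (x (i + 1) - p (i + 1)) + z *\<^sub>R (x i - x (i + 1))"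
      by (simp add: algebra_simps)
    also have "norm \<dots> \<le> (1 - z) * (\<delta> / 8) + z * (\<delta> / 8) + 1 * (\<delta> / 8)"
    proof (intro norm_triangle_le add_mono)
      show "norm ((1 - z) *\<^sub>R (x i - p i)) \<le> (1 - z) * (\<delta> / 8)"
        unfolding norm_scaleR using z p(2)[of i] by (intro mult_mono) (auto simp: norm_minus_commute)
      show "norm (z *\<^sub>R (x (i + 1) - p (i + 1))) \<le> z * (\<delta> / 8)"
        unfolding norm_scaleR using z p(2)[of "i + 1"] by (intro mult_mono) (auto simp: norm_minus_commute)
      show "norm (z *\<^sub>R (x i - x (i + 1))) \<le> 1 * (\<delta> / 8)"
        using z mesh[of i] \<epsilon>(3) unfolding norm_scaleR by (intro mult_mono) auto
    qed
    also have "2 * ((1 - z) * (\<delta> / 8) + z * (\<delta> / 8) + 1 * (\<delta> / 8)) = \<delta> / 2" by (simp add: field_simps)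
    finally have b: "norm (x i - edge 0 (\<lambda>_. 0) i z) \<le> \<delta> / 2" by simp
    have "norm (sgn (wave (p i) (p (i + 1)) (p (i + 2)) K h z) - x i) =
      norm ((sgn (wave (p i) (p (i + 1)) (p (i + 2)) K h z) - edge 0 (\<lambda>_. 0) i z) - (x i - edge 0 (\<lambda>_. 0) i z))" by simp
    also have "\<dots> \<le> norm (sgn (wave (p i) (p (i + 1)) (p (i + 2)) K h z) - edge 0 (\<lambda>_. 0) i z) + norm (x i - edge 0 (\<lambda>_. 0) i z)"
      by (rule norm_triangle_ineq4)
    finally show ?thesis using a b by linarith
  qed
  have AInear: "\<bar>AI (g y) K i h - g y (x i) * AI (\<lambda>_. 1) K i h\<bar> \<le> \<omega> * AI (\<lambda>_. 1) K i h"
    if "y \<in> Y" "i < M" "\<bar>h\<bar> \<le> h0" for y K i h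
    unfolding AI_def
  proof (rule arc.arc_integral_near[OF g[OF that(1)]])
    fix z :: real assume z: "z \<in> {0..1}"
    have "sgn (wave (p i) (p (i + 1)) (p (i + 2)) K h z) \<in> sphere 0 1" using arc.wave_nz by (simp add: norm_sgn)
    then show "\<bar>g y (sgn (wave (p i) (p (i + 1)) (p (i + 2)) K h z)) - g y (x i)\<bar> \<le> \<omega>"
      by (rule \<delta>(2)[OF that(1) _ xsph close[OF that(2,3) z]])
  qed
  have lenp: "(\<Sum>i<M. arc_len (p i) (p (i + 1))) \<le> L"
  proof -
    have "(\<Sum>i<M. arc_len (p i) (p (i + 1))) \<le> (\<Sum>i<M. arc_len (x i) (x (i + 1)) + \<kappa>)"
      by (intro sum_mono) (use p(3) in force)
    also have "\<dots> = (\<Sum>i<M. arc_len (x i) (x (i + 1))) + \<kappa>0" using M0 by (simp add: sum.distrib \<kappa>_def)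
    finally show ?thesis using len \<kappa>0 by (simp add: L_def)
  qed
  have nn: "0 \<le> arc_len (p i) (p (i + 1))" for i using AIpos[of 0 i 0] by (simp only: AI0)
  have lenp1: "arc_len (p i) (p (i + 1)) \<le> L" if "i < M" for i
  proof -
    have "arc_len (p i) (p (i + 1)) \<le> (\<Sum>i<M. arc_len (p i) (p (i + 1)))"
      by (rule member_le_sum[where f = "\<lambda>i. arc_len (p i) (p (i + 1))"]) (use that in simp, rule nn, simp)
    then show ?thesis using lenp by linarith
  qed
  define e1 where "e1 K y = (\<Sum>i<M. AI (g y) K i 0) - (\<Sum>i<M. arc_len (x i) (x (i + 1)) * g y (x i))" for K y
  have e1: "\<bar>e1 K y\<bar> \<le> \<omega> * L + B * \<kappa>0" if y: "y \<in> Y" for K y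
  proof -
    have "\<bar>AI (g y) K i 0 - arc_len (x i) (x (i + 1)) * g y (x i)\<bar> \<le> \<omega> * arc_len (p i) (p (i + 1)) + B * \<kappa>" if i: "i < M" for i
    proof -
      have "AI (g y) K i 0 - arc_len (x i) (x (i + 1)) * g y (x i) =
        (AI (g y) K i 0 - g y (x i) * AI (\<lambda>_. 1) K i 0) + g y (x i) * (arc_len (p i) (p (i + 1)) - arc_len (x i) (x (i + 1)))"
        by (simp add: AI0 algebra_simps)
      also have "\<bar>\<dots>\<bar> \<le> \<bar>AI (g y) K i 0 - g y (x i) * AI (\<lambda>_. 1) K i 0\<bar> + \<bar>g y (x i)\<bar> * \<bar>arc_len (p i) (p (i + 1)) - arc_len (x i) (x (i + 1))\<bar>"
        by (simp only: abs_mult[symmetric] abs_triangle_ineq)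
      also have "\<dots> \<le> \<omega> * AI (\<lambda>_. 1) K i 0 + B * \<kappa>"
        using AInear[OF y i, of 0 K] h0(1) p(3)[OF i] B(2)[OF y xsph[of i]] B(1) by (intro add_mono mult_mono) auto
      finally show ?thesis by (simp only: AI0)
    qed
    then have "\<bar>e1 K y\<bar> \<le> (\<Sum>i<M. \<omega> * arc_len (p i) (p (i + 1)) + B * \<kappa>)"
      unfolding e1_def sum_subtractf[symmetric] by (intro order_trans[OF sum_abs] sum_mono) auto
    also have "\<dots> = \<omega> * (\<Sum>i<M. arc_len (p i) (p (i + 1))) + B * \<kappa>0"
      using M0 by (simp add: sum.distrib sum_distrib_left \<kappa>_def)
    also have "\<dots> \<le> \<omega> * L + B * \<kappa>0" using lenp \<omega> by simp
    finally show ?thesis .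
  qed
  \<comment> \<open>The walk may visit a node several times; one visit is selected to carry the
    wave.\<close>
  have "\<forall>k. \<exists>i. k < n \<longrightarrow> i < M \<and> x i = s k" using Sx sS by force
  from choice[OF this] obtain pos where pos: "\<And>k. k < n \<Longrightarrow> pos k < M" "\<And>k. k < n \<Longrightarrow> x (pos k) = s k" by blast
  have pos_inj: "inj_on pos {..<n}"
    using s pos(2) unfolding inj_on_def bij_betw_def by (metis lessThan_iff)
  have "\<forall>k. \<exists>c>0. \<forall>K>0. real K * c \<le> AI (\<lambda>_. 1) K (pos k) h0"
    unfolding AI_def using arc.wave_length_unbounded[of h0] h0(1) by blast
  from choice[OF this] obtain c where c: "\<And>k. 0 < c k" "\<And>k K. 0 < K \<Longrightarrow> real K * c k \<le> AI (\<lambda>_. 1) K (pos k) h0" by blast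
  \<comment> \<open>A common frequency at which a wave of amplitude \<open>h0\<close> gains at least
    twice the mass of its node; the flat edge accounts for the summand \<open>L\<close>.\<close>
  have "\<exists>K>0. \<forall>k<n. 2 * \<rho> (s k) + L \<le> real K * c k"
  proof -
    have "\<exists>K>0. \<forall>k<m. 2 * \<rho> (s k) + L \<le> real K * c k" for m
    proof (induction m)
      case 0
      show ?case by (rule exI[of _ 1]) simp
    next
      case (Suc m)
      then obtain K where K: "K > 0" "\<forall>k<m. 2 * \<rho> (s k) + L \<le> real K * c k" by blast
      obtain K' where K': "2 * \<rho> (s m) + L < real K' * c m" using reals_Archimedean3[OF c(1)] by blast
      have "2 * \<rho> (s k) + L \<le> real (K + K') * c k" if "k < Suc m" for k
      proof (cases "k = m")
        case True
        have "real K' * c m \<le> real (K + K') * c m" using c(1)[of m] by (intro mult_right_mono) auto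
        then show ?thesis using K' unfolding True by linarith
      next
        case False
        have "real K * c k \<le> real (K + K') * c k" using c(1)[of k] by (intro mult_right_mono) auto
        then show ?thesis using K False that by (metis less_antisym order_trans)
      qed
      then show ?case using K(1) by (intro exI[of _ "K + K'"]) auto
    qed
    then show ?thesis .
  qed
  then obtain K where K: "0 < K" "\<And>k. k < n \<Longrightarrow> 2 * \<rho> (s k) + L \<le> real K * c k" by blast
  define ell where "ell k h = AI (\<lambda>_. 1) K (pos k) h - AI (\<lambda>_. 1) K (pos k) 0" for k h
  have ellc: "continuous_on UNIV (ell k)" for k unfolding ell_def[abs_def] by (intro continuous_intros AIc)
  have "\<forall>k. \<exists>b. k < n \<longrightarrow> 0 < b \<and> b \<le> h0 \<and> ell k b = 2 * \<rho> (s k) \<and> (\<forall>h. 0 \<le> h \<and> h \<le> b \<longrightarrow> ell k h \<le> 2 * \<rho> (s k))"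
  proof
    fix k
    show "\<exists>b. k < n \<longrightarrow> 0 < b \<and> b \<le> h0 \<and> ell k b = 2 * \<rho> (s k) \<and> (\<forall>h. 0 \<le> h \<and> h \<le> b \<longrightarrow> ell k h \<le> 2 * \<rho> (s k))"
    proof (cases "k < n")
      case True
      have "ell k 0 < 2 * \<rho> (s k)" using \<rho>(1)[OF sS[OF True]] rmin by (simp add: ell_def)
      moreover have "2 * \<rho> (s k) \<le> ell k h0"
        using K(2)[OF True] c(2)[OF K(1), of k] lenp1[OF pos(1)[OF True]] by (simp add: ell_def AI0)
      ultimately show ?thesis using first_hit[OF ellc h0(1)] by blast
    qed blast
  qed
  from choice[OF this] obtain b where b: "\<And>k. k < n \<Longrightarrow> 0 < b k" "\<And>k. k < n \<Longrightarrow> b k \<le> h0" "\<And>k. k < n \<Longrightarrow> ell k (b k) = 2 * \<rho> (s k)"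
    "\<And>k h. k < n \<Longrightarrow> 0 \<le> h \<Longrightarrow> h \<le> b k \<Longrightarrow> ell k h \<le> 2 * \<rho> (s k)" by blast
  define Tot where "Tot F v = (\<Sum>i<M. AI F K i 0) + (\<Sum>k<n. AI F K (pos k) (v k) - AI F K (pos k) 0)" for F and v :: "nat \<Rightarrow> real"
  \<comment> \<open>For a node of \<open>Y\<close> this is the moment equation with the misfit of
    the nodes outside \<open>Y\<close> taken out; at a common zero that misfit is 0 and the moment
    is exact. Up to an error below \<open>rmin\<close>, every \<open>G k\<close> equals
    \<open>ell k (v k) - \<rho> (s k)\<close>, which is -\<rho> at amplitude 0 and \<rho> at
    amplitude \<open>b k\<close>.\<close>
  define G where "G k v = (if s k \<in> Y then Tot (g (s k)) v - T (s k) - (\<Sum>j\<in>{j. j < n \<and> s j \<notin> Y}. (ell j (v j) - \<rho> (s j)) * g (s k) (s j))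
     else ell k (v k) - \<rho> (s k))" for k and v :: "nat \<Rightarrow> real"
  have coordc: "continuous_on UNIV (\<lambda>v::nat \<Rightarrow> real. \<phi> (v k))" if "continuous_on UNIV \<phi>" for \<phi> :: "real \<Rightarrow> real" and k
    by (rule continuous_on_compose2[OF that]) (auto simp: continuous_on_product_then_coordinatewise)
  have Gc: "continuous_on UNIV (G k)" for k
  proof (cases "s k \<in> Y")
    case True
    show ?thesis unfolding G_def[abs_def] Tot_def using True
      by (auto intro!: continuous_intros coordc AIc g ellc)
  qed (auto simp: G_def[abs_def] intro!: continuous_intros coordc ellc)
  have Gval: "\<bar>G k v - (ell k (v k) - \<rho> (s k))\<bar> < rmin" if k: "k < n" and v: "\<forall>j<n. 0 \<le> v j \<and> v j \<le> b j" for k v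
  proof (cases "s k \<in> Y")
    case False
    then show ?thesis using rmin by (simp add: G_def)
  next
    case True
    define e2 where "e2 j = AI (g (s k)) K (pos j) (v j) - AI (g (s k)) K (pos j) 0 - ell j (v j) * g (s k) (s j)" for j
    have e2: "\<bar>e2 j\<bar> \<le> \<omega> * (2 * \<bar>rmax\<bar> + 2 * L)" if j: "j < n" for j
    proof -
      have vj: "\<bar>v j\<bar> \<le> h0" "0 \<le> v j" "v j \<le> b j" using v b(2)[OF j] j by force+
      have n1: "\<bar>AI (g (s k)) K (pos j) (v j) - g (s k) (s j) * AI (\<lambda>_. 1) K (pos j) (v j)\<bar> \<le> \<omega> * AI (\<lambda>_. 1) K (pos j) (v j)"
        using AInear[OF True pos(1)[OF j] vj(1), of K] by (simp add: pos(2)[OF j])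
      have n2: "\<bar>AI (g (s k)) K (pos j) 0 - g (s k) (s j) * AI (\<lambda>_. 1) K (pos j) 0\<bar> \<le> \<omega> * AI (\<lambda>_. 1) K (pos j) 0"
        using AInear[OF True pos(1)[OF j], of 0 K] h0(1) by (simp add: pos(2)[OF j])
      have "e2 j = (AI (g (s k)) K (pos j) (v j) - g (s k) (s j) * AI (\<lambda>_. 1) K (pos j) (v j)) - (AI (g (s k)) K (pos j) 0 - g (s k) (s j) * AI (\<lambda>_. 1) K (pos j) 0)"
        by (simp add: e2_def ell_def algebra_simps)
      then have "\<bar>e2 j\<bar> \<le> \<omega> * AI (\<lambda>_. 1) K (pos j) (v j) + \<omega> * AI (\<lambda>_. 1) K (pos j) 0" using n1 n2 by linarith
      also have "\<dots> = \<omega> * (ell j (v j) + 2 * AI (\<lambda>_. 1) K (pos j) 0)" by (simp add: ell_def algebra_simps)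
      also have "\<dots> \<le> \<omega> * (2 * \<bar>rmax\<bar> + 2 * L)"
        using b(4)[OF j vj(2,3)] \<rho>(2)[OF sS[OF j]] lenp1[OF pos(1)[OF j]] \<omega> by (intro mult_left_mono) (auto simp: AI0)
      finally show ?thesis .
    qed
    have sumS: "(\<Sum>z\<in>S. \<rho> z * g (s k) z) = (\<Sum>j<n. \<rho> (s j) * g (s k) (s j))"
      by (rule sum.reindex_bij_betw[OF s, symmetric])
    have "Tot (g (s k)) v - T (s k) = e1 K (s k) + (\<Sum>j<n. e2 j) + (\<Sum>j<n. (ell j (v j) - \<rho> (s j)) * g (s k) (s j))"
      unfolding T[OF True, symmetric] sumS Tot_def e1_def e2_def
      by (simp add: sum_subtractf sum.distrib left_diff_distrib)
    also have "(\<Sum>j<n. (ell j (v j) - \<rho> (s j)) * g (s k) (s j)) =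
       (\<Sum>j\<in>{j. j < n \<and> s j \<notin> Y}. (ell j (v j) - \<rho> (s j)) * g (s k) (s j)) + (\<Sum>j\<in>{j. j < n \<and> s j \<in> Y}. (ell j (v j) - \<rho> (s j)) * g (s k) (s j))"
      by (subst sum.union_disjoint[symmetric]) (auto intro!: sum.cong)
    also have "(\<Sum>j\<in>{j. j < n \<and> s j \<in> Y}. (ell j (v j) - \<rho> (s j)) * g (s k) (s j)) = (\<Sum>j\<in>{j. j < n \<and> s j \<in> Y}. if j = k then ell k (v k) - \<rho> (s k) else 0)"
    proof (intro sum.cong refl)
      fix j assume j: "j \<in> {j. j < n \<and> s j \<in> Y}"
      have "s j = s k \<longleftrightarrow> j = k" using s j k unfolding bij_betw_def inj_on_def by auto
      then show "(ell j (v j) - \<rho> (s j)) * g (s k) (s j) = (if j = k then ell k (v k) - \<rho> (s k) else 0)"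
        using lagrange[OF True, of "s j"] j by auto
    qed
    also have "\<dots> = ell k (v k) - \<rho> (s k)" using k True by simp
    finally have "G k v - (ell k (v k) - \<rho> (s k)) = e1 K (s k) + (\<Sum>j<n. e2 j)" using True by (simp add: G_def)
    also have "\<bar>\<dots>\<bar> \<le> (\<omega> * L + B * \<kappa>0) + (\<Sum>j<n. \<omega> * (2 * \<bar>rmax\<bar> + 2 * L))"
      using e2 by (intro order_trans[OF abs_triangle_ineq] add_mono e1[OF True] order_trans[OF sum_abs] sum_mono) auto
    also have "\<dots> = \<omega> * W + B * \<kappa>0" by (simp add: W_def algebra_simps)
    also have "\<dots> < rmin" by (rule small)
    finally show ?thesis .
  qed
  have "\<exists>v. (\<forall>k<n. 0 \<le> v k \<and> v k \<le> b k) \<and> (\<forall>k<n. G k v = 0)"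
  proof (rule poincare_miranda)
    fix k and v :: "nat \<Rightarrow> real" assume k: "k < n" and v: "\<forall>j<n. 0 \<le> v j \<and> v j \<le> b j"
    { assume "v k = 0"
      then have "ell k (v k) = 0" by (simp add: ell_def)
      then show "G k v < 0" using Gval[OF k v] \<rho>(1)[OF sS[OF k]] by linarith }
    { assume "v k = b k"
      then have "ell k (v k) = 2 * \<rho> (s k)" using b(3)[OF k] by simp
      then show "0 < G k v" using Gval[OF k v] \<rho>(1)[OF sS[OF k]] by linarith }
  qed (use b(1) Gc in auto)
  then obtain v where v: "\<forall>k<n. 0 \<le> v k \<and> v k \<le> b k" "\<And>k. k < n \<Longrightarrow> G k v = 0" by blast
  define \<eta> where "\<eta> i = (if i \<in> pos ` {..<n} then v (inv_into {..<n} pos i) else 0)" for i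
  have \<eta>pos: "\<eta> (pos k) = v k" if "k < n" for k
    using that pos_inj by (simp add: \<eta>_def inv_into_f_f)
  have \<eta>small: "\<bar>\<eta> i\<bar> \<le> h0" for i
  proof (cases "i \<in> pos ` {..<n}")
    case True
    then obtain k where k: "k < n" "i = pos k" by auto
    then show ?thesis using \<eta>pos[OF k(1)] v(1) b(2)[OF k(1)] by force
  qed (use h0 in \<open>simp add: \<eta>_def\<close>)
  define \<gamma> where "\<gamma> = glue M (edge K \<eta>)"
  have TotF: "(\<Sum>i<M. AI F K i (\<eta> i)) = Tot F v" for F
  proof -
    have "(\<Sum>i<M. AI F K i (\<eta> i)) = (\<Sum>i<M. AI F K i 0) + (\<Sum>i<M. AI F K i (\<eta> i) - AI F K i 0)"
      by (simp add: sum_subtractf)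
    also have "(\<Sum>i<M. AI F K i (\<eta> i) - AI F K i 0) = (\<Sum>i\<in>pos ` {..<n}. AI F K i (\<eta> i) - AI F K i 0)"
      by (rule sum.mono_neutral_right) (use pos(1) in \<open>auto simp: \<eta>_def\<close>)
    also have "\<dots> = (\<Sum>k<n. AI F K (pos k) (v k) - AI F K (pos k) 0)"
      by (subst sum.reindex[OF pos_inj]) (simp add: \<eta>pos)
    finally show ?thesis by (simp add: Tot_def)
  qed
  have int: "((\<lambda>s. F (\<gamma> s) * speed \<gamma> s) has_integral Tot F v) {0..1}" if "continuous_on UNIV F" for F
    using glue_edge_integral[OF that, of K \<eta>] TotF[of F] unfolding \<gamma>_def AI_def by simp
  have sol: "Tot (g y) v = T y" if y: "y \<in> Y" for y
  proof -
    obtain k where k: "k < n" "y = s k" using y S(3) s by (force simp: bij_betw_def)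
    have "ell j (v j) - \<rho> (s j) = 0" if "j < n" "s j \<notin> Y" for j using v(2)[OF that(1)] that by (simp add: G_def)
    then have "(\<Sum>j\<in>{j. j < n \<and> s j \<notin> Y}. (ell j (v j) - \<rho> (s j)) * g (s k) (s j)) = 0" by simp
    then show ?thesis using v(2)[OF k(1)] y k(2) by (simp add: G_def)
  qed
  have sol': "integral {0..1} (\<lambda>s. g y (\<gamma> s) * speed \<gamma> s) = T y" if "y \<in> Y" for y
    using integral_unique[OF int[OF g[OF that]]] sol[OF that] by simp
  show ?thesis
  proof (intro exI[of _ \<gamma>] conjI allI impI ballI)
    show "simple_path \<gamma>" "\<gamma> 0 = \<gamma> 1" using h0(2)[of \<eta> K] \<eta>small by (auto simp: \<gamma>_def)
    show "path_image \<gamma> \<subseteq> sphere 0 1" unfolding \<gamma>_def by (rule glue_in_sphere)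
    show "piecewise_smooth \<gamma>" unfolding \<gamma>_def by (rule glue_edge_smooth)
  qed (use int sol' in \<open>auto intro: has_integral_integrable\<close>)
qed

section \<open>A quadrature rule on $[0, 1]$\<close>

text \<open>Up to pi/3 the derivative of sin is at least 1/2; from there on sin is at least sqrt 3 /
  2 \<ge> 0.8 > pi/4.\<close>

lemma half_le_sin:
  assumes "0 \<le> x" "x \<le> pi / 2"
  shows "x / 2 \<le> sin x"
proof (cases "x \<le> pi / 3")
  case True
  have "(\<lambda>y. sin y - y / 2) 0 \<le> (\<lambda>y. sin y - y / 2) x"
  proof (rule DERIV_nonneg_imp_nondecreasing[where f = "\<lambda>y. sin y - y / 2"])
    fix y assume y: "0 \<le> y" "y \<le> x"
    have "cos (pi / 3) \<le> cos y" by (rule cos_monotone_0_pi_le) (use y True pi_gt_zero in auto)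
    then have "0 \<le> cos y - 1 / 2" by (simp add: cos_60)
    moreover have "((\<lambda>y. sin y - y / 2) has_real_derivative cos y - 1 / 2) (at y)"
      by (auto intro!: derivative_eq_intros)
    ultimately show "\<exists>z. ((\<lambda>y. sin y - y / 2) has_real_derivative z) (at y) \<and> 0 \<le> z" by blast
  qed (use assms in auto)
  then show ?thesis by simp
next
  case False
  have "sin (pi / 3) \<le> sin x"
    by (rule sin_monotone_2pi_le) (use False assms pi_gt_zero in auto)
  moreover have "(1.6::real) \<le> sqrt 3" by (rule real_le_rsqrt) (simp add: power2_eq_square)
  moreover have "pi < 3.2" using pi_approx by simp
  ultimately show ?thesis using assms by (simp add: sin_60)
qed

section \<open>Discrete orthogonality of sines\<close>

lemma sin_of_int_pi: "sin (of_int m * pi) = 0"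
  using sin_zero_iff_int2 by blast

lemma cos_of_int_pi: "cos (of_int m * pi) = (-1) powi m"
proof (cases "m \<ge> 0")
  case True
  then obtain n where "m = int n" using nonneg_int_cases by blast
  then show ?thesis using cos_npi2[of n] by (simp add: mult.commute)
next
  case False
  then obtain n where "m = - int n" by (metis int_cases linear nonneg_int_cases of_nat_0_le_iff)
  then show ?thesis using cos_npi2[of n] by (simp add: mult.commute power_int_minus power_inverse[symmetric])
qed

text \<open>Multiplication by 2 sin(x/2) telescopes the sum. The range of \<open>m\<close> excludes
  the multiples of 2M, where this factor is 0.\<close>

lemma sum_cos_nodes:
  fixes m :: int
  assumes M: "0 < M" and m: "m \<noteq> 0" "\<bar>m\<bar> < 2 * int M"
  shows "(\<Sum>k<M. cos (of_int m * (real k * pi / real M))) = (1 - (-1) powi m) / 2"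
proof -
  define x where "x = of_int m * pi / real M"
  have tel: "2 * sin (x / 2) * (\<Sum>k<n. cos (real k * x)) = sin ((real n - 1 / 2) * x) + sin (x / 2)" for n
  proof (induction n)
    case 0
    then show ?case by simp
  next
    case (Suc n)
    have "2 * sin (x / 2) * cos (real n * x) = sin ((real n + 1 / 2) * x) - sin ((real n - 1 / 2) * x)"
      by (simp add: algebra_simps sin_add sin_diff)
    with Suc show ?case by (simp add: algebra_simps)
  qed
  have "sin (x / 2) \<noteq> 0"
  proof
    assume "sin (x / 2) = 0"
    then obtain i :: int where "x / 2 = of_int i * pi" using sin_zero_iff_int2 by blast
    then have "of_int m = of_int i * 2 * real M"
      using M by (simp add: x_def field_simps)
    then have "m = i * 2 * int M" by (metis of_int_eq_iff of_int_mult of_int_numeral of_int_of_nat_eq)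
    then have "\<bar>m\<bar> = \<bar>i\<bar> * (2 * int M)" by (simp add: abs_mult)
    moreover have "i \<noteq> 0" using \<open>m = _\<close> m by auto
    ultimately have "2 * int M \<le> \<bar>m\<bar>" using mult_right_mono[of 1 "\<bar>i\<bar>" "2 * int M"] by linarith
    then show False using m by linarith
  qed
  have "sin ((real M - 1 / 2) * x) = sin (of_int m * pi - x / 2)"
    using M by (simp add: x_def field_simps)
  also have "\<dots> = - ((-1) powi m) * sin (x / 2)"
    by (simp add: sin_diff sin_of_int_pi cos_of_int_pi)
  finally have "2 * sin (x / 2) * (\<Sum>k<M. cos (real k * x)) = sin (x / 2) * (1 - (-1) powi m)"
    unfolding tel by (simp only: right_diff_distrib) (simp add: mult.commute)
  then have "sin (x / 2) * (2 * (\<Sum>k<M. cos (real k * x))) = sin (x / 2) * (1 - (-1) powi m)"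
    by (simp only: mult_ac)
  then have "(\<Sum>k<M. cos (real k * x)) = (1 - (-1) powi m) / 2"
    unfolding mult_cancel_left using \<open>sin (x / 2) \<noteq> 0\<close> by simp
  then show ?thesis by (simp add: x_def mult_ac)
qed

text \<open>A product of sines is half the difference of cosines of frequencies a - b and a + b.
  These have the same parity, so by \<open>sum_cos_nodes\<close> the two sums cancel for a \<noteq>
  b.\<close>

lemma discrete_sine_orthogonality:
  assumes ab: "a < M" "b < M" "0 < a"
  shows "(\<Sum>k<M. sin (real a * (real k * pi / real M)) * sin (real b * (real k * pi / real M)))
     = (if a = b then real M / 2 else 0)"
proof -
  define \<theta> where "\<theta> k = real k * pi / real M" for k
  have M: "0 < M" using ab by simp
  have "(\<Sum>k<M. sin (real a * \<theta> k) * sin (real b * \<theta> k))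
      = ((\<Sum>k<M. cos (of_int (int a - int b) * \<theta> k)) - (\<Sum>k<M. cos (of_int (int a + int b) * \<theta> k))) / 2"
    unfolding sum_subtractf[symmetric] sum_divide_distrib
    by (intro sum.cong refl) (simp add: left_diff_distrib distrib_right cos_diff cos_add)
  also have "(\<Sum>k<M. cos (of_int (int a + int b) * \<theta> k)) = (1 - (-1) powi (int a + int b)) / 2"
    unfolding \<theta>_def by (rule sum_cos_nodes) (use ab in auto)
  also have "(\<Sum>k<M. cos (of_int (int a - int b) * \<theta> k)) =
      (if a = b then real M else (1 - (-1) powi (int a + int b)) / 2)"
  proof (cases "a = b")
    case False
    have "(\<Sum>k<M. cos (of_int (int a - int b) * \<theta> k)) = (1 - (-1) powi (int a - int b)) / 2"
      unfolding \<theta>_def by (rule sum_cos_nodes) (use ab False in auto)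
    also have "((-1::real) powi (int a - int b)) = (-1) powi (int a + int b)"
      by (simp add: power_int_minus_left)
    finally show ?thesis using False by simp
  qed simp
  also have "((if a = b then real M else (1 - (-1) powi (int a + int b)) / 2) - (1 - (-1) powi (int a + int b)) / 2) / 2
     = (if a = b then real M / 2 else 0)"
    by (auto simp: power_int_minus_left)
  finally show ?thesis by (simp add: \<theta>_def)
qed

text \<open>
  The number \<open>v\<close> is the value of \<open>g \<theta> / sin \<theta>\<close> at \<open>\<theta> = 0\<close>.
\<close>

definition sine_poly :: "nat \<Rightarrow> (real \<Rightarrow> real) \<Rightarrow> real \<Rightarrow> bool" where
  "sine_poly n g v \<longleftrightarrow> (\<exists>d. (\<forall>\<theta>. g \<theta> = (\<Sum>j\<le>n. d j * sin (real j * \<theta>))) \<and> (\<Sum>j\<le>n. real j * d j) = v)"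

lemma sine_poly_sin: "j \<le> n \<Longrightarrow> sine_poly n (\<lambda>\<theta>. sin (real j * \<theta>)) (real j)"
  unfolding sine_poly_def
  by (rule exI[of _ "\<lambda>i. if i = j then 1 else 0"]) (auto simp: if_distrib[of "\<lambda>x. x * _"] if_distrib[of "\<lambda>x. _ * x"] cong: if_cong)

lemma sine_poly_add: "sine_poly n g v \<Longrightarrow> sine_poly n h w \<Longrightarrow> sine_poly n (\<lambda>\<theta>. g \<theta> + h \<theta>) (v + w)"
  unfolding sine_poly_def
  by (elim exE, rename_tac d e, rule_tac x="\<lambda>j. d j + e j" in exI) (auto simp: distrib_right distrib_left sum.distrib)

lemma sine_poly_scale: "sine_poly n g v \<Longrightarrow> sine_poly n (\<lambda>\<theta>. c * g \<theta>) (c * v)"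
  unfolding sine_poly_def
  by (elim exE, rename_tac d, rule_tac x="\<lambda>j. c * d j" in exI) (auto simp: sum_distrib_left mult_ac)

lemma sine_poly_sum:
  assumes "finite I" "\<And>i. i \<in> I \<Longrightarrow> sine_poly n (g i) (v i)"
  shows "sine_poly n (\<lambda>\<theta>. \<Sum>i\<in>I. g i \<theta>) (\<Sum>i\<in>I. v i)"
  using assms
proof (induction I rule: finite_induct)
  case empty
  show ?case unfolding sine_poly_def by (rule exI[of _ "\<lambda>_. 0"]) simp
next
  case (insert i I)
  then show ?case by (auto intro!: sine_poly_add)
qed

lemma sine_poly_mono:
  assumes "sine_poly n g v" "n \<le> m" shows "sine_poly m g v"
proof -
  obtain d where d: "\<And>\<theta>. g \<theta> = (\<Sum>j\<le>n. d j * sin (real j * \<theta>))" "(\<Sum>j\<le>n. real j * d j) = v"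
    using assms by (auto simp: sine_poly_def)
  have "sine_poly m (\<lambda>\<theta>. \<Sum>j\<le>n. d j * sin (real j * \<theta>)) (\<Sum>j\<le>n. d j * real j)"
    by (intro sine_poly_sum sine_poly_scale sine_poly_sin) (use assms in auto)
  moreover have "g = (\<lambda>\<theta>. \<Sum>j\<le>n. d j * sin (real j * \<theta>))" using d by auto
  ultimately show ?thesis using d(2) by (simp add: mult_ac)
qed

lemma sine_poly_cos:
  assumes "sine_poly n g v" shows "sine_poly (Suc n) (\<lambda>\<theta>. cos \<theta> * g \<theta>) v"
proof -
  obtain d where d: "\<And>\<theta>. g \<theta> = (\<Sum>j\<le>n. d j * sin (real j * \<theta>))" "(\<Sum>j\<le>n. real j * d j) = v"
    using assms by (auto simp: sine_poly_def)
  have one: "sine_poly (Suc n) (\<lambda>\<theta>. cos \<theta> * sin (real j * \<theta>)) (real j)" if "j \<le> n" for j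
  proof (cases "j = 0")
    case True
    then show ?thesis using sine_poly_sin[of 0 "Suc n"] by simp
  next
    case False
    have "sine_poly (Suc n) (\<lambda>\<theta>. (1/2) * (sin (real (Suc j) * \<theta>) + sin (real (j - 1) * \<theta>)))
       ((1/2) * (real (Suc j) + real (j - 1)))"
      by (intro sine_poly_scale sine_poly_add sine_poly_sin) (use that in auto)
    moreover have "(1/2) * (sin (real (Suc j) * \<theta>) + sin (real (j - 1) * \<theta>)) = cos \<theta> * sin (real j * \<theta>)" for \<theta>
      using False by (simp add: of_nat_diff algebra_simps sin_add sin_diff)
    moreover have "(1/2) * (real (Suc j) + real (j - 1)) = real j"
      using False by (simp add: of_nat_diff)
    ultimately show ?thesis by simp
  qed
  have "sine_poly (Suc n) (\<lambda>\<theta>. \<Sum>j\<le>n. d j * (cos \<theta> * sin (real j * \<theta>))) (\<Sum>j\<le>n. d j * real j)"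
    by (intro sine_poly_sum sine_poly_scale one) auto
  then show ?thesis using d by (simp add: sum_distrib_left mult_ac)
qed

text \<open>Each factor (1 + cos)/2 or (1 - cos)/2 raises the degree by one, and multiplies the
  value at \<theta> = 0 by 1 or 0. In u = (1 - cos \<theta>)/2 the function is sin \<theta> times (1
  - u)^a u^c.\<close>

lemma sine_poly_moment:
  "sine_poly (Suc (a + c)) (\<lambda>\<theta>. sin \<theta> * ((1 + cos \<theta>) / 2) ^ a * ((1 - cos \<theta>) / 2) ^ c) (if c = 0 then 1 else 0)"
proof -
  have plus: "sine_poly (Suc n) (\<lambda>\<theta>. (1 + cos \<theta>) / 2 * g \<theta>) v" if "sine_poly n g v" for n g v
  proof -
    have "sine_poly (Suc n) (\<lambda>\<theta>. (1/2) * (g \<theta> + cos \<theta> * g \<theta>)) ((1/2) * (v + v))"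
      by (intro sine_poly_scale sine_poly_add sine_poly_cos that sine_poly_mono[OF that]) simp
    moreover have "(\<lambda>\<theta>. (1/2) * (g \<theta> + cos \<theta> * g \<theta>)) = (\<lambda>\<theta>. (1 + cos \<theta>) / 2 * g \<theta>)"
      by (simp add: fun_eq_iff field_simps)
    ultimately show ?thesis by simp
  qed
  have minus: "sine_poly (Suc n) (\<lambda>\<theta>. (1 - cos \<theta>) / 2 * g \<theta>) 0" if "sine_poly n g v" for n g v
  proof -
    have "sine_poly (Suc n) (\<lambda>\<theta>. (1/2) * (g \<theta> + (-1) * (cos \<theta> * g \<theta>))) ((1/2) * (v + (-1) * v))"
      by (intro sine_poly_scale sine_poly_add sine_poly_cos that sine_poly_mono[OF that]) simp
    moreover have "(\<lambda>\<theta>. (1/2) * (g \<theta> + (-1) * (cos \<theta> * g \<theta>))) = (\<lambda>\<theta>. (1 - cos \<theta>) / 2 * g \<theta>)"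
      by (simp add: fun_eq_iff field_simps)
    ultimately show ?thesis by simp
  qed
  have a: "sine_poly (Suc a) (\<lambda>\<theta>. sin \<theta> * ((1 + cos \<theta>) / 2) ^ a) 1"
  proof (induction a)
    case 0
    then show ?case using sine_poly_sin[of 1 1] by simp
  next
    case (Suc a)
    from plus[OF Suc] show ?case by (simp add: mult_ac)
  qed
  show ?thesis
  proof (induction c)
    case 0
    then show ?case using a by simp
  next
    case (Suc c)
    from minus[OF Suc] show ?case by (simp add: mult_ac)
  qed
qed

text \<open>The Beta integral of (1 - u)^a u^c, with sin \<theta> d\<theta> = 2 du; the induction on
  \<open>a\<close> is integration by parts.\<close>

lemma moment_integral:
  "((\<lambda>\<theta>. sin \<theta> * ((1 + cos \<theta>) / 2) ^ a * ((1 - cos \<theta>) / 2) ^ c) has_integral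
      2 * (fact a * fact c / fact (a + c + 1))) {0..pi}"
proof (induction a arbitrary: c)
  case 0
  have "((\<lambda>\<theta>. sin \<theta> * ((1 - cos \<theta>) / 2) ^ c) has_integral
      2 / real (Suc c) * ((1 - cos pi) / 2) ^ Suc c - 2 / real (Suc c) * ((1 - cos 0) / 2) ^ Suc c) {0..pi}"
    by (rule fundamental_theorem_of_calculus)
       (auto intro!: derivative_eq_intros simp: has_real_derivative_iff_has_vector_derivative[symmetric] simp del: power_Suc of_nat_Suc)
  moreover have "2 / real (Suc c) * ((1 - cos pi) / 2) ^ Suc c - 2 / real (Suc c) * ((1 - cos 0) / 2) ^ Suc c
      = 2 * (fact 0 * fact c / fact (0 + c + 1))"
    by (simp add: fact_Suc del: of_nat_Suc)
  ultimately show ?case by simp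
next
  case (Suc a)
  let ?u = "\<lambda>\<theta>::real. (1 - cos \<theta>) / 2" and ?w = "\<lambda>\<theta>::real. (1 + cos \<theta>) / 2"
  have der: "((\<lambda>\<theta>. ?u \<theta> ^ Suc c * ?w \<theta> ^ Suc a) has_real_derivative
      real (Suc c) / 2 * (sin \<theta> * ?w \<theta> ^ Suc a * ?u \<theta> ^ c) - real (Suc a) / 2 * (sin \<theta> * ?w \<theta> ^ a * ?u \<theta> ^ Suc c)) (at \<theta> within {0..pi})" for \<theta>
  proof -
    have "((\<lambda>\<theta>. ?u \<theta> ^ Suc c) has_real_derivative real (Suc c) * ?u \<theta> ^ c * (sin \<theta> / 2)) (at \<theta> within {0..pi})"
      by (auto intro!: derivative_eq_intros simp del: power_Suc of_nat_Suc)
    moreover have "((\<lambda>\<theta>. ?w \<theta> ^ Suc a) has_real_derivative real (Suc a) * ?w \<theta> ^ a * (- sin \<theta> / 2)) (at \<theta> within {0..pi})"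
      by (auto intro!: derivative_eq_intros simp del: power_Suc of_nat_Suc)
    ultimately have "((\<lambda>\<theta>. ?u \<theta> ^ Suc c * ?w \<theta> ^ Suc a) has_real_derivative
       (real (Suc c) * ?u \<theta> ^ c * (sin \<theta> / 2)) * ?w \<theta> ^ Suc a + (real (Suc a) * ?w \<theta> ^ a * (- sin \<theta> / 2)) * ?u \<theta> ^ Suc c) (at \<theta> within {0..pi})"
      by (rule DERIV_mult)
    then show ?thesis by (simp add: algebra_simps del: power_Suc of_nat_Suc)
  qed
  have "((\<lambda>\<theta>. real (Suc c) / 2 * (sin \<theta> * ?w \<theta> ^ Suc a * ?u \<theta> ^ c) - real (Suc a) / 2 * (sin \<theta> * ?w \<theta> ^ a * ?u \<theta> ^ Suc c))
     has_integral (?u pi ^ Suc c * ?w pi ^ Suc a - ?u 0 ^ Suc c * ?w 0 ^ Suc a)) {0..pi}"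
    by (rule fundamental_theorem_of_calculus) (use der in \<open>auto simp: has_real_derivative_iff_has_vector_derivative[symmetric]\<close>)
  then have D: "((\<lambda>\<theta>. real (Suc c) / 2 * (sin \<theta> * ?w \<theta> ^ Suc a * ?u \<theta> ^ c) - real (Suc a) / 2 * (sin \<theta> * ?w \<theta> ^ a * ?u \<theta> ^ Suc c))
     has_integral 0) {0..pi}" by simp
  from has_integral_add[OF D has_integral_mult_right[OF Suc[of "Suc c"], of "real (Suc a) / 2"]]
  have "((\<lambda>\<theta>. real (Suc c) / 2 * (sin \<theta> * ?w \<theta> ^ Suc a * ?u \<theta> ^ c)) has_integral
      real (Suc a) / 2 * (2 * (fact a * fact (Suc c) / fact (a + Suc c + 1)))) {0..pi}"
    by (simp del: power_Suc of_nat_Suc fact_Suc)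
  from has_integral_mult_right[OF this, of "2 / real (Suc c)"]
  have "((\<lambda>\<theta>. sin \<theta> * ?w \<theta> ^ Suc a * ?u \<theta> ^ c) has_integral
      2 / real (Suc c) * (real (Suc a) / 2 * (2 * (fact a * fact (Suc c) / fact (a + Suc c + 1))))) {0..pi}"
    by (simp only: mult.assoc mult.left_commute[of "2 / real (Suc c)"]) (simp del: power_Suc of_nat_Suc fact_Suc add: mult_ac)
  moreover have "2 / real (Suc c) * (real (Suc a) / 2 * (2 * (fact a * fact (Suc c) / fact (a + Suc c + 1))))
     = 2 * (fact (Suc a) * fact c / fact (Suc a + c + 1) :: real)"
    by (simp add: fact_Suc field_simps del: of_nat_Suc)
  ultimately show ?case by (simp only:)
qed

text \<open>
  The functional \<open>f \<mapsto> A \<integral> f(u) du - B f(0)\<close> on polynomials in \<open>u = (1 - cos \<theta>)/2\<close>, evaluated at \<open>sin(i\<theta>)/sin \<theta>\<close>.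
  By discrete orthogonality of sines these values determine the weights of a quadrature rule at the nodes \<open>k\<pi>/(2J)\<close>.
\<close>

definition quad_coeff :: "real \<Rightarrow> real \<Rightarrow> nat \<Rightarrow> real" where
  "quad_coeff A B i = A * ((1 - (-1) ^ i) / (2 * real i)) - B * real i"

definition quad_weight :: "real \<Rightarrow> real \<Rightarrow> nat \<Rightarrow> nat \<Rightarrow> real" where
  "quad_weight A B J k = 1 / real J * sin (real k * pi / real (2 * J)) *
     (\<Sum>i<2 * J. quad_coeff A B i * sin (real i * (real k * pi / real (2 * J))))"

text \<open>The sine in \<open>quad_weight\<close> turns the monomial into a sine polynomial of
  degree a + c + 1 < 2J. Orthogonality on the nodes then replaces sin(j\<theta>) by
  \<open>quad_coeff A B j\<close>, so the sum is the functional applied to the monomial: an integral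
  and a value at 0.\<close>

lemma quadrature_rule:
  assumes J: "a + c + 1 < 2 * J"
  shows "(\<Sum>k<2 * J. quad_weight A B J k *
            (((1 + cos (real k * pi / real (2 * J))) / 2) ^ a * ((1 - cos (real k * pi / real (2 * J))) / 2) ^ c))
     = A * (fact a * fact c / fact (a + c + 1)) - B * (if c = 0 then 1 else 0)"
proof -
  define \<theta> where "\<theta> k = real k * pi / real (2 * J)" for k
  define g :: "real \<Rightarrow> real" where "g = (\<lambda>\<theta>. sin \<theta> * ((1 + cos \<theta>) / 2) ^ a * ((1 - cos \<theta>) / 2) ^ c)"
  obtain d where d: "\<And>x. g x = (\<Sum>j\<le>Suc (a + c). d j * sin (real j * x))"
     "(\<Sum>j\<le>Suc (a + c). real j * d j) = (if c = 0 then 1 else 0)"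
    using sine_poly_moment[of a c] unfolding sine_poly_def g_def by blast
  have J0: "0 < J" using J by linarith
  have orth: "(\<Sum>k<2 * J. (\<Sum>i<2 * J. e i * sin (real i * \<theta> k)) * sin (real j * \<theta> k)) = real J * e j"
    if j: "j < 2 * J" "0 < j" for j and e :: "nat \<Rightarrow> real"
  proof -
    have "(\<Sum>k<2 * J. (\<Sum>i<2 * J. e i * sin (real i * \<theta> k)) * sin (real j * \<theta> k))
       = (\<Sum>i<2 * J. e i * (\<Sum>k<2 * J. sin (real j * \<theta> k) * sin (real i * \<theta> k)))"
      unfolding sum_distrib_right sum_distrib_left by (subst sum.swap) (simp add: mult_ac)
    also have "\<dots> = (\<Sum>i<2 * J. e i * (if j = i then real (2 * J) / 2 else 0))"
      unfolding \<theta>_def by (intro sum.cong refl arg_cong2[where f = "(*)"] discrete_sine_orthogonality) (use j in auto)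
    also have "\<dots> = (\<Sum>i<2 * J. if j = i then e i * real J else 0)" by (intro sum.cong) auto
    also have "\<dots> = real J * e j" using j by simp
    finally show ?thesis .
  qed
  have "(\<Sum>k<2 * J. quad_weight A B J k * (((1 + cos (\<theta> k)) / 2) ^ a * ((1 - cos (\<theta> k)) / 2) ^ c))
    = (\<Sum>k<2 * J. 1 / real J * (\<Sum>i<2 * J. quad_coeff A B i * sin (real i * \<theta> k)) * g (\<theta> k))"
    unfolding quad_weight_def g_def \<theta>_def by (simp only: mult_ac)
  also have "\<dots> = (\<Sum>j\<le>Suc (a + c). d j * (1 / real J * (\<Sum>k<2 * J. (\<Sum>i<2 * J. quad_coeff A B i * sin (real i * \<theta> k)) * sin (real j * \<theta> k))))"
  proof -
    define T where "T k = (\<Sum>i<2 * J. quad_coeff A B i * sin (real i * \<theta> k))" for k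
    have "(\<Sum>k<2 * J. 1 / real J * T k * g (\<theta> k)) =
        (\<Sum>k<2 * J. \<Sum>j\<le>Suc (a + c). d j * (1 / real J * (T k * sin (real j * \<theta> k))))"
      unfolding d(1) sum_distrib_left[of "1 / real J * T _"] by (simp only: mult_ac)
    also have "\<dots> = (\<Sum>j\<le>Suc (a + c). \<Sum>k<2 * J. d j * (1 / real J * (T k * sin (real j * \<theta> k))))"
      by (rule sum.swap)
    finally show ?thesis unfolding T_def by (simp only: sum_distrib_left)
  qed
  also have "\<dots> = (\<Sum>j\<le>Suc (a + c). d j * quad_coeff A B j)"
  proof (intro sum.cong refl)
    fix j assume j: "j \<in> {..Suc (a + c)}"
    show "d j * (1 / real J * (\<Sum>k<2 * J. (\<Sum>i<2 * J. quad_coeff A B i * sin (real i * \<theta> k)) * sin (real j * \<theta> k))) = d j * quad_coeff A B j"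
    \<comment> \<open>For j = 0 both sides vanish; \<open>quad_coeff A B 0\<close> is 0, a quotient
      by 0 being 0.\<close>
    proof (cases "j = 0")
      case True
      then show ?thesis by (simp add: quad_coeff_def)
    next
      case False
      then show ?thesis using orth[of j "quad_coeff A B"] j J J0 by simp
    qed
  qed
  also have "\<dots> = A / 2 * (\<Sum>j\<le>Suc (a + c). d j * ((1 - (-1) ^ j) / real j)) - B * (\<Sum>j\<le>Suc (a + c). real j * d j)"
    unfolding quad_coeff_def sum_distrib_left sum_subtractf[symmetric]
    by (intro sum.cong refl) (simp add: algebra_simps diff_divide_distrib)
  also have "(\<Sum>j\<le>Suc (a + c). d j * ((1 - (-1) ^ j) / real j)) = 2 * (fact a * fact c / fact (a + c + 1))"
  proof (rule has_integral_unique)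
    show "(g has_integral 2 * (fact a * fact c / fact (a + c + 1))) {0..pi}"
      unfolding g_def by (rule moment_integral)
    have s: "((\<lambda>x. sin (real j * x)) has_integral (1 - (-1) ^ j) / real j) {0..pi}" for j
    proof (cases "j = 0")
      case False
      have "((\<lambda>x. sin (real j * x)) has_integral (- cos (real j * pi) / real j) - (- cos (real j * 0) / real j)) {0..pi}"
        by (rule fundamental_theorem_of_calculus)
           (use False in \<open>auto intro!: derivative_eq_intros simp: has_real_derivative_iff_has_vector_derivative[symmetric]\<close>)
      then show ?thesis by (simp add: diff_divide_distrib)
    qed simp
    have "g = (\<lambda>x. \<Sum>j\<le>Suc (a + c). d j * sin (real j * x))" using d(1) by auto
    then show "(g has_integral (\<Sum>j\<le>Suc (a + c). d j * ((1 - (-1) ^ j) / real j))) {0..pi}"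
      by (simp only:) (intro has_integral_sum has_integral_mult_right s finite_atMost)
  qed
  finally show ?thesis unfolding d(2) \<theta>_def by simp
qed

section \<open>Lower bounds for the quadrature weights\<close>

text \<open>Partial Fourier sum of the square wave with value pi/4 on (0, pi). The part of a
  quadrature weight proportional to \<open>A\<close> is, up to its positive prefactor, this sum at
  the node.\<close>

definition square_wave :: "nat \<Rightarrow> real \<Rightarrow> real" where
  "square_wave J x = (\<Sum>j<J. sin (real (2 * j + 1) * x) / real (2 * j + 1))"

text \<open>These are partial sums of the Leibniz series 1 - 1/3 + 1/5 - ...: the even ones increase
  from 2/3, and each odd one exceeds the even one before it.\<close>

lemma square_wave_half_pi:
  assumes "2 \<le> J"
  shows "2 / 3 \<le> square_wave J (pi / 2)"
proof -
  have val: "square_wave J (pi / 2) = (\<Sum>j<J. (-1) ^ j / real (2 * j + 1))" for J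
    unfolding square_wave_def
  proof (intro sum.cong refl)
    fix j
    have "sin (real (2 * j + 1) * (pi / 2)) = (-1) ^ j" using sin_cos_npi[of j] by simp
    then show "sin (real (2 * j + 1) * (pi / 2)) / real (2 * j + 1) = (-1) ^ j / real (2 * j + 1)" by simp
  qed
  have ev: "2 / 3 \<le> (\<Sum>j<2 * Suc m. (-1) ^ j / real (2 * j + 1))" for m
  proof (induction m)
    case (Suc m)
    have "(\<Sum>j<2 * Suc (Suc m). (-1) ^ j / real (2 * j + 1)) =
       (\<Sum>j<2 * Suc m. (-1) ^ j / real (2 * j + 1)) + (1 / real (4 * m + 5) - 1 / real (4 * m + 7))"
      by (simp add: add.commute)
    moreover have "1 / real (4 * m + 7) \<le> 1 / real (4 * m + 5)" by (intro divide_left_mono) auto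
    ultimately show ?case using Suc by linarith
  qed (simp add: numeral_2_eq_2)
  show ?thesis
  proof (cases "even J")
    case True
    then obtain m where "J = 2 * m" by blast
    then obtain m' where "J = 2 * Suc m'" using assms by (cases m) auto
    then show ?thesis using ev[of m'] val by simp
  next
    case False
    then obtain m where m: "J = 2 * m + 1" using oddE by blast
    then obtain m' where m': "J = Suc (2 * Suc m')" using assms by (cases m) auto
    have "square_wave J (pi / 2) = (\<Sum>j<2 * Suc m'. (-1) ^ j / real (2 * j + 1)) + 1 / real (2 * (2 * Suc m') + 1)"
      unfolding val m' sum.lessThan_Suc by simp
    moreover have "0 \<le> 1 / real (2 * (2 * Suc m') + 1)" by simp
    ultimately show ?thesis using ev[of m'] by linarith
  qed
qed

lemma square_wave_deriv:
  assumes "sin x \<noteq> 0"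
  shows "(square_wave J has_real_derivative sin (2 * real J * x) / (2 * sin x)) (at x)"
proof -
  have "(square_wave J has_real_derivative (\<Sum>j<J. cos (real (2 * j + 1) * x))) (at x)"
    unfolding square_wave_def[abs_def]
    by (intro derivative_eq_intros refl) (auto intro!: derivative_eq_intros sum.cong)
  moreover have "2 * sin x * (\<Sum>j<J. cos (real (2 * j + 1) * x)) = sin (2 * real J * x)"
  proof (induction J)
    case (Suc J)
    have "2 * sin x * cos (real (2 * J + 1) * x) = sin (2 * real (Suc J) * x) - sin (2 * real J * x)"
    proof -
      have "2 * real (Suc J) * x = real (2 * J + 1) * x + x" "2 * real J * x = real (2 * J + 1) * x - x"
        by (simp_all add: algebra_simps)
      then show ?thesis by (simp only: sin_add sin_diff) (simp add: mult_ac)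
    qed
    with Suc show ?case by (simp add: distrib_left)
  qed simp
  then have "(\<Sum>j<J. cos (real (2 * j + 1) * x)) = sin (2 * real J * x) / (2 * sin x)"
    using assms by (simp only: eq_divide_eq mult.commute) simp
  ultimately show ?thesis by (simp only:)
qed

text \<open>The derivative sin(2Jx)/(2 sin x) oscillates. Its leading antiderivative is compensated
  by the second term of \<open>E\<close>, and the remaining derivative is \<le> 0 on (0, pi/2], so
  \<open>E x\<close> is at least \<open>E (pi / 2)\<close>. The constant 1 beside the cosine makes
  the correction nonnegative and lets it vanish at every second node.\<close>

lemma square_wave_ge:
  assumes J: "2 \<le> J" and x: "0 < x" "x \<le> pi / 2"
  shows "2 / 3 - (1 + cos (2 * real J * x)) / (4 * real J * sin x) \<le> square_wave J x"
proof -
  define E where "E y = square_wave J y + (1 + cos (2 * real J * y)) / (4 * real J * sin y)" for y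
  have "E (pi / 2) \<le> E x"
  proof (rule DERIV_nonpos_imp_nonincreasing[where f = E])
    fix y assume y: "x \<le> y" "y \<le> pi / 2"
    have s: "sin y > 0" using y x by (intro sin_gt_zero) auto
    have c: "0 \<le> cos y" using y x by (intro cos_ge_zero) auto
    have J0: "real J > 0" using J by simp
    have "(E has_real_derivative sin (2 * real J * y) / (2 * sin y) +
        (- sin (2 * real J * y) * (2 * real J) * (4 * real J * sin y) - (1 + cos (2 * real J * y)) * (4 * real J * cos y)) / (4 * real J * sin y * (4 * real J * sin y))) (at y)"
      unfolding E_def[abs_def]
      by (rule DERIV_add[OF square_wave_deriv])
         (use s J0 in \<open>auto intro!: derivative_eq_intros\<close>)
    moreover have "sin (2 * real J * y) / (2 * sin y) +
        (- sin (2 * real J * y) * (2 * real J) * (4 * real J * sin y) - (1 + cos (2 * real J * y)) * (4 * real J * cos y)) / (4 * real J * sin y * (4 * real J * sin y))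
       = - ((1 + cos (2 * real J * y)) * cos y / (4 * real J * (sin y)\<^sup>2))"
      using s J0 by (simp add: field_simps power2_eq_square)
    moreover have "0 \<le> 1 + cos (2 * real J * y)" using cos_ge_minus_one[of "2 * real J * y"] by linarith
    then have "0 \<le> (1 + cos (2 * real J * y)) * cos y / (4 * real J * (sin y)\<^sup>2)"
      using c J0 by (intro divide_nonneg_nonneg mult_nonneg_nonneg) auto
    ultimately show "\<exists>z. (E has_real_derivative z) (at y) \<and> z \<le> 0" by (metis neg_le_0_iff_le)
  qed (use x in auto)
  moreover have "square_wave J (pi / 2) \<le> E (pi / 2)"
  proof -
    have "0 \<le> 1 + cos (2 * real J * (pi / 2))" using cos_ge_minus_one[of "2 * real J * (pi / 2)"] by linarith
    then show ?thesis unfolding E_def by simp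
  qed
  ultimately show ?thesis using square_wave_half_pi[OF J] unfolding E_def by linarith
qed

text \<open>At the nodes cos(2Jx) = (-1)^k. For odd \<open>k\<close> the correction in
  \<open>square_wave_ge\<close> vanishes; for even \<open>k\<close> \<ge> 2 one has sin x \<ge>
  pi/(2J), so it is at most 1/pi < 1/2, and 2/3 - 1/2 = 1/6. Nodes beyond pi/2 are
  reflected.\<close>

lemma square_wave_node_ge:
  assumes J: "2 \<le> J" and k: "0 < k" "k < 2 * J"
  shows "1 / 6 \<le> square_wave J (real k * pi / real (2 * J))"
proof -
  have half: "1 / 6 \<le> square_wave J (real k * pi / real (2 * J))" if k: "0 < k" "k \<le> J" for k
  proof -
    define x where "x = real k * pi / real (2 * J)"
    have x: "0 < x" "x \<le> pi / 2" using k J by (auto simp: x_def field_simps)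
    have c: "cos (2 * real J * x) = (-1) ^ k" using J cos_npi[of k] by (simp add: x_def)
    have "(1 + cos (2 * real J * x)) / (4 * real J * sin x) \<le> 1 / 2"
    proof (cases "even k")
      case False
      then show ?thesis using c by simp
    next
      case True
      then have "2 \<le> k" using k by (cases "k = 1") auto
      then have "2 * pi / real (2 * J) \<le> x" unfolding x_def using J by (intro divide_right_mono mult_right_mono) auto
      then have "pi / (2 * real J) \<le> sin x" using half_le_sin[of x] x by (simp add: field_simps)
      then have "pi / (2 * real J) * (4 * real J) \<le> sin x * (4 * real J)" by (intro mult_right_mono) auto
      then have "2 * pi \<le> 4 * real J * sin x" using J by (simp add: mult_ac)
      then have "4 \<le> 4 * real J * sin x" using pi_gt3 by linarith
      then have "2 / (4 * real J * sin x) \<le> 2 / 4" by (intro divide_left_mono) auto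
      then show ?thesis using True c by simp
    qed
    then show ?thesis using square_wave_ge[OF J x] unfolding x_def by linarith
  qed
  show ?thesis
  proof (cases "k \<le> J")
    case False
    have "square_wave J (real k * pi / real (2 * J)) = square_wave J (real (2 * J - k) * pi / real (2 * J))"
      unfolding square_wave_def
    proof (intro sum.cong refl arg_cong2[where f = "(/)"])
      fix j
      have "real (2 * J - k) * pi / real (2 * J) = pi - real k * pi / real (2 * J)"
        using k J by (simp add: of_nat_diff field_simps)
      then have "sin (real (2 * j + 1) * (real (2 * J - k) * pi / real (2 * J)))
         = sin (real (2 * j + 1) * pi - real (2 * j + 1) * (real k * pi / real (2 * J)))"
        by (simp only: right_diff_distrib)
      also have "\<dots> = sin (real (2 * j + 1) * (real k * pi / real (2 * J)))"
        by (simp only: sin_diff sin_npi cos_npi) simp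
      finally show "sin (real (2 * j + 1) * (real k * pi / real (2 * J))) = sin (real (2 * j + 1) * (real (2 * J - k) * pi / real (2 * J)))" ..
    qed
    then show ?thesis using half[of "2 * J - k"] False k by simp
  qed (use half k in auto)
qed

text \<open>Even indices drop out of the part with \<open>A\<close>, which leaves a square wave; the
  part with \<open>B\<close> is at most 0 + 1 + ... + (2J - 1) \<le> 2J^2 times \<open>B\<close>. So
  a bounded \<open>B\<close> is harmless once \<open>A\<close> is a large multiple of J^2.\<close>

lemma quad_weight_ge:
  assumes J: "2 \<le> J" and k: "0 < k" "k < 2 * J" and AB: "0 \<le> A" "0 \<le> B"
  shows "1 / real J * sin (real k * pi / real (2 * J)) * (A / 6 - 2 * (real J)\<^sup>2 * B) \<le> quad_weight A B J k"
proof -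
  define x where "x = real k * pi / real (2 * J)"
  have odd_sum: "(\<Sum>i<2 * m. (1 - (-1) ^ i) / (2 * real i) * sin (real i * x)) = square_wave m x" for m
  proof (induction m)
    case (Suc m)
    have "(\<Sum>i<2 * Suc m. (1 - (-1) ^ i) / (2 * real i) * sin (real i * x)) =
       (\<Sum>i<2 * m. (1 - (-1) ^ i) / (2 * real i) * sin (real i * x)) + 2 / (2 * real (2 * m + 1)) * sin (real (2 * m + 1) * x)"
      by simp
    also have "2 / (2 * real (2 * m + 1)) * sin (real (2 * m + 1) * x) = sin (real (2 * m + 1) * x) / real (2 * m + 1)"
      by (simp only: mult_divide_mult_cancel_left_if divide_divide_eq_right times_divide_eq_left) simp
    finally show ?case unfolding Suc by (simp add: square_wave_def del: of_nat_add of_nat_mult)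
  qed (simp add: square_wave_def)
  have "(\<Sum>i<2 * J. real i * sin (real i * x)) \<le> (\<Sum>i<2 * J. real i)"
    by (intro sum_mono) (simp add: mult_left_le)
  also have "(\<Sum>i<2 * J. real i) \<le> 2 * (real J)\<^sup>2"
  proof -
    have "(\<Sum>i<2 * m. real i) \<le> 2 * (real m)\<^sup>2" for m
      by (induction m) (auto simp: power2_eq_square algebra_simps)
    then show ?thesis .
  qed
  finally have "B * (\<Sum>i<2 * J. real i * sin (real i * x)) \<le> B * (2 * (real J)\<^sup>2)" using AB by (intro mult_left_mono)
  moreover have "A * (1 / 6) \<le> A * square_wave J x"
    unfolding x_def by (intro mult_left_mono square_wave_node_ge J k AB)
  moreover have "(\<Sum>i<2 * J. quad_coeff A B i * sin (real i * x)) = A * square_wave J x - B * (\<Sum>i<2 * J. real i * sin (real i * x))"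
    unfolding odd_sum[symmetric] quad_coeff_def sum_distrib_left sum_subtractf[symmetric]
    by (intro sum.cong refl) (simp add: algebra_simps)
  ultimately have "A / 6 - 2 * (real J)\<^sup>2 * B \<le> (\<Sum>i<2 * J. quad_coeff A B i * sin (real i * x))"
    by (simp add: mult_ac)
  moreover have "0 \<le> sin x" using k J by (intro sin_ge_zero) (auto simp: x_def field_simps)
  ultimately show ?thesis unfolding quad_weight_def x_def[symmetric]
    by (intro mult_left_mono) auto
qed

section \<open>The mean over the sphere\<close>

lemma emeasure_lborel_orthogonal_vimage:
  fixes g :: "real^4 \<Rightarrow> real^4"
  assumes g: "orthogonal_transformation g" and B: "B \<in> sets borel" "bounded B"
  shows "emeasure lborel (g -` B) = emeasure lborel B"
proof -
  have meas: "B \<in> lmeasurable" using B by (intro bounded_set_imp_lmeasurable) auto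
  have inv: "orthogonal_transformation (inv g)" using g by (rule orthogonal_transformation_inv)
  have eq: "g -` B = inv g ` B"
    using orthogonal_transformation_bij[OF g] by (rule bij_vimage_eq_inv_image)
  have "continuous_on UNIV g"
    using orthogonal_transformation_linear[OF g] linear_continuous_on linear_conv_bounded_linear by blast
  then have "g -` B \<in> sets borel"
    using measurable_sets[OF borel_measurable_continuous_onI B(1)] by simp
  then have "emeasure lborel (g -` B) = emeasure lebesgue (inv g ` B)"
    unfolding eq[symmetric] by simp
  also have "\<dots> = ennreal (measure lebesgue (inv g ` B))"
    by (rule emeasure_eq_measure2[OF measurable_orthogonal_image[OF inv meas]])
  also have "\<dots> = ennreal (measure lebesgue B)" by (simp only: measure_orthogonal_image[OF inv meas])
  also have "\<dots> = emeasure lebesgue B"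
    by (rule emeasure_eq_measure2[OF meas, symmetric])
  also have "\<dots> = emeasure lborel B" using B by simp
  finally show ?thesis .
qed

section \<open>The surface measure through cones\<close>

abbreviation \<sigma> :: "(real^'n::finite) measure" where "\<sigma> \<equiv> sphere_measure"

lemma space_sphere_measure [simp]: "space \<sigma> = sphere 0 1"
  by (simp add: sphere_measure_def space_scale_measure space_restrict_space)

lemma sets_sphere_measure: "sets \<sigma> = sets (restrict_space borel (sphere 0 1))"
  by (simp add: sphere_measure_def)

lemma radial_projection_measurable:
  "(\<lambda>x. x /\<^sub>R norm x) \<in> measurable (restrict_space lborel (cball 0 1 - {0})) (restrict_space borel (sphere (0::real^'n::finite) 1))"
proof (rule measurable_restrict_space2)
  show "(\<lambda>x::real^'n. x /\<^sub>R norm x) \<in> borel_measurable (restrict_space lborel (cball 0 1 - {0}))"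
    by (rule measurable_restrict_space1) measurable
qed (auto simp: space_restrict_space)

lemma emeasure_sphere_measure:
  assumes A: "A \<in> sets (\<sigma> :: (real^'n::finite) measure)"
  shows "emeasure \<sigma> A = of_nat CARD('n) * emeasure lborel {x \<in> cball 0 1 - {0}. x /\<^sub>R norm x \<in> A}"
proof -
  have "emeasure \<sigma> A = of_nat CARD('n) * emeasure (restrict_space lborel (cball 0 1 - {0}))
     ((\<lambda>x. x /\<^sub>R norm x) -` A \<inter> space (restrict_space lborel (cball 0 1 - {0})))"
    unfolding sphere_measure_def emeasure_scale_measure
    by (subst emeasure_distr[OF radial_projection_measurable]) (use A in \<open>auto simp: sets_sphere_measure\<close>)
  also have "(\<lambda>x. x /\<^sub>R norm x) -` A \<inter> space (restrict_space lborel (cball 0 1 - {0})) = {x \<in> cball 0 1 - {0}. x /\<^sub>R norm x \<in> A}"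
    by (auto simp: space_restrict_space)
  also have "emeasure (restrict_space lborel (cball 0 1 - {0})) \<dots> = emeasure lborel \<dots>"
    by (rule emeasure_restrict_space) auto
  finally show ?thesis .
qed

lemma cone_borel:
  assumes A: "A \<in> sets (\<sigma> :: (real^'n::finite) measure)"
  shows "{x \<in> cball 0 1 - {0}. x /\<^sub>R norm x \<in> A} \<in> sets borel"
proof -
  have "(\<lambda>x. x /\<^sub>R norm x) -` A \<inter> space (restrict_space lborel (cball 0 1 - {0})) \<in> sets (restrict_space lborel (cball 0 1 - {0}))"
    by (rule measurable_sets[OF radial_projection_measurable]) (use A in \<open>simp add: sets_sphere_measure\<close>)
  then have "(\<lambda>x. x /\<^sub>R norm x) -` A \<inter> space (restrict_space lborel (cball 0 1 - {0})) \<in> sets borel"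
    by (subst (asm) sets_restrict_space_iff) auto
  moreover have "(\<lambda>x. x /\<^sub>R norm x) -` A \<inter> space (restrict_space lborel (cball 0 1 - {0})) = {x \<in> cball 0 1 - {0}. x /\<^sub>R norm x \<in> A}"
    by (auto simp: space_restrict_space)
  ultimately show ?thesis by simp
qed

lemma emeasure_sphere_finite: "emeasure \<sigma> (sphere (0::real^'n::finite) 1) < \<infinity>"
  and measure_sphere_pos: "0 < measure \<sigma> (sphere (0::real^'n::finite) 1)"
proof -
  have sp: "sphere (0::real^'n) 1 \<in> sets \<sigma>" using sets.top[of "\<sigma> :: (real^'n) measure"] by simp
  have eq: "{x \<in> cball 0 1 - {0}. x /\<^sub>R norm x \<in> sphere (0::real^'n) 1} = cball 0 1 - {0}"
    by auto
  have e: "emeasure \<sigma> (sphere (0::real^'n) 1) = of_nat CARD('n) * emeasure lborel (cball (0::real^'n) 1)"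
    unfolding emeasure_sphere_measure[OF sp] eq
    by (subst emeasure_Diff_null_set) auto
  have fin: "emeasure lborel (cball (0::real^'n) 1) < \<infinity>" by (rule emeasure_bounded_finite) simp
  have em: "emeasure \<sigma> (sphere (0::real^'n) 1) = ennreal (real CARD('n) * measure lborel (cball (0::real^'n) 1))"
    unfolding e using fin by (simp add: emeasure_eq_ennreal_measure ennreal_mult ennreal_of_nat_eq_real_of_nat)
  then show "emeasure \<sigma> (sphere (0::real^'n) 1) < \<infinity>" by simp
  show "0 < measure \<sigma> (sphere (0::real^'n) 1)"
    unfolding measure_def[of \<sigma>] em using content_cball_pos[of 1 "0::real^'n"] by (simp add: enn2real_ennreal)
qed

lemma finite_measure_sphere: "finite_measure (\<sigma> :: (real^'n::finite) measure)"
  by (rule finite_measureI) (use emeasure_sphere_finite[where 'n='n] in auto)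

lemma borel_measurable_sphere:
  fixes F :: "real^'n::finite \<Rightarrow> 'b::{banach, second_countable_topology}"
  assumes "continuous_on UNIV F" shows "F \<in> borel_measurable \<sigma>"
proof -
  have "F \<in> borel_measurable (restrict_space borel (sphere 0 1))"
    by (rule measurable_restrict_space1) (rule borel_measurable_continuous_onI[OF assms])
  then show ?thesis by (simp add: measurable_cong_sets[OF sets_sphere_measure refl])
qed

lemma integrable_sphere:
  fixes F :: "real^'n::finite \<Rightarrow> 'b::{banach, second_countable_topology}"
  assumes F: "continuous_on UNIV F" shows "integrable \<sigma> F"
proof -
  have "compact (F ` sphere 0 1)"
    by (intro compact_continuous_image continuous_on_subset[OF F]) auto
  then obtain B where B: "\<And>x. x \<in> sphere 0 1 \<Longrightarrow> norm (F x) \<le> B"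
    using compact_imp_bounded bounded_iff by (metis imageI)
  show ?thesis
    by (rule finite_measure.integrable_const_bound[OF finite_measure_sphere _ borel_measurable_sphere[OF F]])
       (use B in \<open>auto intro!: AE_I2\<close>)
qed

section \<open>Normalized means\<close>

definition sphere_mean :: "(real^'n::finite \<Rightarrow> 'b::{banach, second_countable_topology}) \<Rightarrow> 'b" where
  "sphere_mean F = (1 / measure \<sigma> (sphere (0::real^'n) 1)) *\<^sub>R integral\<^sup>L \<sigma> F"

lemma sphere_mean_add:
  assumes "continuous_on UNIV F" "continuous_on UNIV G"
  shows "sphere_mean (\<lambda>x. F x + G x) = sphere_mean F + sphere_mean G"
  using integrable_sphere[OF assms(1)] integrable_sphere[OF assms(2)]
  by (simp add: sphere_mean_def scaleR_right_distrib)

lemma sphere_mean_mult: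
  fixes F :: "real^'n::finite \<Rightarrow> 'b::{banach, second_countable_topology, real_normed_field}"
  shows "sphere_mean (\<lambda>x. c * F x) = c * sphere_mean F"
  by (simp add: sphere_mean_def)

lemma sphere_mean_const [simp]:
  fixes c :: "'b::{banach, second_countable_topology}"
  shows "sphere_mean (\<lambda>x :: real^'n::finite. c) = c"
proof -
  have "integral\<^sup>L \<sigma> (\<lambda>x :: real^'n. c) = measure \<sigma> (sphere (0::real^'n) 1) *\<^sub>R c"
    by (simp add: lebesgue_integral_const)
  then show ?thesis using measure_sphere_pos[where 'n='n] by (simp add: sphere_mean_def)
qed

lemma sphere_mean_sum:
  fixes F :: "'i \<Rightarrow> real^'n::finite \<Rightarrow> 'b::{banach, second_countable_topology}"
  assumes "finite I" "\<And>i. i \<in> I \<Longrightarrow> continuous_on UNIV (F i)"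
  shows "sphere_mean (\<lambda>x. \<Sum>i\<in>I. F i x) = (\<Sum>i\<in>I. sphere_mean (F i))"
  using assms by (induction I rule: finite_induct) (auto simp: sphere_mean_add continuous_on_sum)

lemma sphere_mean_cong:
  "(\<And>x. x \<in> sphere 0 1 \<Longrightarrow> F x = G x) \<Longrightarrow> sphere_mean F = sphere_mean G"
  unfolding sphere_mean_def by (intro arg_cong2[where f = scaleR] refl Bochner_Integration.integral_cong) auto

lemma sphere_mean_of_real:
  fixes F :: "real^'n::finite \<Rightarrow> real"
  shows "sphere_mean (\<lambda>x. complex_of_real (F x)) = complex_of_real (sphere_mean F)"
  by (simp add: sphere_mean_def scaleR_conv_of_real)

text \<open>The cone over a preimage is the preimage of the cone, as \<open>g\<close> is linear and
  keeps norms; so the invariance of \<sigma> reduces to that of Lebesgue measure on bounded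
  sets.\<close>

lemma sphere_mean_orthogonal:
  fixes F :: "real^4 \<Rightarrow> 'b::{banach, second_countable_topology}" and g :: "real^4 \<Rightarrow> real^4"
  assumes g: "orthogonal_transformation g" and F: "continuous_on UNIV F"
  shows "sphere_mean (\<lambda>x. F (g x)) = sphere_mean F"
proof -
  have cg: "continuous_on UNIV g"
    using orthogonal_transformation_linear[OF g] linear_continuous_on linear_conv_bounded_linear by blast
  have gm: "g \<in> measurable \<sigma> \<sigma>"
  proof -
    have "g \<in> measurable (restrict_space borel (sphere 0 1)) (restrict_space borel (sphere 0 1))"
      by (intro measurable_restrict_space2 measurable_restrict_space1 borel_measurable_continuous_onI cg)
         (auto simp: space_restrict_space orthogonal_transformation_norm[OF g])
    then show ?thesis by (simp add: measurable_cong_sets[OF sets_sphere_measure sets_sphere_measure])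
  qed
  have "distr \<sigma> \<sigma> g = \<sigma>"
  proof (rule measure_eqI)
    fix A assume "A \<in> sets (distr \<sigma> \<sigma> g)"
    then have A: "A \<in> sets \<sigma>" by simp
    have "emeasure (distr \<sigma> \<sigma> g) A = emeasure \<sigma> (g -` A \<inter> space \<sigma>)"
      by (rule emeasure_distr[OF gm A])
    also have "\<dots> = of_nat CARD(4) * emeasure lborel {x \<in> cball 0 1 - {0}. x /\<^sub>R norm x \<in> g -` A \<inter> space \<sigma>}"
      using emeasure_sphere_measure[OF measurable_sets[OF gm A]] .
    also have "{x \<in> cball 0 1 - {0}. x /\<^sub>R norm x \<in> g -` A \<inter> space \<sigma>} = g -` {x \<in> cball 0 1 - {0}. x /\<^sub>R norm x \<in> A}"
    proof -
      have n: "norm (g x) = norm x" for x by (rule orthogonal_transformation_norm[OF g])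
      have z: "g x = 0 \<longleftrightarrow> x = 0" for x unfolding norm_eq_zero[of "g x", symmetric] n by simp
      have sc: "g (x /\<^sub>R norm x) = g x /\<^sub>R norm x" for x by (rule orthogonal_transformation_scaleR[OF g])
      have sp: "x /\<^sub>R norm x \<in> space \<sigma>" if "x \<noteq> 0" for x :: "real^4" using that by simp
      have "x \<in> cball 0 1 - {0} \<longleftrightarrow> g x \<in> cball 0 1 - {0}" for x unfolding Diff_iff mem_cball_0 n singleton_iff z ..
      then show ?thesis unfolding vimage_def Int_iff mem_Collect_eq sc n using sp by blast
    qed
    also have "emeasure lborel \<dots> = emeasure lborel {x \<in> cball 0 1 - {0}. x /\<^sub>R norm x \<in> A}"
      by (rule emeasure_lborel_orthogonal_vimage[OF g cone_borel[OF A]])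
         (rule bounded_subset[OF bounded_cball[of 0 1]], auto)
    also have "of_nat CARD(4) * \<dots> = emeasure \<sigma> A" by (rule emeasure_sphere_measure[OF A, symmetric])
    finally show "emeasure (distr \<sigma> \<sigma> g) A = emeasure \<sigma> A" .
  qed simp
  then have "integral\<^sup>L \<sigma> F = integral\<^sup>L (distr \<sigma> \<sigma> g) F" by simp
  also have "\<dots> = integral\<^sup>L \<sigma> (\<lambda>x. F (g x))" by (rule integral_distr[OF gm borel_measurable_sphere[OF F]])
  finally show ?thesis by (simp add: sphere_mean_def)
qed

text \<open>The square vanishes almost everywhere, so the cone over the points where
  \<open>f\<close> is nonzero is a null set. Within the open punctured ball this cone is open by
  continuity, and an open null set is empty.\<close>

lemma sphere_mean_square_zero:
  fixes f :: "real^'n::finite \<Rightarrow> real"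
  assumes f: "continuous_on UNIV f" and 0: "sphere_mean (\<lambda>x. (f x)\<^sup>2) = 0" and x: "x \<in> sphere 0 1"
  shows "f x = 0"
proof -
  have c2: "continuous_on UNIV (\<lambda>x. (f x)\<^sup>2)" using f by (intro continuous_intros)
  have "integral\<^sup>L \<sigma> (\<lambda>x. (f x)\<^sup>2) = 0"
    using 0 measure_sphere_pos[where 'n='n] by (simp add: sphere_mean_def)
  then have "AE x in \<sigma>. (f x)\<^sup>2 = 0"
    by (subst (asm) integral_nonneg_eq_0_iff_AE[OF integrable_sphere[OF c2]]) auto
  then obtain N where N: "{x \<in> space \<sigma>. \<not> (f x)\<^sup>2 = 0} \<subseteq> N" "emeasure \<sigma> N = 0" "N \<in> sets \<sigma>"
    by (rule AE_E)
  define C where "C = {x \<in> cball 0 1 - {0}. x /\<^sub>R norm x \<in> N}"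
  have "of_nat CARD('n) * emeasure lborel C = 0" using N emeasure_sphere_measure[OF N(3)] by (simp add: C_def)
  then have "emeasure lborel C = 0" by simp
  then have "C \<in> null_sets lborel" using cone_borel[OF N(3)] by (simp add: null_sets_def C_def)
  then have Cn: "C \<in> null_sets lebesgue" using null_sets_completionI by blast
  define U where "U = ball 0 1 - {0::real^'n}"
  define Z where "Z = {y. norm y * f (y /\<^sub>R norm y) = 0} \<inter> U"
  define g where "g y = (if y = 0 then 0 else f (y /\<^sub>R norm y))" for y :: "real^'n"
  have cg: "continuous_on U g"
  proof -
    have "continuous_on U (\<lambda>y. f (y /\<^sub>R norm y))"
      by (rule continuous_on_compose2[OF f]) (auto intro!: continuous_intros simp: U_def)
    then show ?thesis by (rule continuous_on_eq) (auto simp: g_def U_def)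
  qed
  have oU: "open U" by (simp add: U_def open_Diff)
  have "open {y \<in> U. g y \<noteq> 0}"
  proof -
    have "open (U \<inter> g -` (- {0}))" by (rule continuous_open_preimage[OF cg oU]) auto
    moreover have "U \<inter> g -` (- {0}) = {y \<in> U. g y \<noteq> 0}" by auto
    ultimately show ?thesis by simp
  qed
  moreover have "{y \<in> U. g y \<noteq> 0} \<subseteq> C"
    using N(1) by (auto simp: C_def U_def g_def)
  then have "negligible {y \<in> U. g y \<noteq> 0}"
    using Cn negligible_iff_null_sets negligible_subset by blast
  ultimately have "{y \<in> U. g y \<noteq> 0} = {}"
    using open_not_negligible by blast
  moreover have "x /\<^sub>R 2 \<in> U" using x by (auto simp: U_def)
  ultimately have "g (x /\<^sub>R 2) = 0" by blast
  moreover have "x \<noteq> 0" using x by auto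
  ultimately show ?thesis using x by (simp add: g_def)
qed

section \<open>Polynomials in two complex variables\<close>

definition zl :: "real^4 \<Rightarrow> complex" where "zl x = Complex (x $ 1) (x $ 2)"
definition zr :: "real^4 \<Rightarrow> complex" where "zr x = Complex (x $ 3) (x $ 4)"
definition mk4 :: "complex \<Rightarrow> complex \<Rightarrow> real^4" where
  "mk4 u v = (\<chi> i. if i = 1 then Re u else if i = 2 then Im u else if i = 3 then Re v else Im v)"

lemma four_distinct: "(1::4) \<noteq> 2" "(1::4) \<noteq> 3" "(1::4) \<noteq> 4" "(2::4) \<noteq> 3" "(2::4) \<noteq> 4" "(3::4) \<noteq> 4"
  by simp_all

lemma mk4_nth [simp]: "mk4 u v $ 1 = Re u" "mk4 u v $ 2 = Im u" "mk4 u v $ 3 = Re v" "mk4 u v $ 4 = Im v"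
  using four_distinct by (auto simp: mk4_def)

lemma zl_mk4 [simp]: "zl (mk4 u v) = u" and zr_mk4 [simp]: "zr (mk4 u v) = v"
  by (simp_all add: zl_def zr_def)

lemma vec4_eqI: "zl x = zl y \<Longrightarrow> zr x = zr y \<Longrightarrow> x = y"
  by (simp add: vec_eq_iff forall_4 zl_def zr_def)

lemma zl_add: "zl (x + y) = zl x + zl y" and zr_add: "zr (x + y) = zr x + zr y"
  and zl_scaleR: "zl (r *\<^sub>R x) = of_real r * zl x" and zr_scaleR: "zr (r *\<^sub>R x) = of_real r * zr x"
  by (simp_all add: zl_def zr_def complex_eq_iff)

lemma norm_sq_vec4: "(norm x)\<^sup>2 = (cmod (zl x))\<^sup>2 + (cmod (zr x))\<^sup>2"
  by (simp add: norm_vec_def L2_set_def sum_4 sum_nonneg zl_def zr_def cmod_power2)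

lemma continuous_on_zl [continuous_intros]: "continuous_on S f \<Longrightarrow> continuous_on S (\<lambda>x. zl (f x))"
  and continuous_on_zr [continuous_intros]: "continuous_on S f \<Longrightarrow> continuous_on S (\<lambda>x. zr (f x))"
  unfolding zl_def zr_def Complex_eq by (auto intro!: continuous_intros)

definition cmon :: "nat \<Rightarrow> nat \<Rightarrow> nat \<Rightarrow> nat \<Rightarrow> real^4 \<Rightarrow> complex" where
  "cmon a b c d x = zl x ^ a * cnj (zl x) ^ b * zr x ^ c * cnj (zr x) ^ d"

lemma continuous_on_cmon [continuous_intros]: "continuous_on S (cmon a b c d)"
  unfolding cmon_def[abs_def] by (intro continuous_intros)

text \<open>An inductive form of polynomials of degree at most \<open>n\<close>: products, the
  coordinate exchange and the passage to complex monomials become inductions instead of computations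
  with exponents.\<close>

inductive pdeg :: "nat \<Rightarrow> (real^4 \<Rightarrow> real) \<Rightarrow> bool" where
  const: "pdeg n (\<lambda>x. c)"
| coord: "pdeg n f \<Longrightarrow> pdeg (Suc n) (\<lambda>x. x $ i * f x)"
| add: "pdeg n f \<Longrightarrow> pdeg n g \<Longrightarrow> pdeg n (\<lambda>x. f x + g x)"

lemma pdeg_mono: "pdeg n f \<Longrightarrow> n \<le> m \<Longrightarrow> pdeg m f"
proof (induction arbitrary: m rule: pdeg.induct)
  case (coord n f i)
  then obtain k where "m = Suc k" by (cases m) auto
  then show ?case using coord by (auto intro!: pdeg.coord)
qed (auto intro: pdeg.intros)

lemma pdeg_scale: "pdeg n f \<Longrightarrow> pdeg n (\<lambda>x. c * f x)"
proof (induction rule: pdeg.induct)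
  case (const n d)
  show ?case by (rule pdeg.const)
next
  case (coord n f i)
  from pdeg.coord[OF coord.IH, of i] show ?case by (simp add: mult.left_commute)
next
  case (add n f g)
  from pdeg.add[OF add.IH] show ?case by (simp add: distrib_left)
qed

lemma pdeg_mult: "pdeg n f \<Longrightarrow> pdeg m g \<Longrightarrow> pdeg (n + m) (\<lambda>x. f x * g x)"
proof (induction rule: pdeg.induct)
  case (const n c)
  then show ?case using pdeg_mono[OF pdeg_scale[of m g c], of "n + m"] by simp
next
  case (coord n f i)
  from pdeg.coord[OF coord.IH[OF coord.prems], of i] show ?case by (simp add: mult.assoc)
next
  case (add n f g')
  from pdeg.add[OF add.IH(1)[OF add.prems] add.IH(2)[OF add.prems]] show ?case by (simp add: distrib_right)
qed

lemma pdeg_sum: "finite I \<Longrightarrow> (\<And>i. i \<in> I \<Longrightarrow> pdeg n (f i)) \<Longrightarrow> pdeg n (\<lambda>x. \<Sum>i\<in>I. f i x)"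
proof (induction I rule: finite_induct)
  case empty
  show ?case using pdeg.const[of n 0] by simp
next
  case (insert i I)
  then show ?case by (simp add: pdeg.add)
qed

lemma pdeg_power: "pdeg k (\<lambda>x. x $ i ^ k)"
proof (induction k)
  case 0
  show ?case using pdeg.const[of 0 1] by simp
next
  case (Suc k)
  from pdeg.coord[OF Suc, of i] show ?case by simp
qed

lemma pdeg_monomial: "pdeg (\<Sum>i\<in>UNIV. \<alpha> i) (\<lambda>x. \<Prod>i\<in>UNIV. (x $ i) ^ \<alpha> i)"
proof -
  have "pdeg (\<Sum>i\<in>I. \<alpha> i) (\<lambda>x. \<Prod>i\<in>I. (x $ i) ^ \<alpha> i)" if "finite I" for I :: "4 set"
    using that
  proof (induction I rule: finite_induct)
    case empty
    show ?case using pdeg.const[of 0 1] by simp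
  next
    case (insert i I)
    then show ?case using pdeg_mult[OF pdeg_power insert.IH] by simp
  qed
  then show ?thesis by simp
qed

lemma pdeg_continuous: "pdeg n f \<Longrightarrow> continuous_on S f"
  by (induction rule: pdeg.induct) (auto intro!: continuous_intros)

text \<open>Combinations of monomials in z_1, z_2 and their conjugates, the form in which a torus
  rotation multiplies each term by a phase.\<close>

inductive cpoly :: "nat \<Rightarrow> (real^4 \<Rightarrow> complex) \<Rightarrow> bool" where
  mon: "a + b + c + d \<le> n \<Longrightarrow> cpoly n (\<lambda>x. k * cmon a b c d x)"
| add: "cpoly n f \<Longrightarrow> cpoly n g \<Longrightarrow> cpoly n (\<lambda>x. f x + g x)"

lemma cpoly_continuous: "cpoly n f \<Longrightarrow> continuous_on S f"
  by (induction rule: cpoly.induct) (auto intro!: continuous_intros)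

lemma cpoly_coord: "cpoly n f \<Longrightarrow> cpoly (Suc n) (\<lambda>x. of_real (x $ i) * f x)"
proof (induction rule: cpoly.induct)
  case (mon a b c d n k)
  have "cpoly (Suc n) (\<lambda>x. k / 2 * cmon (Suc a) b c d x + k / 2 * cmon a (Suc b) c d x)"
       "cpoly (Suc n) (\<lambda>x. k / (2 * \<i>) * cmon (Suc a) b c d x + (- k / (2 * \<i>)) * cmon a (Suc b) c d x)"
       "cpoly (Suc n) (\<lambda>x. k / 2 * cmon a b (Suc c) d x + k / 2 * cmon a b c (Suc d) x)"
       "cpoly (Suc n) (\<lambda>x. k / (2 * \<i>) * cmon a b (Suc c) d x + (- k / (2 * \<i>)) * cmon a b c (Suc d) x)"
    by (intro cpoly.add cpoly.mon; use mon in simp)+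
  moreover have "of_real (x $ 1) * (k * cmon a b c d x) = k / 2 * cmon (Suc a) b c d x + k / 2 * cmon a (Suc b) c d x"
     "of_real (x $ 2) * (k * cmon a b c d x) = k / (2 * \<i>) * cmon (Suc a) b c d x + (- k / (2 * \<i>)) * cmon a (Suc b) c d x"
     "of_real (x $ 3) * (k * cmon a b c d x) = k / 2 * cmon a b (Suc c) d x + k / 2 * cmon a b c (Suc d) x"
     "of_real (x $ 4) * (k * cmon a b c d x) = k / (2 * \<i>) * cmon a b (Suc c) d x + (- k / (2 * \<i>)) * cmon a b c (Suc d) x" for x
  proof -
    have e: "of_real (x $ 1) = (zl x + cnj (zl x)) / 2" "of_real (x $ 2) = (zl x - cnj (zl x)) / (2 * \<i>)"
      "of_real (x $ 3) = (zr x + cnj (zr x)) / 2" "of_real (x $ 4) = (zr x - cnj (zr x)) / (2 * \<i>)"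
      by (simp_all add: zl_def zr_def complex_eq_iff)
    show "of_real (x $ 1) * (k * cmon a b c d x) = k / 2 * cmon (Suc a) b c d x + k / 2 * cmon a (Suc b) c d x"
     "of_real (x $ 2) * (k * cmon a b c d x) = k / (2 * \<i>) * cmon (Suc a) b c d x + (- k / (2 * \<i>)) * cmon a (Suc b) c d x"
     "of_real (x $ 3) * (k * cmon a b c d x) = k / 2 * cmon a b (Suc c) d x + k / 2 * cmon a b c (Suc d) x"
     "of_real (x $ 4) * (k * cmon a b c d x) = k / (2 * \<i>) * cmon a b (Suc c) d x + (- k / (2 * \<i>)) * cmon a b c (Suc d) x"
      unfolding e cmon_def by (simp_all add: field_simps)
  qed
  moreover have "i = 1 \<or> i = 2 \<or> i = 3 \<or> i = 4" using exhaust_4 by blast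
  ultimately show ?case by (elim disjE) simp_all
next
  case (add n f g)
  from cpoly.add[OF add.IH] show ?case by (simp add: distrib_left)
qed

lemma pdeg_imp_cpoly: "pdeg n f \<Longrightarrow> cpoly n (\<lambda>x. of_real (f x))"
proof (induction rule: pdeg.induct)
  case (const n c)
  show ?case using cpoly.mon[of 0 0 0 0 n "of_real c"] by (simp add: cmon_def)
next
  case (coord n f i)
  from cpoly_coord[OF coord.IH, of i] show ?case by simp
next
  case (add n f g)
  from cpoly.add[OF add.IH] show ?case by simp
qed

section \<open>Isometries in complex coordinates\<close>

lemma orthogonal_mk4:
  assumes "\<And>x y. u (x + y) = u x + u y" "\<And>x y. v (x + y) = v x + v y"
    "\<And>r x. u (r *\<^sub>R x) = of_real r * u x" "\<And>r x. v (r *\<^sub>R x) = of_real r * v x"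
    "\<And>x. (cmod (u x))\<^sup>2 + (cmod (v x))\<^sup>2 = (norm x)\<^sup>2"
  shows "orthogonal_transformation (\<lambda>x::real^4. mk4 (u x) (v x))"
  unfolding orthogonal_transformation
proof (intro conjI allI)
  show "linear (\<lambda>x. mk4 (u x) (v x))"
    by (rule linearI) (auto intro!: vec4_eqI simp: assms(1-4) zl_add zr_add zl_scaleR zr_scaleR)
  fix x :: "real^4"
  have "(norm (mk4 (u x) (v x)))\<^sup>2 = (norm x)\<^sup>2"
    using assms(5)[of x] by (simp add: norm_sq_vec4[of "mk4 (u x) (v x)"])
  then show "norm (mk4 (u x) (v x)) = norm x" by simp
qed

definition rot :: "complex \<Rightarrow> complex \<Rightarrow> real^4 \<Rightarrow> real^4" where
  "rot u v x = mk4 (u * zl x) (v * zr x)"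

lemma orthogonal_rot: "cmod u = 1 \<Longrightarrow> cmod v = 1 \<Longrightarrow> orthogonal_transformation (rot u v)"
  unfolding rot_def[abs_def]
  by (rule orthogonal_mk4) (auto simp: zl_add zr_add zl_scaleR zr_scaleR norm_sq_vec4 norm_mult algebra_simps)

definition mix :: "real \<Rightarrow> real \<Rightarrow> real^4 \<Rightarrow> real^4" where
  "mix p q x = mk4 (of_real p * zl x + of_real q * zr x) (of_real p * zr x - of_real q * zl x)"

lemma orthogonal_mix:
  assumes "p\<^sup>2 + q\<^sup>2 = 1" shows "orthogonal_transformation (mix p q)"
  unfolding mix_def[abs_def]
proof (rule orthogonal_mk4)
  fix x :: "real^4"
  have "(cmod (of_real p * zl x + of_real q * zr x))\<^sup>2 + (cmod (of_real p * zr x - of_real q * zl x))\<^sup>2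
     = (p\<^sup>2 + q\<^sup>2) * ((cmod (zl x))\<^sup>2 + (cmod (zr x))\<^sup>2)"
    unfolding cmod_power2 by (simp add: power2_eq_square algebra_simps)
  then show "(cmod (of_real p * zl x + of_real q * zr x))\<^sup>2 + (cmod (of_real p * zr x - of_real q * zl x))\<^sup>2 = (norm x)\<^sup>2"
    by (simp add: assms norm_sq_vec4)
qed (auto simp: zl_add zr_add zl_scaleR zr_scaleR algebra_simps)

text \<open>The exchange of the second and third real coordinate. It carries the circle z_2 = 0 to
  the circle of real points of C^2, on which (cos \<eta>, sin \<eta>) lies for every torus.\<close>

definition swp :: "real^4 \<Rightarrow> real^4" where
  "swp x = mk4 (Complex (x $ 1) (x $ 3)) (Complex (x $ 2) (x $ 4))"

lemma orthogonal_swp: "orthogonal_transformation swp"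
  unfolding swp_def[abs_def]
  by (rule orthogonal_mk4) (auto simp: complex_eq_iff norm_sq_vec4 zl_def zr_def cmod_power2)

lemma swp_swp [simp]: "swp (swp x) = x"
  by (rule vec4_eqI) (auto simp: swp_def zl_def zr_def)

lemma pdeg_swp: "pdeg n f \<Longrightarrow> pdeg n (\<lambda>x. f (swp x))"
proof (induction rule: pdeg.induct)
  case (coord n f i)
  have "swp x $ i = x $ (if i = 2 then 3 else if i = 3 then 2 else i)" for x
    using exhaust_4[of i] by (auto simp: swp_def)
  then show ?case using pdeg.coord[OF coord.IH] by simp
qed (auto intro: pdeg.intros)

section \<open>Means of complex monomials\<close>

lemma cmon_rot: "cmon a b c d (rot u v x) = u ^ a * cnj u ^ b * v ^ c * cnj v ^ d * cmon a b c d x"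
  by (simp add: cmon_def rot_def power_mult_distrib mult_ac)

lemma cis_power_cnj: "cis \<phi> ^ a * cnj (cis \<phi>) ^ b = cis ((real a - real b) * \<phi>)"
  by (simp add: cis_cnj Complex.DeMoivre cis_mult left_diff_distrib)

text \<open>The angle is nonzero and of absolute value below 1 < pi, so its sine is nonzero.\<close>

lemma cis_ne_1:
  assumes "a \<noteq> b" shows "cis ((real a - real b) * (1 / (1 + real a + real b))) \<noteq> 1"
proof -
  define t where "t = (real a - real b) * (1 / (1 + real a + real b))"
  have "t \<noteq> 0" using assms by (simp add: t_def)
  moreover have "\<bar>t\<bar> < 1" by (simp add: t_def abs_mult divide_simps)
  ultimately have "sin t \<noteq> 0" using sin_eq_0_pi[of t] pi_gt3 by linarith
  then have "Im (cis t) \<noteq> 0" by simp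
  then show ?thesis unfolding t_def by (metis one_complex.sel(2))
qed

text \<open>A rotation of one complex coordinate leaves the mean unchanged and at the same time
  multiplies it by a phase other than 1.\<close>

lemma sphere_mean_cmon_off_diagonal:
  assumes "a \<noteq> b \<or> c \<noteq> d" shows "sphere_mean (cmon a b c d) = 0"
proof -
  have inv: "u ^ a * cnj u ^ b * v ^ c * cnj v ^ d * sphere_mean (cmon a b c d) = sphere_mean (cmon a b c d)"
    if "cmod u = 1" "cmod v = 1" for u v
    using sphere_mean_orthogonal[OF orthogonal_rot[OF that] continuous_on_cmon[of UNIV a b c d]]
    by (simp add: cmon_rot sphere_mean_mult)
  show ?thesis
  proof (cases "a = b")
    case False
    show ?thesis using inv[of "cis (1 / (1 + real a + real b))" 1] cis_ne_1[OF False] by (simp add: cis_power_cnj)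
  next
    case True
    then have "c \<noteq> d" using assms by simp
    show ?thesis using inv[of 1 "cis (1 / (1 + real c + real d))"] cis_ne_1[OF \<open>c \<noteq> d\<close>] by (simp add: cis_power_cnj)
  qed
qed

text \<open>
  Expanding the invariant \<open>|p z\<^sub>1 + q z\<^sub>2|\<^sup>2\<^sup>k\<close>, \<open>p\<^sup>2 + q\<^sup>2 = 1\<close>, in powers of \<open>p\<^sup>2/q\<^sup>2\<close> shows that the mean of
  \<open>|z\<^sub>1|\<^sup>2\<^sup>j |z\<^sub>2|\<^sup>2\<^sup>(\<^sup>k\<^sup>-\<^sup>j\<^sup>)\<close> times the binomial coefficient does not depend on \<open>j\<close>.
\<close>

lemma sphere_mean_cmon_diagonal:
  "sphere_mean (cmon a a c c) = of_real (fact a * fact c / fact (a + c + 1))"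
proof -
  define k where "k = a + c"
  define I where "I j = sphere_mean (cmon j j (k - j) (k - j))" for j
  have expand: "sphere_mean (cmon k k 0 0) = (\<Sum>j\<le>k. of_nat (k choose j) ^ 2 * of_real (p ^ (2 * j) * q ^ (2 * (k - j))) * I j)"
    if pq: "p\<^sup>2 + q\<^sup>2 = 1" for p q :: real
  proof -
    have e1: "(of_real p * zl x + of_real q * zr x) ^ k = (\<Sum>j\<le>k. of_nat (k choose j) * (of_real p * zl x) ^ j * (of_real q * zr x) ^ (k - j))" for x
      by (rule binomial_ring)
    have e2: "cnj (of_real p * zl x + of_real q * zr x) ^ k = (\<Sum>l\<le>k. of_nat (k choose l) * (of_real p * cnj (zl x)) ^ l * (of_real q * cnj (zr x)) ^ (k - l))" for x
      by (simp add: binomial_ring)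
    define C :: "nat \<Rightarrow> nat \<Rightarrow> complex" where "C j l = of_nat (k choose j) * of_nat (k choose l) * (of_real p ^ j * of_real q ^ (k - j) * of_real p ^ l * of_real q ^ (k - l))" for j l :: nat
    have "cmon k k 0 0 (mix p q x) = (\<Sum>j\<le>k. \<Sum>l\<le>k. C j l * cmon j l (k - j) (k - l) x)" for x
      unfolding cmon_def mix_def zl_mk4 zr_mk4 e1 e2 C_def power_0 mult_1_right
      unfolding sum_product by (intro sum.cong refl) (simp add: power_mult_distrib mult_ac)
    then have "sphere_mean (cmon k k 0 0) = sphere_mean (\<lambda>x. \<Sum>j\<le>k. \<Sum>l\<le>k. C j l * cmon j l (k - j) (k - l) x)"
      using sphere_mean_orthogonal[OF orthogonal_mix[OF pq] continuous_on_cmon[of UNIV k k 0 0]] by simp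
    also have "\<dots> = (\<Sum>j\<le>k. \<Sum>l\<le>k. C j l * sphere_mean (cmon j l (k - j) (k - l)))"
      by (subst sphere_mean_sum; (intro finite_atMost continuous_intros)?)
         (simp add: sphere_mean_sum sphere_mean_mult continuous_intros)
    also have "\<dots> = (\<Sum>j\<le>k. \<Sum>l\<le>k. if j = l then C j j * I j else 0)"
      by (intro sum.cong refl) (auto simp: sphere_mean_cmon_off_diagonal I_def)
    finally have "sphere_mean (cmon k k 0 0) = (\<Sum>j\<le>k. C j j * I j)" by simp
    moreover have Cjj: "C j j = of_nat (k choose j) ^ 2 * of_real (p ^ (2 * j) * q ^ (2 * (k - j)))" for j
      unfolding C_def power_even_eq by (simp add: power2_eq_square mult_ac)
    ultimately show ?thesis by (simp only: Cjj)
  qed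
  define m where "m = sphere_mean (cmon k k 0 0)"
  \<comment> \<open>\<open>x\<close> is p^2/q^2. Multiplying \<open>expand\<close> by (1 + x)^k =
    q^(-2k) gives a polynomial identity in \<open>x\<close> on the positive half-line.\<close>
  have zero: "(\<Sum>j\<le>k. (of_nat (k choose j) ^ 2 * I j - m * of_nat (k choose j)) * of_real x ^ j) = 0" if x: "0 < x" for x :: real
  proof -
    define p where "p = sqrt (x / (1 + x))"
    define q where "q = sqrt (1 / (1 + x))"
    have p2: "p\<^sup>2 = x / (1 + x)" "q\<^sup>2 = 1 / (1 + x)" using x by (auto simp: p_def q_def)
    have "p\<^sup>2 + q\<^sup>2 = 1" unfolding p2 using x by (simp add: add_divide_distrib[symmetric] add.commute)
    from expand[OF this] have "m * of_real ((1 + x) ^ k) =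
       (\<Sum>j\<le>k. of_nat (k choose j) ^ 2 * of_real (p ^ (2 * j) * q ^ (2 * (k - j)) * (1 + x) ^ k) * I j)"
      by (simp add: m_def sum_distrib_left sum_distrib_right mult_ac)
    also have "\<dots> = (\<Sum>j\<le>k. of_nat (k choose j) ^ 2 * of_real (x ^ j) * I j)"
    proof (intro sum.cong refl)
      fix j assume "j \<in> {..k}"
      then have "(1 + x) ^ k = (1 + x) ^ j * (1 + x) ^ (k - j)" by (simp add: power_add[symmetric])
      then have "p ^ (2 * j) * q ^ (2 * (k - j)) * (1 + x) ^ k = x ^ j"
        using x by (simp add: power_mult p2 power_divide)
      then show "of_nat (k choose j) ^ 2 * of_real (p ^ (2 * j) * q ^ (2 * (k - j)) * (1 + x) ^ k) * I j = of_nat (k choose j) ^ 2 * of_real (x ^ j) * I j"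
        by simp
    qed
    also have "of_real ((1 + x) ^ k) = (\<Sum>j\<le>k. of_nat (k choose j) * of_real x ^ j :: complex)"
    proof -
      have "(of_real x + 1 :: complex) ^ k = (\<Sum>j\<le>k. of_nat (k choose j) * of_real x ^ j * 1 ^ (k - j))" by (rule binomial_ring)
      then show ?thesis by (simp add: add.commute)
    qed
    finally have eq: "m * (\<Sum>j\<le>k. of_nat (k choose j) * of_real x ^ j) = (\<Sum>j\<le>k. of_nat (k choose j) ^ 2 * of_real (x ^ j) * I j)" .
    have "(\<Sum>j\<le>k. (of_nat (k choose j) ^ 2 * I j - m * of_nat (k choose j)) * of_real x ^ j) =
      (\<Sum>j\<le>k. of_nat (k choose j) ^ 2 * of_real (x ^ j) * I j) - m * (\<Sum>j\<le>k. of_nat (k choose j) * of_real x ^ j)"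
      unfolding sum_distrib_left sum_subtractf[symmetric] by (intro sum.cong refl) (simp add: algebra_simps)
    then show ?thesis using eq by simp
  qed
  \<comment> \<open>A polynomial with infinitely many roots has vanishing coefficients.\<close>
  have coef: "of_nat (k choose j) * I j = m" if j: "j \<le> k" for j
  proof -
    have "of_real ` {0<..} \<subseteq> {z::complex. (\<Sum>j\<le>k. (of_nat (k choose j) ^ 2 * I j - m * of_nat (k choose j)) * z ^ j) = 0}"
      using zero by auto
    moreover have "infinite (complex_of_real ` {0<..})"
      by (subst finite_image_iff) (auto simp: inj_on_def infinite_Ioi)
    ultimately have "infinite {z::complex. (\<Sum>j\<le>k. (of_nat (k choose j) ^ 2 * I j - m * of_nat (k choose j)) * z ^ j) = 0}"
      using finite_subset by blast
    then have "of_nat (k choose j) ^ 2 * I j - m * of_nat (k choose j) = 0"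
      unfolding polyfun_finite_roots using j by blast
    then have "of_nat (k choose j) * (of_nat (k choose j) * I j - m) = 0" by (simp add: power2_eq_square algebra_simps)
    then show ?thesis using j by simp
  qed
  \<comment> \<open>On the sphere 1 = (|z_1|^2 + |z_2|^2)^k, and the k + 1 terms of the expansion
    have the same mean \<open>m\<close>; this fixes m = 1/(k + 1).\<close>
  have "1 = sphere_mean (\<lambda>x::real^4. 1::complex)" by simp
  also have "\<dots> = sphere_mean (\<lambda>x. \<Sum>j\<le>k. of_nat (k choose j) * cmon j j (k - j) (k - j) x)"
  proof (rule sphere_mean_cong)
    fix x :: "real^4" assume "x \<in> sphere 0 1"
    then have "(cmod (zl x))\<^sup>2 + (cmod (zr x))\<^sup>2 = 1" using norm_sq_vec4[of x] by simp
    then have "complex_of_real ((cmod (zl x))\<^sup>2 + (cmod (zr x))\<^sup>2) = 1" by simp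
    then have "zl x * cnj (zl x) + zr x * cnj (zr x) = 1" by (simp only: of_real_add complex_norm_square)
    then have "1 = (zl x * cnj (zl x) + zr x * cnj (zr x)) ^ k" by simp
    also have "\<dots> = (\<Sum>j\<le>k. of_nat (k choose j) * cmon j j (k - j) (k - j) x)"
      by (simp add: binomial_ring cmon_def power_mult_distrib mult_ac)
    finally show "1 = (\<Sum>j\<le>k. of_nat (k choose j) * cmon j j (k - j) (k - j) x)" .
  qed
  also have "\<dots> = (\<Sum>j\<le>k. of_nat (k choose j) * I j)"
    by (subst sphere_mean_sum; (intro finite_atMost continuous_intros)?) (simp add: sphere_mean_mult I_def)
  also have "\<dots> = of_nat (k + 1) * m" by (simp add: coef)
  finally have m1: "1 = of_nat (k + 1) * m" .
  have "of_nat (k + 1) \<noteq> (0 :: complex)" by (simp only: of_nat_eq_0_iff)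
  then have "m = 1 / of_nat (k + 1)" using m1 by (metis mult.commute nonzero_eq_divide_eq)
  then have "of_nat (k choose a) * I a = 1 / of_nat (k + 1)" using coef[of a] by (simp add: k_def)
  moreover have "of_nat (k choose a) = (fact k / (fact a * fact c) :: complex)"
    by (simp add: binomial_fact k_def)
  moreover have "(fact (a + c + 1) :: complex) = of_nat (k + 1) * fact k" by (simp add: k_def)
  ultimately have "I a = fact a * fact c / fact (a + c + 1)"
    by (simp add: field_simps del: of_nat_Suc of_nat_add)
  then show ?thesis by (simp add: I_def k_def)
qed

section \<open>Quadrature by torus knots\<close>

definition torus_pt :: "real \<Rightarrow> nat \<Rightarrow> nat \<Rightarrow> nat \<Rightarrow> nat \<Rightarrow> real^4" where
  "torus_pt \<eta> p q N r = mk4 (of_real (cos \<eta>) * cis (2 * pi * real (p * r) / real N)) (of_real (sin \<eta>) * cis (2 * pi * real (q * r) / real N))"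

lemma torus_pt_sphere: "torus_pt \<eta> p q N r \<in> sphere 0 1"
proof -
  have "(norm (torus_pt \<eta> p q N r))\<^sup>2 = 1"
    by (simp add: norm_sq_vec4 torus_pt_def norm_mult)
  then show ?thesis by (simp add: power2_eq_1_iff) (smt (verit) norm_ge_zero)
qed

lemma torus_pt_rotate: "torus_pt \<eta> p q N (r + i) = rot (cis (2 * pi * real (p * r) / real N)) (cis (2 * pi * real (q * r) / real N)) (torus_pt \<eta> p q N i)"
  by (rule vec4_eqI) (simp_all add: torus_pt_def rot_def cis_mult distrib_left add_divide_distrib mult.left_commute)

text \<open>Refining the sampling by an integer factor keeps the old samples, so that one fixed node
  set lies on all finer polygons.\<close>

lemma torus_pt_scale: "0 < \<kappa> \<Longrightarrow> torus_pt \<eta> p q (N * \<kappa>) (r * \<kappa>) = torus_pt \<eta> p q N r"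
proof -
  assume "0 < \<kappa>"
  then have "2 * pi * real (p * (r * \<kappa>)) / real (N * \<kappa>) = 2 * pi * real (p * r) / real N" for p
    by (simp add: mult.assoc[symmetric])
  then show ?thesis by (simp only: torus_pt_def)
qed

lemma cis_int_period: "cis (2 * pi * of_int m) = 1"
  by (simp add: complex_eq_iff)

lemma torus_pt_period: "0 < N \<Longrightarrow> torus_pt \<eta> p q N N = torus_pt \<eta> p q N 0"
proof -
  assume "0 < N"
  then have "2 * pi * real (p * N) / real N = 2 * pi * of_int (int p)" for p by simp
  then have "cis (2 * pi * real (p * N) / real N) = 1" for p by (simp only: cis_int_period)
  then show ?thesis by (simp add: torus_pt_def del: of_nat_mult)
qed

lemma sum_roots_of_unity:
  assumes N: "0 < N" and m: "\<not> int N dvd m"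
  shows "(\<Sum>r<N. cis (2 * pi * of_int m * real r / real N)) = 0"
proof -
  define w where "w = cis (2 * pi * of_int m / real N)"
  have pw: "cis (2 * pi * of_int m * real r / real N) = w ^ r" for r
    by (simp add: w_def Complex.DeMoivre mult_ac)
  have "w ^ N = 1"
    using N cis_int_period[of m] by (simp add: w_def Complex.DeMoivre)
  moreover have "w \<noteq> 1"
  proof
    assume "w = 1"
    then have "exp (\<i> * complex_of_real (2 * pi * of_int m / real N)) = 1" by (simp add: w_def cis_conv_exp)
    then obtain n :: int where "2 * pi * of_int m / real N = of_int (2 * n) * pi" unfolding exp_eq_1 by auto
    then have "of_int m = real_of_int (n * int N)" using N by (simp add: field_simps)
    then have "m = n * int N" by (simp only: of_int_eq_iff)
    then show False using m by simp
  qed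
  ultimately have "(\<Sum>r<N. w ^ r) = 0" using sum_gp_strict[of w N] by simp
  then show ?thesis by (simp add: pw)
qed

definition orbit_mean :: "real \<Rightarrow> nat \<Rightarrow> nat \<Rightarrow> nat \<Rightarrow> (real^4 \<Rightarrow> 'b::real_normed_field) \<Rightarrow> 'b" where
  "orbit_mean \<eta> p q N F = (\<Sum>r<N. F (torus_pt \<eta> p q N r)) / of_nat N"

text \<open>On the samples the monomial is a constant times a character of Z/N with frequency p(a -
  b) + q(c - d), and a nontrivial character has sum 0.\<close>

lemma orbit_mean_cmon:
  assumes N: "0 < N" and res: "\<not> (a = b \<and> c = d) \<Longrightarrow> \<not> int N dvd int p * (int a - int b) + int q * (int c - int d)"
  shows "orbit_mean \<eta> p q N (cmon a b c d) = (if a = b \<and> c = d then of_real ((cos \<eta>)\<^sup>2 ^ a * (sin \<eta>)\<^sup>2 ^ c) else 0)"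
proof -
  define m where "m = int p * (int a - int b) + int q * (int c - int d)"
  have val: "cmon a b c d (torus_pt \<eta> p q N r) = of_real (cos \<eta> ^ (a + b) * sin \<eta> ^ (c + d)) * cis (2 * pi * of_int m * real r / real N)" for r
  proof -
    let ?u = "2 * pi * real (p * r) / real N" and ?v = "2 * pi * real (q * r) / real N"
    have "cmon a b c d (torus_pt \<eta> p q N r) = of_real (cos \<eta> ^ (a + b) * sin \<eta> ^ (c + d)) *
       ((cis ?u ^ a * cnj (cis ?u) ^ b) * (cis ?v ^ c * cnj (cis ?v) ^ d))"
      by (simp add: cmon_def torus_pt_def power_mult_distrib power_add mult_ac)
    also have "(cis ?u ^ a * cnj (cis ?u) ^ b) * (cis ?v ^ c * cnj (cis ?v) ^ d) = cis ((real a - real b) * ?u + (real c - real d) * ?v)"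
      unfolding cis_power_cnj cis_mult ..
    also have "(real a - real b) * ?u + (real c - real d) * ?v = 2 * pi * of_int m * real r / real N"
      by (simp add: m_def algebra_simps add_divide_distrib diff_divide_distrib)
    finally show ?thesis .
  qed
  have "orbit_mean \<eta> p q N (cmon a b c d) = of_real (cos \<eta> ^ (a + b) * sin \<eta> ^ (c + d)) * (\<Sum>r<N. cis (2 * pi * of_int m * real r / real N)) / of_nat N"
    by (simp only: orbit_mean_def val sum_distrib_left)
  also have "\<dots> = (if a = b \<and> c = d then of_real ((cos \<eta>)\<^sup>2 ^ a * (sin \<eta>)\<^sup>2 ^ c) else 0)"
  proof (cases "a = b \<and> c = d")
    case True
    then have "m = 0" by (simp add: m_def)
    then show ?thesis using True N by (simp add: mult_2[symmetric] power_mult)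
  next
    case False
    then show ?thesis using sum_roots_of_unity[OF N res[OF False, folded m_def]] by auto
  qed
  finally show ?thesis .
qed

text \<open>Let Q = T + 1. Since |i| < Q, i + Qj = 0 would force j = 0 and then i = 0; and |i + Qj|
  \<le> (Q - 1) + Q(Q - 1) < Q^2 \<le> N.\<close>

lemma nonresonant:
  fixes i j :: int
  assumes ij: "\<bar>i\<bar> + \<bar>j\<bar> \<le> int T" "i \<noteq> 0 \<or> j \<noteq> 0" and N: "(T + 1)\<^sup>2 \<le> N"
  shows "\<not> int N dvd i + int (T + 1) * j"
proof
  define Q where "Q = int T + 1"
  assume d': "int N dvd i + int (T + 1) * j"
  have "int (T + 1) = Q" by (simp add: Q_def)
  with d' have d: "int N dvd i + Q * j" by (simp only:)
  have "int ((T + 1)\<^sup>2) = Q * Q" by (simp add: Q_def power2_eq_square algebra_simps)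
  moreover have "int ((T + 1)\<^sup>2) \<le> int N" by (subst of_nat_le_iff) (rule N)
  ultimately have NQ: "Q * Q \<le> int N" by linarith
  have iQ: "\<bar>i\<bar> \<le> Q - 1" "\<bar>j\<bar> \<le> Q - 1" using ij by (auto simp: Q_def)
  have "i + Q * j \<noteq> 0"
  proof
    assume 0: "i + Q * j = 0"
    show False
    proof (cases "j = 0")
      case False
      then have "Q * 1 \<le> Q * \<bar>j\<bar>" by (intro mult_left_mono) (auto simp: Q_def)
      moreover have "Q * \<bar>j\<bar> = \<bar>i\<bar>"
      proof -
        have "i = - (Q * j)" using 0 by simp
        then show ?thesis by (simp add: abs_mult Q_def)
      qed
      ultimately show False using iQ by linarith
    qed (use 0 ij in auto)
  qed
  then have "int N \<le> \<bar>i + Q * j\<bar>" using zdvd_imp_le[of "int N" "\<bar>i + Q * j\<bar>"] d by simp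
  also have "\<dots> \<le> \<bar>i\<bar> + Q * \<bar>j\<bar>" using abs_triangle_ineq[of i "Q * j"] by (simp add: abs_mult Q_def)
  also have "\<dots> \<le> (Q - 1) + Q * (Q - 1)" using iQ by (intro add_mono mult_left_mono) (auto simp: Q_def)
  also have "\<dots> < Q * Q" by (simp add: algebra_simps)
  finally show False using NQ by linarith
qed

section \<open>The rule on the sphere\<close>

definition node_angle :: "nat \<Rightarrow> nat \<Rightarrow> real" where
  "node_angle J k = real k * pi / (4 * real J)"

text \<open>
  The slope is chosen so that the knot is short where the torus has small weight: its length is comparable to
  \<open>cos \<eta> + (T + 1) sin \<eta>\<close> for \<open>k \<le> J\<close> and to \<open>(T + 1) cos \<eta> + sin \<eta>\<close> otherwise.
\<close>

definition node_p :: "nat \<Rightarrow> nat \<Rightarrow> nat \<Rightarrow> nat" where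
  "node_p J T k = (if k \<le> J then 1 else T + 1)"

definition node_q :: "nat \<Rightarrow> nat \<Rightarrow> nat \<Rightarrow> nat" where
  "node_q J T k = (if k \<le> J then T + 1 else 1)"

definition node_pt :: "nat \<Rightarrow> nat \<Rightarrow> nat \<Rightarrow> nat \<Rightarrow> nat \<Rightarrow> real^4" where
  "node_pt J T k = torus_pt (node_angle J k) (node_p J T k) (node_q J T k)"

definition node_mean :: "nat \<Rightarrow> nat \<Rightarrow> nat \<Rightarrow> nat \<Rightarrow> (real^4 \<Rightarrow> 'b::real_normed_field) \<Rightarrow> 'b" where
  "node_mean J T k = orbit_mean (node_angle J k) (node_p J T k) (node_q J T k)"

text \<open>At k = 0 the sine in \<open>quad_weight\<close> is 0. The weight \<open>B\<close> placed
  there cancels the term - B f(0) of the functional, so the whole rule is \<open>A\<close> times the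
  mean.\<close>

definition node_weight :: "real \<Rightarrow> real \<Rightarrow> nat \<Rightarrow> nat \<Rightarrow> real" where
  "node_weight A B J k = (if k = 0 then B else quad_weight A B J k)"

lemma node_mean_cmon:
  assumes deg: "a + b + c + d \<le> T" and N: "(T + 1)\<^sup>2 \<le> N"
  shows "node_mean J T k N (cmon a b c d) =
    (if a = b \<and> c = d then of_real (((1 + cos (2 * node_angle J k)) / 2) ^ a * ((1 - cos (2 * node_angle J k)) / 2) ^ c) else 0)"
proof -
  have N0: "0 < N" using N zero_less_power[of "T + 1" 2] by linarith
  have res: "\<not> int N dvd int (node_p J T k) * (int a - int b) + int (node_q J T k) * (int c - int d)"
    if ne: "\<not> (a = b \<and> c = d)"
  proof (cases "k \<le> J")
    case True
    have "\<not> int N dvd (int a - int b) + int (T + 1) * (int c - int d)"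
      by (rule nonresonant[OF _ _ N]) (use deg ne in auto)
    then show ?thesis using True by (simp add: node_p_def node_q_def)
  next
    case False
    have "\<not> int N dvd (int c - int d) + int (T + 1) * (int a - int b)"
      by (rule nonresonant[OF _ _ N]) (use deg ne in auto)
    then show ?thesis using False by (simp add: node_p_def node_q_def add.commute)
  qed
  have c: "(cos x)\<^sup>2 = (1 + cos (2 * x)) / 2" for x :: real unfolding cos_double_cos by simp
  have s: "(sin x)\<^sup>2 = (1 - cos (2 * x)) / 2" for x :: real unfolding cos_double_sin by simp
  show ?thesis
    using orbit_mean_cmon[OF N0 res, of "node_angle J k"] unfolding node_mean_def c s .
qed

text \<open>Off-diagonal monomials have mean 0 on every knot and on the sphere. Diagonal ones reduce
  to the rule in one variable; they satisfy a + c \<le> T/2, so T + 2 < 4J gives a + c + 1 <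
  2J.\<close>

lemma node_quadrature_cpoly:
  assumes F: "cpoly n F" and n: "n \<le> T" and T: "T + 2 < 4 * J" and N: "(T + 1)\<^sup>2 \<le> N"
  shows "(\<Sum>k<2 * J. of_real (node_weight A B J k) * node_mean J T k N F) = of_real A * sphere_mean F"
  using F n
proof (induction rule: cpoly.induct)
  case (mon a b c d n \<kappa>)
  have lin: "node_mean J T k N (\<lambda>x. \<kappa> * cmon a b c d x) = \<kappa> * node_mean J T k N (cmon a b c d)" for k
    by (simp add: node_mean_def orbit_mean_def sum_distrib_left)
  have deg: "a + b + c + d \<le> T" using mon by simp
  have "(\<Sum>k<2 * J. of_real (node_weight A B J k) * node_mean J T k N (cmon a b c d)) = of_real A * sphere_mean (cmon a b c d)"
  proof (cases "a = b \<and> c = d")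
    case False
    then show ?thesis using sphere_mean_cmon_off_diagonal[of a b c d] by (auto simp: node_mean_cmon[OF deg N])
  next
    case True
    define u where "u k = ((1 + cos (2 * node_angle J k)) / 2) ^ a * ((1 - cos (2 * node_angle J k)) / 2) ^ c" for k
    have J0: "0 < J" using T by linarith
    have ang: "2 * node_angle J k = real k * pi / real (2 * J)" for k by (simp add: node_angle_def)
    have "a + c + 1 < 2 * J" using deg True T by linarith
    from quadrature_rule[OF this, of A B]
    have Q: "(\<Sum>k<2 * J. quad_weight A B J k * u k) = A * (fact a * fact c / fact (a + c + 1)) - B * (if c = 0 then 1 else 0)"
      by (simp only: u_def ang)
    have "(\<Sum>k<2 * J. node_weight A B J k * u k) = (\<Sum>k<2 * J. quad_weight A B J k * u k + (if k = 0 then B * u 0 else 0))"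
      by (intro sum.cong refl) (simp add: node_weight_def quad_weight_def)
    also have "\<dots> = (\<Sum>k<2 * J. quad_weight A B J k * u k) + B * u 0"
      using J0 by (simp add: sum.distrib)
    also have "u 0 = (if c = 0 then 1 else 0)" by (simp add: u_def node_angle_def)
    finally have "(\<Sum>k<2 * J. node_weight A B J k * u k) = A * (fact a * fact c / fact (a + c + 1))" using Q by simp
    then have "of_real (\<Sum>k<2 * J. node_weight A B J k * u k) = (of_real (A * (fact a * fact c / fact (a + c + 1))) :: complex)"
      by (simp only:)
    moreover have "node_mean J T k N (cmon a b c d) = of_real (u k)" for k
      unfolding node_mean_cmon[OF deg N] u_def using True by simp
    moreover have "sphere_mean (cmon a b c d) = of_real (fact a * fact c / fact (a + c + 1))"
      using True sphere_mean_cmon_diagonal[of a c] by simp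
    ultimately show ?thesis by simp
  qed
  then show ?case
    unfolding lin sphere_mean_mult mult.left_commute[of _ \<kappa>] sum_distrib_left[symmetric] by simp
next
  case (add n F G)
  have "node_mean J T k N (\<lambda>x. F x + G x) = node_mean J T k N F + node_mean J T k N G" for k
    by (simp add: node_mean_def orbit_mean_def sum.distrib add_divide_distrib)
  then show ?case
    using add by (simp add: sphere_mean_add[OF cpoly_continuous cpoly_continuous] distrib_left sum.distrib)
qed

theorem node_quadrature:
  fixes f :: "real^4 \<Rightarrow> real"
  assumes f: "pdeg T f" and T: "T + 2 < 4 * J" and N: "(T + 1)\<^sup>2 \<le> N"
  shows "(\<Sum>k<2 * J. node_weight A B J k * node_mean J T k N f) = A * sphere_mean f"
proof -
  have "node_mean J T k N (\<lambda>x. complex_of_real (f x)) = of_real (node_mean J T k N f)" for k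
    by (simp add: node_mean_def orbit_mean_def)
  then have "of_real (\<Sum>k<2 * J. node_weight A B J k * node_mean J T k N f) = complex_of_real (A * sphere_mean f)"
    using node_quadrature_cpoly[OF pdeg_imp_cpoly[OF f] order_refl T N, of A B] by (simp add: sphere_mean_of_real)
  then show ?thesis by (simp only: of_real_eq_iff)
qed

text \<open>Only the torus-invariant terms survive, and their value does not involve the number of
  samples. So point masses may sit on a coarse sampling while arc length is taken along a fine
  one.\<close>

lemma node_mean_eq:
  fixes f :: "real^4 \<Rightarrow> real"
  assumes f: "pdeg T f" and N: "(T + 1)\<^sup>2 \<le> N" "(T + 1)\<^sup>2 \<le> N'"
  shows "node_mean J T k N f = node_mean J T k N' f"
proof -
  have "node_mean J T k N F = node_mean J T k N' F" if "cpoly n F" "n \<le> T" for n F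
    using that
  proof (induction rule: cpoly.induct)
    case (mon a b c d n \<kappa>)
    have lin: "node_mean J T k N (\<lambda>x. \<kappa> * cmon a b c d x) = \<kappa> * node_mean J T k N (cmon a b c d)" for N
      by (simp add: node_mean_def orbit_mean_def sum_distrib_left)
    have deg: "a + b + c + d \<le> T" using mon by simp
    show ?case unfolding lin node_mean_cmon[OF deg N(1)] node_mean_cmon[OF deg N(2)] ..
  next
    case (add n F G)
    have "node_mean J T k N (\<lambda>x. F x + G x) = node_mean J T k N F + node_mean J T k N G" for N
      by (simp add: node_mean_def orbit_mean_def sum.distrib add_divide_distrib)
    then show ?case using add by simp
  qed
  from this[OF pdeg_imp_cpoly[OF f] order_refl]
  have "complex_of_real (node_mean J T k N f) = of_real (node_mean J T k N' f)"
    by (simp add: node_mean_def orbit_mean_def)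
  then show ?thesis by (simp only: of_real_eq_iff)
qed

section \<open>Closed walks and interpolation\<close>

text \<open>A Riemann sum for the line integral of \<open>f\<close> along a geodesic polygon, with
  \<open>f\<close> evaluated at the first vertex of each edge.\<close>

fun walk_sum :: "('a::euclidean_space \<Rightarrow> real) \<Rightarrow> 'a list \<Rightarrow> real" where
  "walk_sum f (x # y # zs) = arc_len x y * f x + walk_sum f (y # zs)"
| "walk_sum f _ = 0"

lemma walk_sum_append: "walk_sum f (xs @ y # zs) = walk_sum f (xs @ [y]) + walk_sum f (y # zs)"
proof (induction xs)
  case (Cons x xs)
  then show ?case by (cases xs) auto
qed simp

lemma walk_sum_map:
  "walk_sum f (map x [0..<Suc n]) = (\<Sum>i<n. arc_len (x i) (x (Suc i)) * f (x i))"
proof (induction n)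
  case (Suc n)
  have "map x [0..<Suc (Suc n)] = map x [0..<n] @ x n # [x (Suc n)]" by simp
  then have "walk_sum f (map x [0..<Suc (Suc n)]) = walk_sum f (map x [0..<n] @ [x n]) + walk_sum f [x n, x (Suc n)]"
    by (simp only: walk_sum_append[of f "map x [0..<n]" "x n" "[x (Suc n)]"])
  then show ?case using Suc by simp
qed simp

abbreviation steps :: "real \<Rightarrow> 'a::euclidean_space list \<Rightarrow> bool" where
  "steps \<epsilon> \<equiv> successively (\<lambda>x y. norm (x - y) \<le> \<epsilon>)"

lemma steps_append: "steps \<epsilon> (xs @ y # zs) \<longleftrightarrow> steps \<epsilon> (xs @ [y]) \<and> steps \<epsilon> (y # zs)"
  by (auto simp: successively_append_iff)

text \<open>A walk is remembered through its vertex set and its Riemann sum functional only: joining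
  two walks at a vertex adds the functionals, and a change of base point keeps them. Repeated
  vertices are allowed; the later perturbation separates them.\<close>

definition closed_walk :: "real \<Rightarrow> 'a::euclidean_space \<Rightarrow> 'a set \<Rightarrow> (('a \<Rightarrow> real) \<Rightarrow> real) \<Rightarrow> bool" where
  "closed_walk \<epsilon> p X \<Phi> \<longleftrightarrow> (\<exists>xs. 4 \<le> length xs \<and> hd xs = p \<and> set xs = X \<and> steps \<epsilon> (xs @ [p]) \<and> (\<forall>f. walk_sum f (xs @ [p]) = \<Phi> f))"

lemma closed_walkE:
  assumes "closed_walk \<epsilon> p X \<Phi>"
  obtains xs where "4 \<le> length xs" "hd xs = p" "set xs = X" "steps \<epsilon> (xs @ [p])" "\<forall>f. walk_sum f (xs @ [p]) = \<Phi> f"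
  using assms unfolding closed_walk_def by (elim exE conjE)

lemma closed_walk_compose:
  assumes "closed_walk \<epsilon> p X \<Phi>" "closed_walk \<epsilon> p Y \<Psi>"
  shows "closed_walk \<epsilon> p (X \<union> Y) (\<lambda>f. \<Phi> f + \<Psi> f)"
proof -
  obtain xs where xs: "4 \<le> length xs" "hd xs = p" "set xs = X" "steps \<epsilon> (xs @ [p])" "\<forall>f. walk_sum f (xs @ [p]) = \<Phi> f"
    using assms(1) by (rule closed_walkE)
  obtain ys where ys: "4 \<le> length ys" "hd ys = p" "set ys = Y" "steps \<epsilon> (ys @ [p])" "\<forall>f. walk_sum f (ys @ [p]) = \<Psi> f"
    using assms(2) by (rule closed_walkE)
  obtain zs where zs: "ys = p # zs" using ys by (cases ys) auto
  have e: "(xs @ ys) @ [p] = xs @ p # (zs @ [p])" by (simp add: zs)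
  have e': "ys @ [p] = p # (zs @ [p])" by (simp add: zs)
  have "walk_sum f ((xs @ ys) @ [p]) = \<Phi> f + \<Psi> f" for f
  proof -
    have "walk_sum f ((xs @ ys) @ [p]) = walk_sum f (xs @ [p]) + walk_sum f (p # (zs @ [p]))"
      unfolding e by (rule walk_sum_append)
    then show ?thesis using xs(5)[rule_format, of f] ys(5)[rule_format, of f, unfolded e'] by simp
  qed
  moreover have "steps \<epsilon> ((xs @ ys) @ [p])"
    unfolding e steps_append[of \<epsilon> xs p "zs @ [p]"] using xs(4) ys(4)[unfolded e'] ..
  moreover have "hd (xs @ ys) = p" using xs by (cases xs) auto
  ultimately show ?thesis unfolding closed_walk_def
    using xs ys by (intro exI[of _ "xs @ ys"]) auto
qed

lemma closed_walk_rebase: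
  assumes "closed_walk \<epsilon> p X \<Phi>" "q \<in> X"
  shows "closed_walk \<epsilon> q X \<Phi>"
proof -
  obtain xs where xs: "4 \<le> length xs" "hd xs = p" "set xs = X" "steps \<epsilon> (xs @ [p])" "\<forall>f. walk_sum f (xs @ [p]) = \<Phi> f"
    using assms(1) by (rule closed_walkE)
  have "q \<in> set xs" using assms(2) xs(3) by simp
  then obtain as bs where q: "xs = as @ q # bs" by (elim split_list[THEN exE] exE)
  show ?thesis
  proof (cases as)
    case Nil
    then show ?thesis using assms xs q by auto
  next
    case (Cons a as')
    then have as: "as = p # as'" using xs(2) q by simp
    have e: "xs @ [p] = as @ q # (bs @ [p])" using q by simp
    have e': "(q # bs @ as) @ [q] = (q # bs) @ p # (as' @ [q])" using as by simp
    have e2: "as @ [q] = p # (as' @ [q])" "q # (bs @ [p]) = (q # bs) @ [p]" using as by auto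
    have "walk_sum f ((q # bs @ as) @ [q]) = \<Phi> f" for f
    proof -
      have "walk_sum f ((q # bs @ as) @ [q]) = walk_sum f ((q # bs) @ [p]) + walk_sum f (p # (as' @ [q]))"
        unfolding e' by (rule walk_sum_append)
      moreover have "walk_sum f (xs @ [p]) = walk_sum f (as @ [q]) + walk_sum f (q # (bs @ [p]))"
        unfolding e by (rule walk_sum_append)
      ultimately show ?thesis using xs(5)[rule_format, of f] unfolding e2 by linarith
    qed
    moreover have "steps \<epsilon> ((q # bs @ as) @ [q])"
    proof -
      have "steps \<epsilon> (as @ [q]) \<and> steps \<epsilon> (q # (bs @ [p]))" using xs(4) unfolding e steps_append[of \<epsilon> as q "bs @ [p]"] .
      then show ?thesis unfolding e' steps_append[of \<epsilon> "q # bs" p "as' @ [q]"] e2 by blast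
    qed
    ultimately show ?thesis unfolding closed_walk_def
      using xs q by (intro exI[of _ "q # bs @ as"]) auto
  qed
qed

text \<open>The first walk is rotated to start at \<open>q\<close>, the second is traversed from
  there, and the result is rotated back to \<open>p\<close>.\<close>

lemma closed_walk_attach:
  assumes "closed_walk \<epsilon> p X \<Phi>" "q \<in> X" "closed_walk \<epsilon> q Y \<Psi>"
  shows "closed_walk \<epsilon> p (X \<union> Y) (\<lambda>f. \<Phi> f + \<Psi> f)"
proof -
  have "p \<in> X" by (rule closed_walkE[OF assms(1)]) (metis hd_in_set list.size(3) not_numeral_le_zero)
  then show ?thesis
    by (intro closed_walk_rebase[OF closed_walk_compose[OF closed_walk_rebase[OF assms(1,2)] assms(3)]]) simp
qed

lemma closed_walk_attach_family:
  assumes "closed_walk \<epsilon> p X \<Phi>" "finite K" "\<And>k. k \<in> K \<Longrightarrow> q k \<in> X" "\<And>k. k \<in> K \<Longrightarrow> closed_walk \<epsilon> (q k) (Y k) (\<Psi> k)"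
  shows "closed_walk \<epsilon> p (X \<union> (\<Union>k\<in>K. Y k)) (\<lambda>f. \<Phi> f + (\<Sum>k\<in>K. \<Psi> k f))"
  using assms(2-4)
proof (induction K rule: finite_induct)
  case empty
  then show ?case using assms(1) by simp
next
  case (insert k K)
  have "closed_walk \<epsilon> p ((X \<union> (\<Union>k\<in>K. Y k)) \<union> Y k) (\<lambda>f. (\<Phi> f + (\<Sum>k\<in>K. \<Psi> k f)) + \<Psi> k f)"
    by (rule closed_walk_attach[OF insert.IH, of "q k"]) (use insert.prems in auto)
  moreover have "X \<union> (\<Union>k\<in>K. Y k) \<union> Y k = X \<union> (\<Union>k\<in>insert k K. Y k)" by auto
  ultimately show ?case using insert.hyps by (simp add: add_ac)
qed

lemma closed_walk_loop:
  assumes N: "4 \<le> N" and cl: "x N = x 0" and st: "\<And>r. r < N \<Longrightarrow> norm (x r - x (Suc r)) \<le> \<epsilon>"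
  shows "closed_walk \<epsilon> (x 0) (x ` {..<N}) (\<lambda>f. \<Sum>r<N. arc_len (x r) (x (Suc r)) * f (x r))"
  unfolding closed_walk_def
proof (intro exI[of _ "map x [0..<N]"] conjI allI)
  have e: "map x [0..<N] @ [x 0] = map x [0..<Suc N]" using cl by simp
  show "walk_sum f (map x [0..<N] @ [x 0]) = (\<Sum>r<N. arc_len (x r) (x (Suc r)) * f (x r))" for f
    unfolding e by (rule walk_sum_map)
  show "steps \<epsilon> (map x [0..<N] @ [x 0])"
    unfolding e successively_conv_nth using st by (simp del: upt_Suc)
qed (use N in \<open>auto simp: hd_map atLeast0LessThan\<close>)

lemma closed_walk_periodic:
  assumes "closed_walk \<epsilon> p X \<Phi>" "0 \<le> \<epsilon>"
  shows "\<exists>(M::nat) x. 4 \<le> M \<and> (\<forall>i. x (i + M) = x i) \<and> (\<forall>i. x i \<in> X) \<and> X = x ` {..<M} \<and>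
     (\<forall>i. norm (x i - x (i + 1)) \<le> \<epsilon>) \<and> (\<forall>f. (\<Sum>i<M. arc_len (x i) (x (i + 1)) * f (x i)) = \<Phi> f)"
proof -
  obtain xs where xs: "4 \<le> length xs" "hd xs = p" "set xs = X" "steps \<epsilon> (xs @ [p])" "\<forall>f. walk_sum f (xs @ [p]) = \<Phi> f"
    using assms(1) by (rule closed_walkE)
  define M where "M = length xs"
  define x where "x i = xs ! (i mod M)" for i
  have M: "0 < M" "4 \<le> M" using xs(1) by (auto simp: M_def)
  have e: "xs @ [p] = map x [0..<Suc M]"
  proof (rule nth_equalityI)
    fix i assume i: "i < length (xs @ [p])"
    have "xs ! 0 = p" using xs(1,2) by (cases xs) auto
    then show "(xs @ [p]) ! i = map x [0..<Suc M] ! i"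
      using i by (cases "i = M") (auto simp: x_def M_def nth_append simp del: upt_Suc)
  qed (simp add: M_def)
  have im: "x ` {..<M} = X"
  proof -
    have "x ` {..<M} = (\<lambda>i. xs ! i) ` {..<M}" by (intro image_cong) (auto simp: x_def)
    then show ?thesis using xs(3) by (auto simp: M_def set_conv_nth)
  qed
  have per: "x (i + M) = x i" for i by (simp add: x_def)
  have st: "norm (x i - x (Suc i)) \<le> \<epsilon>" if "i < M" for i
    using xs(4) that unfolding e successively_conv_nth by (simp del: upt_Suc)
  have "norm (x i - x (i + 1)) \<le> \<epsilon>" for i
  proof -
    have "x i = x (i mod M)" "x (i + 1) = x (Suc (i mod M))" by (simp_all add: x_def mod_Suc_eq)
    then show ?thesis using st[of "i mod M"] M by simp
  qed
  moreover have "x i \<in> X" for i using M by (auto simp: x_def xs(3)[symmetric] M_def)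
  moreover have "(\<Sum>i<M. arc_len (x i) (x (i + 1)) * f (x i)) = \<Phi> f" for f
    using xs(5)[rule_format, of f] unfolding e walk_sum_map by simp
  ultimately show ?thesis using M per im by (intro exI[of _ M] exI[of _ x] conjI allI) (simp_all add: im)
qed

section \<open>Interpolation in finite-dimensional function spaces\<close>

definition function_span :: "'b set \<Rightarrow> ('b \<Rightarrow> 'a \<Rightarrow> real) \<Rightarrow> ('a \<Rightarrow> real) set" where
  "function_span A e = {f. \<exists>c. f = (\<lambda>x. \<Sum>\<alpha>\<in>A. c \<alpha> * e \<alpha> x)}"

lemma function_spanD: "f \<in> function_span A e \<Longrightarrow> \<exists>c. f = (\<lambda>x. \<Sum>\<alpha>\<in>A. c \<alpha> * e \<alpha> x)"
  by (simp add: function_span_def)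

lemma function_span_add: "f \<in> function_span A e \<Longrightarrow> g \<in> function_span A e \<Longrightarrow> (\<lambda>x. f x + g x) \<in> function_span A e"
  unfolding function_span_def
  by (clarify, rule_tac x="\<lambda>\<alpha>. c \<alpha> + ca \<alpha>" in exI) (simp add: distrib_right sum.distrib)

lemma function_span_sum_in: "(\<lambda>x. \<Sum>\<alpha>\<in>A. c \<alpha> * e \<alpha> x) \<in> function_span A e"
  unfolding function_span_def mem_Collect_eq by (rule exI, rule refl)

lemma function_span_scale: "f \<in> function_span A e \<Longrightarrow> (\<lambda>x. k * f x) \<in> function_span A e"
  unfolding function_span_def
  by (clarify, rule_tac x="\<lambda>\<alpha>. k * c \<alpha>" in exI) (simp add: sum_distrib_left mult_ac)

lemma function_span_sum:
  "finite I \<Longrightarrow> (\<And>i. i \<in> I \<Longrightarrow> f i \<in> function_span A e) \<Longrightarrow> (\<lambda>x. \<Sum>i\<in>I. f i x) \<in> function_span A e"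
proof (induction I rule: finite_induct)
  case empty
  show ?case unfolding function_span_def by (simp, rule exI[of _ "\<lambda>_. 0"]) simp
qed (simp add: function_span_add)

lemma function_span_base: "finite A \<Longrightarrow> \<alpha> \<in> A \<Longrightarrow> e \<alpha> \<in> function_span A e"
  unfolding function_span_def
  by (simp, rule exI[of _ "\<lambda>\<beta>. if \<beta> = \<alpha> then 1 else 0"]) (simp add: if_distrib[of "\<lambda>x. x * _"] cong: if_cong)

lemma function_span_mono:
  assumes "f \<in> function_span A e" "A \<subseteq> A'" "finite A'" shows "f \<in> function_span A' e"
proof -
  obtain c where c: "f = (\<lambda>x. \<Sum>\<alpha>\<in>A. c \<alpha> * e \<alpha> x)" using assms(1) by (auto simp: function_span_def)
  have "f = (\<lambda>x. \<Sum>\<alpha>\<in>A'. (if \<alpha> \<in> A then c \<alpha> else 0) * e \<alpha> x)"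
    unfolding c by (intro ext sum.mono_neutral_cong_left) (use assms in auto)
  then show ?thesis by (auto simp: function_span_def)
qed

text \<open>A new generator minus its interpolant, \<open>e'\<close>, vanishes on \<open>Y\<close>.
  If it vanishes on all of \<open>S\<close>, the old basis still suffices. Otherwise some
  \<open>z\<close> in \<open>S\<close> with \<open>e' z\<close> \<noteq> 0 joins \<open>Y\<close>:
  \<open>e'\<close> is normalized at \<open>z\<close>, and a multiple of it is subtracted from each
  old basis function to make it vanish there. The representation is claimed on \<open>S\<close>
  only.\<close>

lemma lagrange_basis:
  assumes "finite A"
  shows "\<exists>Y g. Y \<subseteq> S \<and> finite Y \<and> (\<forall>y\<in>Y. g y \<in> function_span A e) \<and>
     (\<forall>y\<in>Y. \<forall>y'\<in>Y. g y y' = (if y = y' then 1 else 0)) \<and>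
     (\<forall>f\<in>function_span A e. \<forall>x\<in>S. f x = (\<Sum>y\<in>Y. f y * g y x))"
  using assms
proof (induction A rule: finite_induct)
  case empty
  show ?case by (intro exI[of _ "{}"] exI[of _ "\<lambda>_ _. 0"]) (simp add: function_span_def)
next
  case (insert \<alpha> A)
  from insert.IH obtain Y g where H: "Y \<subseteq> S \<and> finite Y \<and> (\<forall>y\<in>Y. g y \<in> function_span A e) \<and>
     (\<forall>y\<in>Y. \<forall>y'\<in>Y. g y y' = (if y = y' then 1 else 0)) \<and>
     (\<forall>f\<in>function_span A e. \<forall>x\<in>S. f x = (\<Sum>y\<in>Y. f y * g y x))"
    by (elim exE)
  have Y1: "Y \<subseteq> S" "finite Y" "\<And>y. y \<in> Y \<Longrightarrow> g y \<in> function_span A e" using H by blast+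
  have Y2: "g y y' = (if y = y' then 1 else 0)" if "y \<in> Y" "y' \<in> Y" for y y' using H that by blast
  have Y3: "f x = (\<Sum>y\<in>Y. f y * g y x)" if "f \<in> function_span A e" "x \<in> S" for f x using H that by blast
  note Y = Y1 Y2 Y3
  let ?A = "insert \<alpha> A"
  have finA: "finite ?A" using insert by simp
  have gA: "g y \<in> function_span ?A e" if "y \<in> Y" for y
    by (rule function_span_mono[OF Y(3)[OF that]]) (use insert in auto)
  define e' where "e' x = e \<alpha> x + (\<Sum>y\<in>Y. (- e \<alpha> y) * g y x)" for x
  have e'A: "e' \<in> function_span ?A e" unfolding e'_def[abs_def]
    by (intro function_span_add function_span_base finA function_span_sum Y(2) function_span_scale gA) auto
  have decomp: "\<exists>c f0. f0 \<in> function_span A e \<and> (\<forall>x. f x = c * e \<alpha> x + f0 x)" if f: "f \<in> function_span ?A e" for f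
  proof -
    obtain c where "f = (\<lambda>x. \<Sum>\<beta>\<in>?A. c \<beta> * e \<beta> x)" using function_spanD[OF f] ..
    then have "f x = c \<alpha> * e \<alpha> x + (\<Sum>\<beta>\<in>A. c \<beta> * e \<beta> x)" for x using insert by simp
    then show ?thesis by (intro exI[of _ "c \<alpha>"] exI[of _ "\<lambda>x. \<Sum>\<beta>\<in>A. c \<beta> * e \<beta> x"] conjI allI function_span_sum_in)
  qed
  have rep: "f x = (\<Sum>y\<in>Y. f y * g y x) + c * e' x"
    if "f0 \<in> function_span A e" "\<And>x. f x = c * e \<alpha> x + f0 x" "x \<in> S" for f f0 c x
    unfolding that(2) Y(5)[OF that(1,3)] e'_def
    by (simp add: distrib_left distrib_right right_diff_distrib sum.distrib sum_distrib_left sum_negf mult_ac)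
  have e'Y: "e' y = 0" if "y \<in> Y" for y
  proof -
    have "(\<Sum>z\<in>Y. (- e \<alpha> z) * g z y) = (\<Sum>z\<in>Y. if z = y then - e \<alpha> y else 0)"
      by (intro sum.cong refl) (use Y(4) that in auto)
    then show ?thesis using that Y(2) by (simp add: e'_def)
  qed
  show ?case
  proof (cases "\<forall>x\<in>S. e' x = 0")
    case True
    have "f x = (\<Sum>y\<in>Y. f y * g y x)" if f: "f \<in> function_span ?A e" and x: "x \<in> S" for f x
    proof -
      obtain c f0 where c: "f0 \<in> function_span A e \<and> (\<forall>x. f x = c * e \<alpha> x + f0 x)" using decomp[OF f] by (elim exE)
      show ?thesis using rep[OF conjunct1[OF c] spec[OF conjunct2[OF c]] x] True x by simp
    qed
    then show ?thesis using Y1 Y2 gA by (intro exI[of _ Y] exI[of _ g] conjI ballI) auto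
  next
    case False
    then obtain z where z: "z \<in> S" "e' z \<noteq> 0" by blast
    have zY: "z \<notin> Y" using e'Y z by blast
    define G where "G y x = (if y = z then (1 / e' z) * e' x else g y x + (- g y z / e' z) * e' x)" for y x
    have GA: "G y \<in> function_span ?A e" if "y \<in> insert z Y" for y
    proof (cases "y = z")
      case True
      then have "G y = (\<lambda>x. (1 / e' z) * e' x)" by (simp add: G_def fun_eq_iff)
      then show ?thesis using function_span_scale[OF e'A, of "1 / e' z"] by simp
    next
      case False
      then have "G y = (\<lambda>x. g y x + (- g y z / e' z) * e' x)" by (simp add: G_def fun_eq_iff)
      then show ?thesis using function_span_add[OF gA function_span_scale[OF e'A, of "- g y z / e' z"], of y] False that by simp
    qed
    have Glag: "G y y' = (if y = y' then 1 else 0)" if "y \<in> insert z Y" "y' \<in> insert z Y" for y y'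
      using that z zY e'Y Y(4) by (auto simp: G_def)
    have Grep: "f x = (\<Sum>y\<in>insert z Y. f y * G y x)" if f: "f \<in> function_span ?A e" and x: "x \<in> S" for f x
    proof -
      obtain c f0 where c': "f0 \<in> function_span A e \<and> (\<forall>x. f x = c * e \<alpha> x + f0 x)" using decomp[OF f] by (elim exE)
      note c = conjunct1[OF c'] spec[OF conjunct2[OF c']]
      have fz: "c * e' z = f z - (\<Sum>y\<in>Y. f y * g y z)" using rep[OF c z(1)] by simp
      have "(\<Sum>y\<in>insert z Y. f y * G y x) = f z * ((1 / e' z) * e' x) + (\<Sum>y\<in>Y. f y * (g y x + (- g y z / e' z) * e' x))"
        using zY Y(2) by (simp add: G_def) (intro sum.cong refl, auto)
      also have "\<dots> = (\<Sum>y\<in>Y. f y * g y x) + (f z - (\<Sum>y\<in>Y. f y * g y z)) * (e' x / e' z)"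
      proof -
        have "(\<Sum>y\<in>Y. f y * ((- g y z / e' z) * e' x)) = - ((\<Sum>y\<in>Y. f y * g y z) * (e' x / e' z))"
          unfolding sum_distrib_right sum_negf[symmetric] by (intro sum.cong refl) simp
        then show ?thesis by (simp only: distrib_left sum.distrib) (simp add: left_diff_distrib diff_divide_distrib)
      qed
      also have "\<dots> = (\<Sum>y\<in>Y. f y * g y x) + c * e' x" unfolding fz[symmetric] using z by simp
      also have "\<dots> = f x" using rep[OF c x] by simp
      finally show ?thesis ..
    qed
    show ?thesis
      by (rule exI[of _ "insert z Y"], rule exI[of _ G], intro conjI ballI Glag GA Grep) (use Y1 z in auto)
  qed
qed

section \<open>The design curve\<close>

definition node_len :: "nat \<Rightarrow> nat \<Rightarrow> nat \<Rightarrow> nat \<Rightarrow> real" where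
  "node_len J T k N = arc_len (node_pt J T k N 0) (node_pt J T k N 1)"

text \<open>The knot moves with speeds 2 pi p cos \<eta> and 2 pi q sin \<eta> in its two complex
  coordinates; these are added instead of combined in the Euclidean norm, so 2 pi times the spread
  bounds the length of the knot.\<close>

definition node_spread :: "nat \<Rightarrow> nat \<Rightarrow> nat \<Rightarrow> real" where
  "node_spread J T k = real (node_p J T k) * cos (node_angle J k) + real (node_q J T k) * sin (node_angle J k)"

lemma node_angle_bounds:
  assumes "k < 2 * J" shows "0 \<le> node_angle J k" "node_angle J k \<le> pi / 2"
  using assms by (auto simp: node_angle_def field_simps)

lemma node_spread_bounds:
  assumes "k < 2 * J" shows "0 \<le> node_spread J T k" "node_spread J T k \<le> real T + 2"
proof -
  have cs: "0 \<le> cos (node_angle J k)" "0 \<le> sin (node_angle J k)"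
    using node_angle_bounds[OF assms] pi_gt_zero by (auto intro!: cos_ge_zero sin_ge_zero)
  then show "0 \<le> node_spread J T k" by (simp add: node_spread_def)
  have "node_spread J T k \<le> real (node_p J T k) * 1 + real (node_q J T k) * 1"
    unfolding node_spread_def by (intro add_mono mult_left_mono) auto
  also have "\<dots> = real T + 2" by (simp add: node_p_def node_q_def)
  finally show "node_spread J T k \<le> real T + 2" .
qed

lemma cmod_cis_diff_le: "cmod (1 - cis x) \<le> \<bar>x\<bar>"
proof -
  have "cmod (cis x - 1) = 2 * \<bar>sin (x / 2)\<bar>" using dist_exp_i_1[of x] by (simp add: cis_conv_exp)
  also have "\<dots> \<le> 2 * \<bar>x / 2\<bar>" by (intro mult_left_mono abs_sin_x_le_abs_x) auto
  finally show ?thesis by (simp add: norm_minus_commute)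
qed

text \<open>A shift of the sample index is a rotation of both complex coordinates; hence all edges
  of a knot are congruent and only the first has to be measured.\<close>

lemma node_pt_rotation:
  "\<exists>g. orthogonal_transformation g \<and> node_pt J T k N r = g (node_pt J T k N 0) \<and> node_pt J T k N (Suc r) = g (node_pt J T k N 1)"
  using torus_pt_rotate[of "node_angle J k" "node_p J T k" "node_q J T k" N r 0] torus_pt_rotate[of "node_angle J k" "node_p J T k" "node_q J T k" N r 1]
  unfolding node_pt_def by (metis add_0_right Suc_eq_plus1 norm_cis orthogonal_rot)

lemma node_arc_len: "arc_len (node_pt J T k N r) (node_pt J T k N (Suc r)) = node_len J T k N"
  using node_pt_rotation[of J T k N r] arc_len_orthogonal unfolding node_len_def by metis

lemma node_pt_sphere: "node_pt J T k N r \<in> sphere 0 1"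
  unfolding node_pt_def by (rule torus_pt_sphere)

lemma node_step:
  assumes k: "k < 2 * J" and N: "0 < N"
  shows "norm (node_pt J T k N r - node_pt J T k N (Suc r)) \<le> 2 * pi * node_spread J T k / real N"
proof -
  obtain g where g: "orthogonal_transformation g" "node_pt J T k N r = g (node_pt J T k N 0)" "node_pt J T k N (Suc r) = g (node_pt J T k N 1)"
    using node_pt_rotation by metis
  have "norm (node_pt J T k N r - node_pt J T k N (Suc r)) = norm (node_pt J T k N 0 - node_pt J T k N 1)"
    unfolding g(2,3) linear_diff[OF orthogonal_transformation_linear[OF g(1)], symmetric]
    by (rule orthogonal_transformation_norm[OF g(1)])
  also have "\<dots> \<le> cmod (zl (node_pt J T k N 0 - node_pt J T k N 1)) + cmod (zr (node_pt J T k N 0 - node_pt J T k N 1))"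
  proof (rule power2_le_imp_le)
    show "(norm (node_pt J T k N 0 - node_pt J T k N 1))\<^sup>2 \<le> (cmod (zl (node_pt J T k N 0 - node_pt J T k N 1)) + cmod (zr (node_pt J T k N 0 - node_pt J T k N 1)))\<^sup>2"
      unfolding norm_sq_vec4 by (simp add: power2_sum)
  qed simp
  also have "\<dots> \<le> \<bar>cos (node_angle J k)\<bar> * (2 * pi * real (node_p J T k) / real N) + \<bar>sin (node_angle J k)\<bar> * (2 * pi * real (node_q J T k) / real N)"
  proof (intro add_mono)
    have zd: "zl (x - y) = zl x - zl y" "zr (x - y) = zr x - zr y" for x y
      by (simp_all add: zl_def zr_def complex_eq_iff)
    have "zl (node_pt J T k N 0 - node_pt J T k N 1) = of_real (cos (node_angle J k)) * (1 - cis (2 * pi * real (node_p J T k) / real N))"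
      by (simp add: zd node_pt_def torus_pt_def algebra_simps)
    moreover have "cmod (1 - cis (2 * pi * real (node_p J T k) / real N)) \<le> 2 * pi * real (node_p J T k) / real N"
      using cmod_cis_diff_le[of "2 * pi * real (node_p J T k) / real N"] by simp
    ultimately show "cmod (zl (node_pt J T k N 0 - node_pt J T k N 1)) \<le> \<bar>cos (node_angle J k)\<bar> * (2 * pi * real (node_p J T k) / real N)"
      by (simp only: norm_mult norm_of_real) (rule mult_left_mono, simp_all)
    have "zr (node_pt J T k N 0 - node_pt J T k N 1) = of_real (sin (node_angle J k)) * (1 - cis (2 * pi * real (node_q J T k) / real N))"
      by (simp add: zd node_pt_def torus_pt_def algebra_simps)
    moreover have "cmod (1 - cis (2 * pi * real (node_q J T k) / real N)) \<le> 2 * pi * real (node_q J T k) / real N"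
      using cmod_cis_diff_le[of "2 * pi * real (node_q J T k) / real N"] by simp
    ultimately show "cmod (zr (node_pt J T k N 0 - node_pt J T k N 1)) \<le> \<bar>sin (node_angle J k)\<bar> * (2 * pi * real (node_q J T k) / real N)"
      by (simp only: norm_mult norm_of_real) (rule mult_left_mono, simp_all)
  qed
  also have "\<bar>cos (node_angle J k)\<bar> = cos (node_angle J k)"
    using node_angle_bounds[OF k] pi_gt_zero by (auto intro!: cos_ge_zero abs_of_nonneg)
  also have "\<bar>sin (node_angle J k)\<bar> = sin (node_angle J k)"
    using node_angle_bounds[OF k] pi_gt_zero by (auto intro!: sin_ge_zero abs_of_nonneg)
  also have "cos (node_angle J k) * (2 * pi * real (node_p J T k) / real N) + sin (node_angle J k) * (2 * pi * real (node_q J T k) / real N)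
     = 2 * pi * node_spread J T k / real N"
    by (simp add: node_spread_def add_divide_distrib algebra_simps)
  finally show ?thesis .
qed

text \<open>The factor 4 pi in place of 2 pi is the loss of 2 in \<open>arc_len_le\<close>, which
  applies once the step is at most 1.\<close>

lemma node_length:
  assumes k: "k < 2 * J" and N: "0 < N" and small: "2 * pi * (real T + 2) / real N \<le> 1"
  shows "0 \<le> node_len J T k N" "real N * node_len J T k N \<le> 4 * pi * node_spread J T k"
proof -
  have n: "norm (node_pt J T k N 0) = 1" "norm (node_pt J T k N 1) = 1" using node_pt_sphere[of J T k N] by auto
  have st: "norm (node_pt J T k N 0 - node_pt J T k N 1) \<le> 2 * pi * node_spread J T k / real N"
    using node_step[OF k N, of T 0] by simp
  also have "\<dots> \<le> 2 * pi * (real T + 2) / real N"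
    using node_spread_bounds(2)[OF k, of T] by (intro divide_right_mono mult_left_mono) auto
  finally have le1: "norm (node_pt J T k N 0 - node_pt J T k N 1) \<le> 1" using small by linarith
  show "0 \<le> node_len J T k N" unfolding node_len_def by (rule arc_len_le(1)[OF n le1])
  have "node_len J T k N \<le> 2 * norm (node_pt J T k N 0 - node_pt J T k N 1)"
    unfolding node_len_def by (rule arc_len_le(2)[OF n le1])
  also have "\<dots> \<le> 2 * (2 * pi * node_spread J T k / real N)" using st by simp
  finally have "real N * node_len J T k N \<le> real N * (2 * (2 * pi * node_spread J T k / real N))" by (intro mult_left_mono) auto
  then show "real N * node_len J T k N \<le> 4 * pi * node_spread J T k" using N by simp
qed

text \<open>For k > 0 both sides are of order t sin \<theta> with \<theta> = k pi/(2J). The spread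
  is at most 7t sin \<theta>, so the left side is below 13 * 7t sin \<theta> = 91t sin \<theta>.
  With J \<le> 2t and A \<ge> 2000 t^2, \<open>quad_weight_ge\<close> gives at least 182 t^2/(2t)
  sin \<theta>, the same number. At k = 0 the spread is 1, and 14 is there because it exceeds 4
  pi.\<close>

lemma node_weight_dominates:
  assumes t: "1 \<le> t" and k: "k < 2 * (t + 1)" and A: "2000 * (real t)\<^sup>2 \<le> A"
  shows "4 * pi * node_spread (t + 1) (2 * t) k < node_weight A 14 (t + 1) k"
proof (cases "k = 0")
  case True
  then show ?thesis using pi_less_4 pi_approx by (simp add: node_spread_def node_weight_def node_p_def node_q_def node_angle_def)
next
  case False
  define J where "J = t + 1"
  define \<theta> where "\<theta> k = real k * pi / real (2 * J)" for k
  have J: "2 \<le> J" "real J \<le> 2 * real t" using t by (auto simp: J_def)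
  have low: "node_spread J (2 * t) j \<le> 7 * real t * sin (\<theta> j) \<and> cos (node_angle J j) + real (2 * t + 1) * sin (node_angle J j) \<le> 7 * real t * sin (\<theta> j)"
    if j: "0 < j" "j \<le> J" for j
  proof -
    have th: "0 \<le> \<theta> j" "\<theta> j \<le> pi / 2" using j by (auto simp: \<theta>_def field_simps)
    have a: "node_angle J j = \<theta> j / 2" by (simp add: node_angle_def \<theta>_def)
    have "1 * pi / real (2 * J) \<le> \<theta> j" unfolding \<theta>_def using j by (intro divide_right_mono mult_right_mono) auto
    then have "pi / real (2 * J) / 2 \<le> sin (\<theta> j)" using half_le_sin[OF th] by simp
    then have "pi / 4 \<le> real J * sin (\<theta> j)" using J by (simp add: field_simps)
    \<comment> \<open>The cosine in the spread does not become small with \<theta>. It is absorbed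
      because \<theta> is at least the node distance pi/(2J).\<close>
    then have one: "1 \<le> 2 * real J * sin (\<theta> j)" using pi_gt3 by linarith
    have "cos (pi / 3) \<le> cos (\<theta> j / 2)" by (rule cos_monotone_0_pi_le) (use th pi_gt_zero in auto)
    then have c: "1 / 2 \<le> cos (\<theta> j / 2)" by (simp add: cos_60)
    have s0: "0 \<le> sin (\<theta> j / 2)" using th by (intro sin_ge_zero) auto
    have "sin (\<theta> j) = 2 * sin (\<theta> j / 2) * cos (\<theta> j / 2)" using sin_double[of "\<theta> j / 2"] by simp
    moreover have "sin (\<theta> j / 2) * (1 / 2) \<le> sin (\<theta> j / 2) * cos (\<theta> j / 2)" using c s0 by (intro mult_left_mono) auto
    ultimately have s: "sin (\<theta> j / 2) \<le> sin (\<theta> j)" by linarith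
    have "cos (\<theta> j / 2) + real (2 * t + 1) * sin (\<theta> j / 2) \<le> 2 * real J * sin (\<theta> j) + real (2 * t + 1) * sin (\<theta> j)"
      by (intro add_mono order_trans[OF cos_le_one one] mult_left_mono s) auto
    also have "\<dots> = (2 * real J + real (2 * t + 1)) * sin (\<theta> j)" by (simp add: algebra_simps)
    \<comment> \<open>Here 2J + 2t + 1 = 4t + 3 \<le> 7t.\<close>
    also have "\<dots> \<le> 7 * real t * sin (\<theta> j)"
      using t s s0 by (intro mult_right_mono) (auto simp: J_def)
    finally show ?thesis using j by (simp add: node_spread_def node_p_def node_q_def a)
  qed
  have main: "node_spread J (2 * t) k \<le> 7 * real t * sin (\<theta> k)"
  proof (cases "k \<le> J")
    case True
    then show ?thesis using low[of k] False by simp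
  next
    \<comment> \<open>Passing from \<eta> to pi/2 - \<eta> exchanges cosine and sine along with the
      two entries of the slope, and it keeps sin \<theta>.\<close>
    case nk: False
    have kk: "real (2 * J - k) = real (2 * J) - real k" using k by (simp add: J_def of_nat_diff)
    have "node_angle J k = pi / 2 - node_angle J (2 * J - k)" unfolding node_angle_def kk
      using J by (simp add: field_simps)
    then have "cos (node_angle J k) = sin (node_angle J (2 * J - k))" "sin (node_angle J k) = cos (node_angle J (2 * J - k))"
      by (simp_all add: cos_diff sin_diff)
    moreover have "\<theta> (2 * J - k) = pi - \<theta> k" unfolding \<theta>_def kk using J by (simp add: field_simps)
    then have "sin (\<theta> (2 * J - k)) = sin (\<theta> k)" by simp
    ultimately show ?thesis using low[of "2 * J - k"] nk k by (simp add: node_spread_def node_p_def node_q_def J_def add.commute)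
  qed
  have sp: "0 < sin (\<theta> k)"
  proof (rule sin_gt_zero)
    show "0 < \<theta> k" using False J by (simp add: \<theta>_def)
    have "real k < real (2 * J)" using k by (simp only: of_nat_less_iff J_def)
    then have "real k * pi < real (2 * J) * pi" by (intro mult_strict_right_mono) auto
    then show "\<theta> k < pi" using J by (simp add: \<theta>_def divide_less_eq mult.commute)
  qed
  have "(real J)\<^sup>2 \<le> (2 * real t)\<^sup>2" using J by (intro power_mono) auto
  then have J2: "(real J)\<^sup>2 \<le> 4 * (real t)\<^sup>2" by (simp add: power_mult_distrib)
  have tt: "0 < (real t)\<^sup>2" using t by simp
  have "28 * real t * (6.5 * real t) \<le> A / 6 - 2 * (real J)\<^sup>2 * 14"
  proof -
    have "28 * real t * (6.5 * real t) = 182 * (real t)\<^sup>2" by (simp add: power2_eq_square)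
    then show ?thesis using A J2 tt by linarith
  qed
  have "4 * pi * node_spread J (2 * t) k \<le> 4 * pi * (7 * real t * sin (\<theta> k))"
    using main by (intro mult_left_mono) auto
  also have "\<dots> < 13 * (7 * real t * sin (\<theta> k))"
    using pi_approx sp t by (intro mult_strict_right_mono) auto
  also have "\<dots> = 1 / (2 * real t) * sin (\<theta> k) * (28 * real t * (6.5 * real t))"
    using t by (simp add: field_simps)
  also have "\<dots> \<le> 1 / real J * sin (\<theta> k) * (A / 6 - 2 * (real J)\<^sup>2 * 14)"
    using \<open>28 * real t * (6.5 * real t) \<le> _\<close> sp J t
    by (intro mult_mono divide_left_mono mult_right_mono) auto
  also have "\<dots> \<le> quad_weight A 14 J k"
    unfolding \<theta>_def by (rule quad_weight_ge) (use J False k A in \<open>auto simp: J_def intro: order_trans[rotated]\<close>)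
  finally show ?thesis using False by (simp add: node_weight_def J_def)
qed

section \<open>Two reflected copies and a walk through all loops\<close>

definition node_copy :: "nat \<Rightarrow> nat \<Rightarrow> nat \<Rightarrow> bool \<times> nat \<times> nat \<Rightarrow> real^4" where
  "node_copy J T N i = (if fst i then swp (node_pt J T (fst (snd i)) N (snd (snd i))) else node_pt J T (fst (snd i)) N (snd (snd i)))"

definition copy :: "bool \<Rightarrow> (real^4 \<Rightarrow> real) \<Rightarrow> real^4 \<Rightarrow> real" where
  "copy b f x = (if b then f (swp x) else f x)"

lemma copy_pdeg: "pdeg n f \<Longrightarrow> pdeg n (copy b f)"
  unfolding copy_def[abs_def] by (cases b) (simp_all add: pdeg_swp)

lemma node_copy_sphere: "node_copy J T N i \<in> sphere 0 1"
  using node_pt_sphere orthogonal_transformation_norm[OF orthogonal_swp] by (simp add: node_copy_def)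

lemma node_copy_apply: "f (node_copy J T N (b, k, r)) = copy b f (node_pt J T k N r)"
  by (simp add: node_copy_def copy_def)

lemma node_copy_sum:
  assumes "0 < N"
  shows "(\<Sum>r<N. f (node_copy J T N (b, k, r))) = real N * node_mean J T k N (copy b f)"
  using assms by (simp only: node_copy_apply) (simp add: node_mean_def orbit_mean_def node_pt_def)

lemma double_quadrature:
  assumes f: "pdeg T f" and T: "T + 2 < 4 * J" and N: "(T + 1)\<^sup>2 \<le> N"
  shows "(\<Sum>b\<in>UNIV. \<Sum>k<2 * J. node_weight A B J k * node_mean J T k N (copy b f)) = 2 * A * sphere_mean f"
proof -
  have "sphere_mean (copy b f) = sphere_mean f" for b
    using sphere_mean_orthogonal[OF orthogonal_swp pdeg_continuous[OF f]] unfolding copy_def[abs_def] by (cases b) simp_all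
  then have "(\<Sum>k<2 * J. node_weight A B J k * node_mean J T k N (copy b f)) = A * sphere_mean f" for b
    using node_quadrature[OF copy_pdeg[OF f] T N] by simp
  then show ?thesis by (simp add: UNIV_bool)
qed

lemma node_copy_loop:
  assumes k: "k < 2 * J" and N: "4 \<le> N" and st: "2 * pi * (real T + 2) / real N \<le> \<epsilon>"
  shows "closed_walk \<epsilon> (node_copy J T N (b, k, 0)) ((\<lambda>r. node_copy J T N (b, k, r)) ` {..<N})
     (\<lambda>f. node_len J T k N * (real N * node_mean J T k N (copy b f)))"
proof -
  let ?x = "\<lambda>r. node_copy J T N (b, k, r)"
  have N0: "0 < N" using N by simp
  have swl: "swp x - swp y = swp (x - y)" for x y
    using linear_diff[OF orthogonal_transformation_linear[OF orthogonal_swp]] by simp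
  have "closed_walk \<epsilon> (?x 0) (?x ` {..<N}) (\<lambda>f. \<Sum>r<N. arc_len (?x r) (?x (Suc r)) * f (?x r))"
  proof (rule closed_walk_loop[OF N])
    show "?x N = ?x 0" using torus_pt_period[OF N0] by (simp add: node_copy_def node_pt_def)
    fix r
    have "norm (?x r - ?x (Suc r)) = norm (node_pt J T k N r - node_pt J T k N (Suc r))"
      by (simp add: node_copy_def swl orthogonal_transformation_norm[OF orthogonal_swp])
    also have "\<dots> \<le> 2 * pi * node_spread J T k / real N" by (rule node_step[OF k N0])
    also have "\<dots> \<le> 2 * pi * (real T + 2) / real N"
      using node_spread_bounds(2)[OF k, of T] by (intro divide_right_mono mult_left_mono) auto
    finally show "norm (?x r - ?x (Suc r)) \<le> \<epsilon>" using st by linarith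
  qed
  moreover have "arc_len (?x r) (?x (Suc r)) = node_len J T k N" for r
    by (simp add: node_copy_def arc_len_orthogonal[OF orthogonal_swp] node_arc_len)
  then have "(\<Sum>r<N. arc_len (?x r) (?x (Suc r)) * f (?x r)) = node_len J T k N * (real N * node_mean J T k N (copy b f))" for f
    using node_copy_sum[OF N0] by (simp add: sum_distrib_left[symmetric])
  ultimately show ?thesis by simp
qed

text \<open>
  The second copy of the circle \<open>k = 0\<close> is the great circle \<open>(cos x, 0, sin x, 0)\<close>, which meets every torus
  of the first copy, and vice versa; so all loops can be traversed in one closed walk.
\<close>

lemma node_copy_incidence:
  assumes k: "k < 2 * J" and N: "N = 8 * J * m" "0 < m"
  shows "node_copy J T N (b, k, 0) \<in> (\<lambda>r. node_copy J T N (\<not> b, 0, r)) ` {..<N}"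
proof -
  have J: "0 < J" using k by simp
  \<comment> \<open>The circle has N = 8Jm samples, so sample k m sits at angle 2 pi k m/N = k
    pi/(4J), the parameter of torus \<open>k\<close>.\<close>
  have lt: "k * m < N" using k N J by (simp add: N(1))
  have e: "2 * pi * real (1 * (k * m)) / real N = node_angle J k"
    using N J by (simp add: node_angle_def field_simps)
  have a: "node_pt J T k N 0 = mk4 (of_real (cos (node_angle J k))) (of_real (sin (node_angle J k)))"
    by (simp add: node_pt_def torus_pt_def)
  have c: "node_pt J T 0 N (k * m) = mk4 (cis (node_angle J k)) 0"
  proof -
    have "node_pt J T 0 N (k * m) = mk4 (cis (2 * pi * real (1 * (k * m)) / real N)) 0"
      by (simp add: node_pt_def torus_pt_def node_p_def node_angle_def)
    then show ?thesis by (simp only: e)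
  qed
  have "node_pt J T k N 0 = swp (node_pt J T 0 N (k * m))"
    unfolding a c by (rule vec4_eqI) (simp_all add: swp_def complex_eq_iff)
  then have "node_copy J T N (b, k, 0) = node_copy J T N (\<not> b, 0, k * m)" by (simp add: node_copy_def)
  then show ?thesis using lt by auto
qed

text \<open>The circle of copy \<open>True\<close> meets all loops of copy \<open>False\<close>,
  among them its circle, and that one meets all loops of copy \<open>True\<close>. Attaching in this
  order reaches every loop; the last family starts at index 1 because the circle of copy
  \<open>True\<close> has already been traversed.\<close>

lemma node_copy_walk:
  assumes J: "0 < J" and N: "N = 8 * J * m" "0 < m" and st: "2 * pi * (real T + 2) / real N \<le> \<epsilon>"
  shows "\<exists>p. closed_walk \<epsilon> p (node_copy J T N ` (UNIV \<times> {..<2 * J} \<times> {..<N}))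
     (\<lambda>f. \<Sum>b\<in>UNIV. \<Sum>k<2 * J. node_len J T k N * (real N * node_mean J T k N (copy b f)))"
proof -
  define L where "L b k = (\<lambda>r. node_copy J T N (b, k, r)) ` {..<N}" for b k
  define \<Phi> where "\<Phi> b k f = node_len J T k N * (real N * node_mean J T k N (copy b f))" for b k f
  have N4: "4 \<le> N" using J N by (simp add: N(1))
  have loop: "closed_walk \<epsilon> (node_copy J T N (b, k, 0)) (L b k) (\<Phi> b k)" if "k < 2 * J" for b k
    unfolding L_def \<Phi>_def by (rule node_copy_loop[OF that N4 st])
  have inc: "node_copy J T N (b, k, 0) \<in> L (\<not> b) 0" if "k < 2 * J" for b k
    unfolding L_def by (rule node_copy_incidence[OF that N])
  have J0: "0 < 2 * J" using J by simp
  let ?p = "node_copy J T N (True, 0, 0)"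
  have W: "closed_walk \<epsilon> ?p (L True 0 \<union> (\<Union>k\<in>{..<2 * J}. L False k)) (\<lambda>f. \<Phi> True 0 f + (\<Sum>k<2 * J. \<Phi> False k f))"
    by (rule closed_walk_attach_family[OF loop[OF J0], where q = "\<lambda>k. node_copy J T N (False, k, 0)"])
       (use inc[of _ False] loop[of _ False] in auto)
  have incT: "node_copy J T N (True, k, 0) \<in> L True 0 \<union> (\<Union>k\<in>{..<2 * J}. L False k)" if "k < 2 * J" for k
  proof -
    have "L False 0 \<subseteq> (\<Union>k\<in>{..<2 * J}. L False k)" using J0 by (intro UN_upper) simp
    then show ?thesis using inc[OF that, of True] by auto
  qed
  have "closed_walk \<epsilon> ?p (L True 0 \<union> (\<Union>k\<in>{..<2 * J}. L False k) \<union> (\<Union>k\<in>{1..<2 * J}. L True k))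
      (\<lambda>f. \<Phi> True 0 f + (\<Sum>k<2 * J. \<Phi> False k f) + (\<Sum>k\<in>{1..<2 * J}. \<Phi> True k f))"
    by (rule closed_walk_attach_family[OF W, where q = "\<lambda>k. node_copy J T N (True, k, 0)"])
       (use incT loop in auto)
  moreover have "L True 0 \<union> (\<Union>k\<in>{..<2 * J}. L False k) \<union> (\<Union>k\<in>{1..<2 * J}. L True k) = node_copy J T N ` (UNIV \<times> {..<2 * J} \<times> {..<N})"
  proof -
    have "{..<2 * J} = insert 0 {1..<2 * J}" using J0 by auto
    then have "L True 0 \<union> (\<Union>k\<in>{1..<2 * J}. L True k) = (\<Union>k\<in>{..<2 * J}. L True k)" by simp
    then have "L True 0 \<union> (\<Union>k\<in>{..<2 * J}. L False k) \<union> (\<Union>k\<in>{1..<2 * J}. L True k) = (\<Union>b\<in>UNIV. \<Union>k\<in>{..<2 * J}. L b k)"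
      by (auto simp: UNIV_bool)
    also have "\<dots> = node_copy J T N ` (UNIV \<times> {..<2 * J} \<times> {..<N})" by (auto simp: L_def)
    finally show ?thesis .
  qed
  moreover have "\<Phi> True 0 f + (\<Sum>k<2 * J. \<Phi> False k f) + (\<Sum>k\<in>{1..<2 * J}. \<Phi> True k f) = (\<Sum>b\<in>UNIV. \<Sum>k<2 * J. \<Phi> b k f)" for f
  proof -
    have "{..<2 * J} = insert 0 {1..<2 * J}" using J0 by auto
    then have "(\<Sum>k<2 * J. \<Phi> True k f) = \<Phi> True 0 f + (\<Sum>k\<in>{1..<2 * J}. \<Phi> True k f)" by simp
    then show ?thesis by (simp add: UNIV_bool)
  qed
  ultimately show ?thesis unfolding \<Phi>_def by auto
qed

section \<open>From nodes to all polynomials\<close>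

lemma finite_exponents: "finite {\<alpha> :: 4 \<Rightarrow> nat. (\<Sum>i\<in>UNIV. \<alpha> i) \<le> t}"
proof (rule finite_subset)
  show "{\<alpha> :: 4 \<Rightarrow> nat. (\<Sum>i\<in>UNIV. \<alpha> i) \<le> t} \<subseteq> PiE UNIV (\<lambda>_. {..t})"
  proof
    fix \<alpha> :: "4 \<Rightarrow> nat" assume "\<alpha> \<in> {\<alpha>. (\<Sum>i\<in>UNIV. \<alpha> i) \<le> t}"
    then have "\<alpha> i \<le> t" for i using member_le_sum[of i UNIV \<alpha>] by fastforce
    then show "\<alpha> \<in> PiE UNIV (\<lambda>_. {..t})" by auto
  qed
qed (auto intro: finite_PiE)

lemma polys_deg_le_span:
  "polys_deg_le t = function_span {\<alpha> :: 4 \<Rightarrow> nat. (\<Sum>i\<in>UNIV. \<alpha> i) \<le> t} (\<lambda>\<alpha> x. \<Prod>i\<in>UNIV. (x $ i) ^ \<alpha> i)"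
  by (simp add: polys_deg_le_def function_span_def)

lemma polys_deg_le_pdeg:
  assumes "f \<in> polys_deg_le t" shows "pdeg t f"
proof -
  obtain c where "f = (\<lambda>x. \<Sum>\<alpha> | (\<Sum>i\<in>UNIV. \<alpha> i) \<le> t. c \<alpha> * (\<Prod>i\<in>UNIV. (x $ i) ^ \<alpha> i))"
    using assms by (auto simp: polys_deg_le_def)
  then show ?thesis
    by (auto intro!: pdeg_sum finite_exponents pdeg_scale intro: pdeg_mono[OF pdeg_monomial])
qed

text \<open>The rule with A = 1 and B = 0 is exact for the square of \<open>f\<close>, whose degree
  is at most 2t, and therefore gives it mean 0.\<close>

lemma zero_on_nodes:
  assumes f: "pdeg t f" and T: "2 * t + 2 < 4 * J" and N: "(2 * t + 1)\<^sup>2 \<le> N"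
    and 0: "\<And>i. i \<in> UNIV \<times> {..<2 * J} \<times> {..<N} \<Longrightarrow> f (node_copy J (2 * t) N i) = 0" and x: "x \<in> sphere 0 1"
  shows "f x = 0"
proof -
  have f2: "pdeg (2 * t) (\<lambda>x. (f x)\<^sup>2)"
    using pdeg_mult[OF f f] by (simp add: power2_eq_square mult_2)
  have "node_mean J (2 * t) k N (\<lambda>x. (f x)\<^sup>2) = 0" if "k < 2 * J" for k
  proof -
    have "f (node_pt J (2 * t) k N r) = 0" if "r < N" for r
      using 0[of "(False, k, r)"] that \<open>k < 2 * J\<close> by (simp add: node_copy_def)
    then show ?thesis by (simp add: node_mean_def orbit_mean_def node_pt_def)
  qed
  then have "(\<Sum>k<2 * J. node_weight 1 0 J k * node_mean J (2 * t) k N (\<lambda>x. (f x)\<^sup>2)) = 0" by simp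
  then have "sphere_mean (\<lambda>x. (f x)\<^sup>2) = 0" using node_quadrature[OF f2 T N, of 1 0] by simp
  then show ?thesis by (rule sphere_mean_square_zero[OF pdeg_continuous[OF f] _ x])
qed

text \<open>The weight \<open>v k\<close> of a loop exceeds its length on every mesh considered, as
  \<open>\<beta> k\<close> bounds that length. The surplus, shared equally by the \<open>N0\<close>
  coarse samples of the loop, becomes the point masses. The coarse set \<open>S\<close> stays fixed
  while the mesh \<open>N = N0 * \<kappa>\<close> is refined, which makes the bounds on the masses
  independent of the mesh.\<close>

theorem simple_curve_exact_for_polynomials:
  assumes t: "1 \<le> t" and A: "2000 * (real t)\<^sup>2 \<le> A"
  shows "\<exists>\<gamma> :: real \<Rightarrow> real^4. simple_path \<gamma> \<and> \<gamma> 0 = \<gamma> 1 \<and> path_image \<gamma> \<subseteq> sphere 0 1 \<and> piecewise_smooth \<gamma> \<and>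
      (\<forall>f\<in>polys_deg_le t. integral {0..1} (\<lambda>s. f (\<gamma> s) * speed \<gamma> s) = 2 * A * sphere_mean f)"
proof -
  define T where "T = 2 * t"
  define J where "J = t + 1"
  define m where "m = (T + 1)\<^sup>2"
  define N0 where "N0 = 8 * J * m"
  have J: "0 < J" and TJ: "T + 2 < 4 * J" by (auto simp: T_def J_def)
  have m: "0 < m" by (simp add: m_def)
  have N0: "(T + 1)\<^sup>2 \<le> N0" "0 < N0" using J m by (auto simp: N0_def m_def)
  define I where "I = (UNIV :: bool set) \<times> {..<2 * J} \<times> {..<N0}"
  define S where "S = node_copy J T N0 ` I"
  have finI: "finite I" by (simp add: I_def)
  have finS: "finite S" by (simp add: S_def finI)
  let ?V = "polys_deg_le t :: (real^4 \<Rightarrow> real) set"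
  obtain Y g where Yg: "Y \<subseteq> S \<and> finite Y \<and> (\<forall>y\<in>Y. g y \<in> ?V) \<and>
     (\<forall>y\<in>Y. \<forall>y'\<in>Y. g y y' = (if y = y' then 1 else 0)) \<and>
     (\<forall>f\<in>?V. \<forall>x\<in>S. f x = (\<Sum>y\<in>Y. f y * g y x))"
    using lagrange_basis[OF finite_exponents[of t], where S = S and e = "\<lambda>\<alpha> x. \<Prod>i\<in>UNIV. (x $ i) ^ \<alpha> i", folded polys_deg_le_span] by (elim exE)
  have Y: "Y \<subseteq> S" "finite Y" and gV: "\<And>y. y \<in> Y \<Longrightarrow> g y \<in> ?V"
    and lag: "\<And>y y'. y \<in> Y \<Longrightarrow> y' \<in> Y \<Longrightarrow> g y y' = (if y = y' then 1 else 0)"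
    and rep: "\<And>f x. f \<in> ?V \<Longrightarrow> x \<in> S \<Longrightarrow> f x = (\<Sum>y\<in>Y. f y * g y x)"
    using Yg by blast+
  have gp: "pdeg t (g y)" if "y \<in> Y" for y using polys_deg_le_pdeg[OF gV[OF that]] .
  define v where "v k = node_weight A 14 J k" for k
  define \<beta> where "\<beta> k = 4 * pi * node_spread J T k" for k
  have v\<beta>: "\<beta> k < v k" if "k < 2 * J" for k
    using node_weight_dominates[OF t, of k A] that A by (simp add: \<beta>_def v_def J_def T_def)
  have \<beta>0: "0 \<le> \<beta> k" if "k < 2 * J" for k using node_spread_bounds(1)[OF that] by (simp add: \<beta>_def)
  define rmin where "rmin = Min ((\<lambda>k. (v k - \<beta> k) / real N0) ` {..<2 * J})"
  have rmin: "0 < rmin" "\<And>k. k < 2 * J \<Longrightarrow> rmin \<le> (v k - \<beta> k) / real N0"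
  proof -
    have ne: "(\<lambda>k. (v k - \<beta> k) / real N0) ` {..<2 * J} \<noteq> {}" using J by (simp add: lessThan_empty_iff)
    show "0 < rmin" unfolding rmin_def
      by (subst Min_gr_iff[OF _ ne]) (use v\<beta> N0 in auto)
    show "rmin \<le> (v k - \<beta> k) / real N0" if "k < 2 * J" for k
      unfolding rmin_def using that by (intro Min_le) auto
  qed
  define rmax where "rmax = (\<Sum>i\<in>I. v (fst (snd i)) / real N0)"
  define \<Lambda> where "\<Lambda> = (\<Sum>b\<in>(UNIV :: bool set). \<Sum>k<2 * J. v k)"
  have "\<exists>\<gamma>. simple_path \<gamma> \<and> \<gamma> 0 = \<gamma> 1 \<and> path_image \<gamma> \<subseteq> sphere 0 1 \<and> piecewise_smooth \<gamma> \<and>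
      (\<forall>F. continuous_on UNIV F \<longrightarrow> (\<lambda>s. F (\<gamma> s) * speed \<gamma> s) integrable_on {0..1}) \<and>
      (\<forall>y\<in>Y. integral {0..1} (\<lambda>s. g y (\<gamma> s) * speed \<gamma> s) = 2 * A * sphere_mean (g y))"
  proof (rule exact_simple_curve[where S = S and rmin = rmin and rmax = rmax and \<Lambda> = \<Lambda>])
    show "4 \<le> DIM(real^4)" by simp
    show "S \<subseteq> sphere 0 1" unfolding S_def using node_copy_sphere by blast
    fix \<epsilon> :: real assume \<epsilon>: "0 < \<epsilon>"
    define \<epsilon>' where "\<epsilon>' = min \<epsilon> 1"
    have \<epsilon>': "0 < \<epsilon>'" "\<epsilon>' \<le> \<epsilon>" "\<epsilon>' \<le> 1" using \<epsilon> by (auto simp: \<epsilon>'_def)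
    obtain \<kappa> where \<kappa>: "2 * pi * (real T + 2) < real \<kappa> * \<epsilon>'" using reals_Archimedean3[OF \<epsilon>'(1)] by blast
    have \<kappa>0: "0 < \<kappa>"
    proof (rule ccontr)
      assume "\<not> 0 < \<kappa>"
      then have "2 * pi * (real T + 2) < 0" using \<kappa> by simp
      moreover have "0 \<le> 2 * pi * (real T + 2)" by simp
      ultimately show False by linarith
    qed
    define N where "N = N0 * \<kappa>"
    have N: "0 < N" "N0 \<le> N" "\<kappa> \<le> N" "N = 8 * J * (m * \<kappa>)" using \<kappa>0 N0 by (auto simp: N_def N0_def)
    have NT: "(T + 1)\<^sup>2 \<le> N" using N0(1) N(2) by linarith
    have st: "2 * pi * (real T + 2) / real N \<le> \<epsilon>'"
    proof -
      have "real \<kappa> * \<epsilon>' \<le> real N * \<epsilon>'" using N(3) \<epsilon>'(1) by (intro mult_right_mono) auto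
      then have "2 * pi * (real T + 2) \<le> \<epsilon>' * real N" using \<kappa> by (simp add: mult.commute)
      then show ?thesis using N(1) by (simp add: pos_divide_le_eq)
    qed
    have len: "0 \<le> node_len J T k N" "real N * node_len J T k N \<le> \<beta> k" if "k < 2 * J" for k
      using node_length[OF that N(1), of T] st \<epsilon>'(3) by (auto simp: \<beta>_def)
    define \<Phi> where "\<Phi> f = (\<Sum>b\<in>UNIV. \<Sum>k<2 * J. node_len J T k N * (real N * node_mean J T k N (copy b f)))" for f
    obtain p where p: "closed_walk \<epsilon>' p (node_copy J T N ` (UNIV \<times> {..<2 * J} \<times> {..<N})) \<Phi>"
      using node_copy_walk[OF J N(4) _ st] m \<kappa>0 unfolding \<Phi>_def[abs_def] by auto
    obtain M :: nat and x where Mx: "4 \<le> M \<and> (\<forall>i. x (i + M) = x i) \<and> (\<forall>i. x i \<in> node_copy J T N ` (UNIV \<times> {..<2 * J} \<times> {..<N})) \<and>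
       node_copy J T N ` (UNIV \<times> {..<2 * J} \<times> {..<N}) = x ` {..<M} \<and>
       (\<forall>i. norm (x i - x (i + 1)) \<le> \<epsilon>') \<and> (\<forall>f. (\<Sum>i<M. arc_len (x i) (x (i + 1)) * f (x i)) = \<Phi> f)"
      using closed_walk_periodic[OF p less_imp_le[OF \<epsilon>'(1)]] by (elim exE)
    define w where "w i = (v (fst (snd i)) - real N * node_len J T (fst (snd i)) N) / real N0" for i :: "bool \<times> nat \<times> nat"
    \<comment> \<open>Loops of the two copies share points, so the mass at \<open>s\<close> collects
      all indices that name it.\<close>
    define \<rho> where "\<rho> s = (\<Sum>i | i \<in> I \<and> node_copy J T N0 i = s. w i)" for s
    have wb: "rmin \<le> w i" "w i \<le> v (fst (snd i)) / real N0" if "i \<in> I" for i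
    proof -
      have k: "fst (snd i) < 2 * J" using that by (auto simp: I_def)
      have "(v (fst (snd i)) - \<beta> (fst (snd i))) / real N0 \<le> w i"
        unfolding w_def using len(2)[OF k] by (intro divide_right_mono) auto
      then show "rmin \<le> w i" using rmin(2)[OF k] by linarith
      show "w i \<le> v (fst (snd i)) / real N0"
        unfolding w_def using len(1)[OF k] by (intro divide_right_mono) auto
    qed
    have \<rho>b: "rmin \<le> \<rho> s \<and> \<rho> s \<le> rmax" if s: "s \<in> S" for s
    proof
      obtain i where i: "i \<in> I" "node_copy J T N0 i = s" using s by (auto simp: S_def)
      have w0: "0 \<le> w j" if "j \<in> I" for j using wb(1)[OF that] rmin(1) by linarith
      have "w i \<le> \<rho> s" unfolding \<rho>_def
        by (rule member_le_sum) (use i w0 finI in auto)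
      then show "rmin \<le> \<rho> s" using wb(1)[OF i(1)] by linarith
      have "\<rho> s \<le> (\<Sum>i\<in>I. w i)" unfolding \<rho>_def
        by (rule sum_mono2) (use finI w0 in auto)
      also have "\<dots> \<le> rmax" unfolding rmax_def by (intro sum_mono wb)
      finally show "\<rho> s \<le> rmax" .
    qed
    have lenL: "\<Phi> (\<lambda>_. 1) \<le> \<Lambda>"
      unfolding \<Phi>_def \<Lambda>_def
    proof (intro sum_mono)
      fix b k assume "k \<in> {..<2 * J}"
      then have k: "k < 2 * J" by simp
      have "node_mean J T k N (copy b (\<lambda>_. 1)) = 1" using N(1) by (simp add: node_mean_def orbit_mean_def copy_def)
      then show "node_len J T k N * (real N * node_mean J T k N (copy b (\<lambda>_. 1))) \<le> v k"
        using len(2)[OF k] v\<beta>[OF k] by (simp add: mult.commute)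
    qed
    \<comment> \<open>On each loop the length and the surplus multiply the same mean, since fine and
      coarse samplings agree by \<open>node_mean_eq\<close>; together they restore
      \<open>v k\<close>, and the quadrature rule applies.\<close>
    have exact: "\<Phi> f + (\<Sum>s\<in>S. \<rho> s * f s) = 2 * A * sphere_mean f" if f: "pdeg t f" for f
    proof -
      have fT: "pdeg T f" by (rule pdeg_mono[OF f]) (simp add: T_def)
      have "(\<Sum>s\<in>S. \<rho> s * f s) = (\<Sum>s\<in>S. \<Sum>i | i \<in> I \<and> node_copy J T N0 i = s. w i * f (node_copy J T N0 i))"
        unfolding \<rho>_def sum_distrib_right by (intro sum.cong refl) auto
      also have "\<dots> = (\<Sum>i\<in>I. w i * f (node_copy J T N0 i))"
        unfolding S_def by (rule sum.image_gen[OF finI, symmetric])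
      also have "\<dots> = (\<Sum>b\<in>UNIV. \<Sum>k<2 * J. \<Sum>r<N0. (v k - real N * node_len J T k N) / real N0 * f (node_copy J T N0 (b, k, r)))"
        unfolding I_def w_def sum.cartesian_product by (intro sum.cong refl) auto
      also have "\<dots> = (\<Sum>b\<in>UNIV. \<Sum>k<2 * J. (v k - real N * node_len J T k N) * node_mean J T k N0 (copy b f))"
        using N0(2) by (simp only: sum_distrib_left[symmetric] node_copy_sum[OF N0(2)]) simp
      also have "\<dots> = (\<Sum>b\<in>UNIV. \<Sum>k<2 * J. (v k - real N * node_len J T k N) * node_mean J T k N (copy b f))"
        using node_mean_eq[OF copy_pdeg[OF fT] N0(1) NT] by simp
      finally have "\<Phi> f + (\<Sum>s\<in>S. \<rho> s * f s) = (\<Sum>b\<in>UNIV. \<Sum>k<2 * J. v k * node_mean J T k N (copy b f))"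
        unfolding \<Phi>_def by (simp only: sum.distrib[symmetric]) (intro sum.cong refl, simp add: algebra_simps)
      also have "\<dots> = 2 * A * sphere_mean f" unfolding v_def by (rule double_quadrature[OF fT TJ NT])
      finally show ?thesis .
    qed
    show "\<exists>(M::nat) x \<rho>. 4 \<le> M \<and> (\<forall>i. x (i + M) = x i) \<and> (\<forall>i. x i \<in> sphere 0 1) \<and>
        S \<subseteq> x ` {..<M} \<and> (\<forall>i. norm (x i - x (i + 1)) \<le> \<epsilon>) \<and>
        (\<Sum>i<M. arc_len (x i) (x (i + 1))) \<le> \<Lambda> \<and> (\<forall>s\<in>S. rmin \<le> \<rho> s \<and> \<rho> s \<le> rmax) \<and>
        (\<forall>y\<in>Y. (\<Sum>i<M. arc_len (x i) (x (i + 1)) * g y (x i)) + (\<Sum>s\<in>S. \<rho> s * g y s) = 2 * A * sphere_mean (g y))"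
    proof (intro exI[of _ M] exI[of _ x] exI[of _ \<rho>] conjI allI ballI)
      show "4 \<le> M" using Mx by blast
      show "x (i + M) = x i" for i using Mx by blast
      show "x i \<in> sphere 0 1" for i
      proof -
        have "x i \<in> node_copy J T N ` (UNIV \<times> {..<2 * J} \<times> {..<N})" using Mx by blast
        then obtain j where "x i = node_copy J T N j" by (elim imageE)
        then show ?thesis by (simp only: node_copy_sphere)
      qed
      show "S \<subseteq> x ` {..<M}"
      proof
        fix s assume "s \<in> S"
        then obtain b k r where i: "k < 2 * J" "r < N0" "s = node_copy J T N0 (b, k, r)" by (auto simp: S_def I_def)
        have "s = node_copy J T N (b, k, r * \<kappa>)"
          unfolding i(3) N_def by (simp add: node_copy_def node_pt_def torus_pt_scale[OF \<kappa>0])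
        moreover have "r * \<kappa> < N" using i(2) \<kappa>0 by (simp add: N_def)
        ultimately have "s \<in> node_copy J T N ` (UNIV \<times> {..<2 * J} \<times> {..<N})" using i(1) by blast
        then show "s \<in> x ` {..<M}" using Mx by blast
      qed
      show "norm (x i - x (i + 1)) \<le> \<epsilon>" for i
      proof -
        have "norm (x i - x (i + 1)) \<le> \<epsilon>'" using Mx by blast
        then show ?thesis using \<epsilon>'(2) by linarith
      qed
      have walk: "(\<Sum>i<M. arc_len (x i) (x (i + 1)) * f (x i)) = \<Phi> f" for f using Mx by blast
      show "(\<Sum>i<M. arc_len (x i) (x (i + 1))) \<le> \<Lambda>" using walk[of "\<lambda>_. 1"] lenL by simp
      show "rmin \<le> \<rho> s" "\<rho> s \<le> rmax" if "s \<in> S" for s using \<rho>b[OF that] by auto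
      show "(\<Sum>i<M. arc_len (x i) (x (i + 1)) * g y (x i)) + (\<Sum>s\<in>S. \<rho> s * g y s) = 2 * A * sphere_mean (g y)" if "y \<in> Y" for y
        unfolding walk by (rule exact[OF gp[OF that]])
    qed
  qed (use finS Y lag rmin pdeg_continuous[OF gp] in auto)
  then obtain \<gamma> where \<gamma>: "simple_path \<gamma>" "\<gamma> 0 = \<gamma> 1" "path_image \<gamma> \<subseteq> sphere 0 1" "piecewise_smooth \<gamma>"
    and int: "\<And>F. continuous_on UNIV F \<Longrightarrow> (\<lambda>s. F (\<gamma> s) * speed \<gamma> s) integrable_on {0..1}"
    and ex: "\<And>y. y \<in> Y \<Longrightarrow> integral {0..1} (\<lambda>s. g y (\<gamma> s) * speed \<gamma> s) = 2 * A * sphere_mean (g y)"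
    by blast
  \<comment> \<open>The difference of both sides has degree at most t and vanishes on
    \<open>S\<close>, hence on the sphere. So the moments of the finitely many \<open>g y\<close>
    decide those of all polynomials.\<close>
  have rep_sphere: "f x = (\<Sum>y\<in>Y. f y * g y x)" if f: "f \<in> ?V" and x: "x \<in> sphere 0 1" for f x
  proof -
    define h where "h x = f x + (\<Sum>y\<in>Y. (- f y) * g y x)" for x
    have "pdeg t h" unfolding h_def[abs_def]
      by (intro pdeg.add polys_deg_le_pdeg[OF f] pdeg_sum Y pdeg_scale gp)
    moreover have "h (node_copy J T N0 i) = 0" if "i \<in> UNIV \<times> {..<2 * J} \<times> {..<N0}" for i
      using rep[OF f, of "node_copy J T N0 i"] that by (auto simp: h_def sum_negf S_def I_def)
    ultimately have "h x = 0"
      using zero_on_nodes[of t h J N0 x] TJ N0(1) x unfolding T_def by blast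
    then show ?thesis by (simp add: h_def sum_negf)
  qed
  have "integral {0..1} (\<lambda>s. f (\<gamma> s) * speed \<gamma> s) = 2 * A * sphere_mean f" if f: "f \<in> ?V" for f
  proof -
    have "integral {0..1} (\<lambda>s. f (\<gamma> s) * speed \<gamma> s) = integral {0..1} (\<lambda>s. \<Sum>y\<in>Y. f y * (g y (\<gamma> s) * speed \<gamma> s))"
    proof (rule Henstock_Kurzweil_Integration.integral_cong)
      fix s :: real assume "s \<in> {0..1}"
      then have "\<gamma> s \<in> sphere 0 1" using \<gamma>(3) unfolding path_image_def by blast
      from rep_sphere[OF f this] show "f (\<gamma> s) * speed \<gamma> s = (\<Sum>y\<in>Y. f y * (g y (\<gamma> s) * speed \<gamma> s))"
        by (simp add: sum_distrib_right mult.assoc)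
    qed
    also have "\<dots> = (\<Sum>y\<in>Y. f y * integral {0..1} (\<lambda>s. g y (\<gamma> s) * speed \<gamma> s))"
      by (subst integral_sum) (auto intro!: Y integrable_on_mult_right int pdeg_continuous[OF gp])
    also have "\<dots> = 2 * A * (\<Sum>y\<in>Y. f y * sphere_mean (g y))"
      unfolding sum_distrib_left by (intro sum.cong refl, subst ex, assumption, simp only: mult_ac)
    also have "(\<Sum>y\<in>Y. f y * sphere_mean (g y)) = sphere_mean (\<lambda>x. \<Sum>y\<in>Y. f y * g y x)"
      by (subst sphere_mean_sum) (auto intro!: Y continuous_intros pdeg_continuous[OF gp] simp: sphere_mean_mult)
    also have "\<dots> = sphere_mean f" by (rule sphere_mean_cong) (rule rep_sphere[OF f, symmetric])
    finally show ?thesis .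
  qed
  with \<gamma> show ?thesis by blast
qed

theorem theorem1p2:
  shows "\<exists>\<C>>0. \<forall>C::real. C \<ge> \<C> \<longrightarrow>
           (\<forall>t::nat. t \<ge> 1 \<longrightarrow>
             (\<exists>\<gamma> :: real \<Rightarrow> real ^ 4.
                design_curve t \<gamma> \<and> simple_path \<gamma> \<and> curve_length \<gamma> = C * (real t)\<^sup>2))"
proof (intro exI[of _ 4000] conjI allI impI)
  fix C :: real and t :: nat assume C: "4000 \<le> C" and t: "1 \<le> t"
  have "4000 * (real t)\<^sup>2 \<le> C * (real t)\<^sup>2" using C by (intro mult_right_mono) auto
  \<comment> \<open>Each of the two copies contributes \<open>A\<close> times the mean, so A = C
    t^2/2, and the threshold for \<open>C\<close> is 2 * 2000.\<close>
  then have "2000 * (real t)\<^sup>2 \<le> C * (real t)\<^sup>2 / 2" by simp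
  then obtain \<gamma> :: "real \<Rightarrow> real^4" where \<gamma>: "simple_path \<gamma>" "\<gamma> 0 = \<gamma> 1" "path_image \<gamma> \<subseteq> sphere 0 1" "piecewise_smooth \<gamma>"
    and ex: "\<And>f. f \<in> polys_deg_le t \<Longrightarrow> integral {0..1} (\<lambda>s. f (\<gamma> s) * speed \<gamma> s) = 2 * (C * (real t)\<^sup>2 / 2) * sphere_mean f"
    using simple_curve_exact_for_polynomials[OF t] by blast
  \<comment> \<open>Exactness for the constant 1 is the statement about the length.\<close>
  have one: "(\<lambda>x :: real^4. 1) \<in> polys_deg_le t"
  proof -
    have "(\<lambda>x :: real^4. \<Prod>i\<in>UNIV. (x $ i) ^ (0::nat)) \<in> polys_deg_le t"
      unfolding polys_deg_le_span
      using function_span_base[OF finite_exponents, of "\<lambda>_. 0" t "\<lambda>\<alpha> x. \<Prod>i\<in>UNIV. (x $ i) ^ \<alpha> i"] by simp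
    then show ?thesis by simp
  qed
  have len: "curve_length \<gamma> = C * (real t)\<^sup>2"
    using ex[OF one] by (simp add: curve_length_def)
  have pos: "0 < C * (real t)\<^sup>2" using C t by simp
  have "design_curve t \<gamma>"
    unfolding design_curve_def
  proof (intro conjI ballI)
    show "path \<gamma>" using \<gamma>(1) by (simp add: simple_path_def)
    show "pathstart \<gamma> = pathfinish \<gamma>" using \<gamma>(2) by (simp add: pathstart_def pathfinish_def)
    show "finite (self_intersections \<gamma>)" using no_self_intersections[OF \<gamma>(1)] by simp
    fix F :: "real^4 \<Rightarrow> real" assume "F \<in> sphere_polys t"
    then obtain p where p: "p \<in> polys_deg_le t" "F = restrict p (sphere 0 1)" by (auto simp: sphere_polys_def)
    have "integral {0..1} (\<lambda>s. F (\<gamma> s) * speed \<gamma> s) = integral {0..1} (\<lambda>s. p (\<gamma> s) * speed \<gamma> s)"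
    proof (rule Henstock_Kurzweil_Integration.integral_cong)
      fix s :: real assume "s \<in> {0..1}"
      then have "\<gamma> s \<in> sphere 0 1" using \<gamma>(3) unfolding path_image_def by blast
      then show "F (\<gamma> s) * speed \<gamma> s = p (\<gamma> s) * speed \<gamma> s" unfolding p(2) by (simp only: restrict_apply if_True)
    qed
    also have "\<dots> = C * (real t)\<^sup>2 * sphere_mean p" using ex[OF p(1)] by simp
    also have "sphere_mean p = sphere_mean F" by (rule sphere_mean_cong) (simp add: p(2))
    finally have F: "integral {0..1} (\<lambda>s. F (\<gamma> s) * speed \<gamma> s) = C * (real t)\<^sup>2 * sphere_mean F" .
    have "1 / c * (c * m) = m" if "0 < c" for c m :: real using that by simp
    from this[OF pos] show "1 / curve_length \<gamma> * integral {0..1} (\<lambda>s. F (\<gamma> s) * speed \<gamma> s) =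
        1 / measure (sphere_measure :: (real ^ 4) measure) (sphere 0 1) * integral\<^sup>L sphere_measure F"
      unfolding len F by (simp only: sphere_mean_def real_scaleR_def)
  qed (use \<gamma> in auto)
  with \<gamma>(1) len show "\<exists>\<gamma> :: real \<Rightarrow> real ^ 4. design_curve t \<gamma> \<and> simple_path \<gamma> \<and> curve_length \<gamma> = C * (real t)\<^sup>2" by blast
qed simp

end
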